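(* Let $k$ be any algebraically closed field of characteristic zero and let $T_2=\operatorname{Sym}^2\langle y_1,\ldots,y_5\rangle_k$. For every integer $r$ with $6\le r\le 14$, the rational map $$\Phi_r:\operatorname{GL}_5\times(\mathbb A^5)^r\dashrightarrow \operatorname{Gr}(r,T_2),\qquad (g,a^{(1)},\ldots,a^{(r)})\longmapsto g\cdot\langle q(a^{(1)}),\ldots,q(a^{(r)})\rangle,$$ is dominant.
   Context: For $a=(a_1,\ldots,a_5)\in\mathbb A^5$, set $$q(a)=\sum_{i=1}^5 a_i y_i^2-\Bigl(\sum_{i=1}^5 a_i y_i\Bigr)^2\in T_2 .$$ $\operatorname{Gr}(r,T_2)$ is the Grassmannian of $r$-dimensional subspaces of the 15-dimensional space $T_2$ of quadratic forms in $y_1,\ldots,y_5$. The group $\operatorname{GL}_5$ acts on $T_2$ by linear substitution of the variables: if a quadratic form is represented by a symmetric $5\times 5$ matrix $M$, then $g$ sends $M$ to $gMg^{\mathsf T}$. The map $\Phi_r$ is defined on the open set where $q(a^{(1)}),\ldots,q(a^{(r)})$ are linearly independent. *)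

theory Defs
  imports
    "HOL-Analysis.Abstract_Topology"
    "HOL-Library.Poly_Mapping"
    "HOL-Computational_Algebra.Polynomial"
    "Jordan_Normal_Form.Determinant"
begin

section \<open>Multivariate polynomials\<close>

type_synonym ('x, 'a) mpol = "('x \<Rightarrow>\<^sub>0 nat) \<Rightarrow>\<^sub>0 'a"

abbreviation mcoeff :: "('x, 'a::zero) mpol \<Rightarrow> ('x \<Rightarrow>\<^sub>0 nat) \<Rightarrow> 'a" where
  "mcoeff \<equiv> Poly_Mapping.lookup"

definition Cst :: "'a::zero \<Rightarrow> ('x, 'a) mpol" where
  "Cst c = Poly_Mapping.single 0 c"

definition Var :: "'x \<Rightarrow> ('x, 'a::zero_neq_one) mpol" where
  "Var x = Poly_Mapping.single (Poly_Mapping.single x 1) 1"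

definition mdeg :: "('x \<Rightarrow>\<^sub>0 nat) \<Rightarrow> nat" where
  "mdeg m = (\<Sum>x\<in>Poly_Mapping.keys m. Poly_Mapping.lookup m x)"

definition homogeneous :: "nat \<Rightarrow> ('x, 'a::zero) mpol \<Rightarrow> bool" where
  "homogeneous d p \<longleftrightarrow> (\<forall>m\<in>Poly_Mapping.keys p. mdeg m = d)"

definition mvars :: "('x, 'a::zero) mpol \<Rightarrow> 'x set" where
  "mvars p = (\<Union>m\<in>Poly_Mapping.keys p. Poly_Mapping.keys m)"

definition monom_eval :: "('x \<Rightarrow> 'b::comm_semiring_1) \<Rightarrow> ('x \<Rightarrow>\<^sub>0 nat) \<Rightarrow> 'b" where
  "monom_eval f m = (\<Prod>x\<in>Poly_Mapping.keys m. f x ^ Poly_Mapping.lookup m x)"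

text \<open>Substitution of \<open>f x\<close> for the variable \<open>x\<close>, the coefficients being carried along
  \<open>\<phi>\<close>: \<open>\<phi> = (\<lambda>c. c)\<close> is evaluation at a point, \<open>\<phi> = Cst\<close> is substitution
  of polynomials.\<close>

definition msubst ::
  "('a::zero \<Rightarrow> 'b::comm_semiring_1) \<Rightarrow> ('x \<Rightarrow> 'b) \<Rightarrow> ('x, 'a) mpol \<Rightarrow> 'b" where
  "msubst \<phi> f p = (\<Sum>m\<in>Poly_Mapping.keys p. \<phi> (mcoeff p m) * monom_eval f m)"

abbreviation meval :: "('x \<Rightarrow> 'a) \<Rightarrow> ('x, 'a::comm_semiring_1) mpol \<Rightarrow> 'a" where
  "meval \<equiv> msubst (\<lambda>c. c)"

lemma Cst_simps:
  "Cst (0::'a::zero) = 0" "Cst (a + b) = Cst a + Cst (b::'b::comm_monoid_add)"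
  "Cst (c * d) = Cst c * Cst (d::'c::comm_semiring_1)" "Cst (1::'c) = 1"
  by (simp_all add: Cst_def single_add mult_single)

lemma mcoeff_Cst_mult: "mcoeff (Cst c * p) m = c * mcoeff p (m :: 'x \<Rightarrow>\<^sub>0 nat)"
  for p :: "('x, 'a::comm_semiring_1) mpol"
  unfolding Cst_def mult_map_scale_conv_mult[symmetric]
  by (simp add: Poly_Mapping.map.rep_eq when_def)

global_interpretation mp: vector_space "\<lambda>(c::'a::field) (p::('x, 'a) mpol). Cst c * p"
  by unfold_locales (simp_all add: Cst_simps algebra_simps)

lemma monom_eval_superset:
  assumes "finite A" "Poly_Mapping.keys m \<subseteq> A"
  shows "monom_eval f m = (\<Prod>x\<in>A. f x ^ Poly_Mapping.lookup m x)"
  unfolding monom_eval_def using assms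
  by (intro prod.mono_neutral_left) (auto simp: in_keys_iff)

lemma monom_eval_add: "monom_eval f (m + n) = monom_eval f m * monom_eval f n"
proof -
  let ?A = "Poly_Mapping.keys m \<union> Poly_Mapping.keys n"
  have "monom_eval f (m + n) = (\<Prod>x\<in>?A. f x ^ Poly_Mapping.lookup (m + n) x)"
    by (rule monom_eval_superset) (simp, rule keys_add)
  also have "\<dots> = (\<Prod>x\<in>?A. f x ^ Poly_Mapping.lookup m x) * (\<Prod>x\<in>?A. f x ^ Poly_Mapping.lookup n x)"
    by (simp add: lookup_add power_add prod.distrib)
  also have "\<dots> = monom_eval f m * monom_eval f n"
    by (subst (1 2) monom_eval_superset[of ?A]) auto
  finally show ?thesis .
qed

lemma monom_eval_0: "monom_eval f 0 = 1"
  by (simp add: monom_eval_def)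

lemma monom_eval_single: "monom_eval f (Poly_Mapping.single x n) = f x ^ n"
  by (subst monom_eval_superset[of "{x}"]) auto

lemma mpol_sum_monomials:
  "p = (\<Sum>m\<in>Poly_Mapping.keys p. Poly_Mapping.single m (mcoeff p m))"
  for p :: "('x, 'a::comm_monoid_add) mpol"
  by (rule poly_mapping_eqI)
     (auto simp: lookup_sum lookup_single when_def in_keys_iff)

locale coeff_hom =
  fixes \<phi> :: "'a::comm_semiring_1 \<Rightarrow> 'b::comm_semiring_1"
  assumes hom0: "\<phi> 0 = 0" and hom1: "\<phi> 1 = 1"
    and hom_add: "\<phi> (a + b) = \<phi> a + \<phi> b" and hom_mult: "\<phi> (a * b) = \<phi> a * \<phi> b"
begin

lemma msubst_superset:
  assumes "finite A" "Poly_Mapping.keys p \<subseteq> A"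
  shows "msubst \<phi> f p = (\<Sum>m\<in>A. \<phi> (mcoeff p m) * monom_eval f m)"
  unfolding msubst_def using assms
  by (intro sum.mono_neutral_left) (auto simp: in_keys_iff hom0)

lemma msubst_add: "msubst \<phi> f (p + q) = msubst \<phi> f p + msubst \<phi> f q"
proof -
  let ?A = "Poly_Mapping.keys p \<union> Poly_Mapping.keys q"
  have "msubst \<phi> f (p + q) = (\<Sum>m\<in>?A. \<phi> (mcoeff (p + q) m) * monom_eval f m)"
    by (rule msubst_superset) (simp, rule keys_add)
  also have "\<dots> = (\<Sum>m\<in>?A. \<phi> (mcoeff p m) * monom_eval f m) + (\<Sum>m\<in>?A. \<phi> (mcoeff q m) * monom_eval f m)"
    by (simp add: lookup_add hom_add sum.distrib algebra_simps)
  also have "\<dots> = msubst \<phi> f p + msubst \<phi> f q"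
    by (subst (1 2) msubst_superset[of ?A]) auto
  finally show ?thesis .
qed

lemma msubst_0: "msubst \<phi> f 0 = 0"
  by (simp add: msubst_def)

lemma msubst_sum: "msubst \<phi> f (sum p I) = (\<Sum>i\<in>I. msubst \<phi> f (p i))"
  by (induction I rule: infinite_finite_induct) (auto simp: msubst_0 msubst_add)

lemma msubst_single: "msubst \<phi> f (Poly_Mapping.single m c) = \<phi> c * monom_eval f m"
  by (subst msubst_superset[of "{m}"]) auto

lemma msubst_Cst: "msubst \<phi> f (Cst c) = \<phi> c"
  by (simp add: Cst_def msubst_single monom_eval_0)

lemma msubst_Var: "msubst \<phi> f (Var x) = f x"
  by (simp add: Var_def msubst_single monom_eval_single hom1)

lemma msubst_1: "msubst \<phi> f 1 = 1"
  using msubst_Cst[of f 1] by (simp add: Cst_simps hom1)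

lemma msubst_mult: "msubst \<phi> f (p * q) = msubst \<phi> f p * msubst \<phi> f q"
proof -
  let ?P = "Poly_Mapping.keys p" and ?Q = "Poly_Mapping.keys q"
  have "p * q = (\<Sum>m\<in>?P. Poly_Mapping.single m (mcoeff p m)) * (\<Sum>n\<in>?Q. Poly_Mapping.single n (mcoeff q n))"
    by (simp flip: mpol_sum_monomials)
  also have "\<dots> = (\<Sum>m\<in>?P. \<Sum>n\<in>?Q. Poly_Mapping.single (m + n) (mcoeff p m * mcoeff q n))"
    by (simp add: sum_product mult_single)
  finally have "msubst \<phi> f (p * q) =
      (\<Sum>m\<in>?P. \<Sum>n\<in>?Q. \<phi> (mcoeff p m * mcoeff q n) * monom_eval f (m + n))"
    by (simp add: msubst_sum msubst_single)
  also have "\<dots> = msubst \<phi> f p * msubst \<phi> f q"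
    by (simp add: msubst_def sum_product hom_mult monom_eval_add mult_ac)
  finally show ?thesis .
qed

end

global_interpretation meval: coeff_hom "\<lambda>c. c"
  by unfold_locales auto

global_interpretation mcst: coeff_hom Cst
  by unfold_locales (auto simp: Cst_simps)

lemma monom_eval_scale: "monom_eval (\<lambda>x. c * f x) m = c ^ mdeg m * monom_eval f m"
  by (simp add: monom_eval_def mdeg_def power_mult_distrib prod.distrib power_sum)

lemma meval_homogeneous:
  "homogeneous d F \<Longrightarrow> meval (\<lambda>x. c * f x) F = c ^ d * meval f F"
  unfolding msubst_def
  by (simp add: monom_eval_scale homogeneous_def sum_distrib_left mult_ac)

lemma mdeg_superset:
  assumes "finite A" "Poly_Mapping.keys m \<subseteq> A"
  shows "mdeg m = (\<Sum>x\<in>A. Poly_Mapping.lookup m x)"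
  unfolding mdeg_def using assms
  by (intro sum.mono_neutral_left) (auto simp: in_keys_iff)

lemma mdeg_add: "mdeg (m + n) = mdeg m + mdeg n"
proof -
  let ?A = "Poly_Mapping.keys m \<union> Poly_Mapping.keys n"
  have "mdeg (m + n) = (\<Sum>x\<in>?A. Poly_Mapping.lookup (m + n) x)"
    by (rule mdeg_superset) (simp, rule keys_add)
  also have "\<dots> = (\<Sum>x\<in>?A. Poly_Mapping.lookup m x) + (\<Sum>x\<in>?A. Poly_Mapping.lookup n x)"
    by (simp add: lookup_add sum.distrib)
  also have "\<dots> = mdeg m + mdeg n"
    by (subst (1 2) mdeg_superset[of ?A]) auto
  finally show ?thesis .
qed

lemma homogeneous_mult:
  fixes p q :: "('x, 'a::comm_semiring_1) mpol"
  assumes "homogeneous d p" "homogeneous e q"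
  shows "homogeneous (d + e) (p * q)"
  using assms keys_mult[of p q] by (fastforce simp: homogeneous_def mdeg_add)

lemma mvars_mult: "mvars (p * q) \<subseteq> mvars p \<union> mvars q"
  for p q :: "('x, 'a::comm_semiring_1) mpol"
  using keys_mult[of p q] keys_add unfolding mvars_def by fastforce

section \<open>Quadratic forms in five variables\<close>

text \<open>The variables \<open>y\<^sub>1, \<dots>, y\<^sub>5\<close> are \<open>Var 0, \<dots>, Var 4\<close>.\<close>

definition T2 :: "(nat, 'a::zero) mpol set" where
  "T2 = {p. homogeneous 2 p \<and> mvars p \<subseteq> {..<5}}"

definition T2_monoms :: "(nat \<Rightarrow>\<^sub>0 nat) set" where
  "T2_monoms = {m. Poly_Mapping.keys m \<subseteq> {..<5} \<and> mdeg m = 2}"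

definition q :: "'a::comm_ring_1 vec \<Rightarrow> (nat, 'a) mpol" where
  "q a = (\<Sum>i<5. Cst (a $ i) * Var i ^ 2) - (\<Sum>i<5. Cst (a $ i) * Var i) ^ 2"

definition GL5 :: "'a::comm_ring_1 mat set" where
  "GL5 = {g \<in> carrier_mat 5 5. invertible_mat g}"

definition act :: "'a::comm_ring_1 mat \<Rightarrow> (nat, 'a) mpol \<Rightarrow> (nat, 'a) mpol" where
  "act g = msubst Cst (\<lambda>j. \<Sum>i<5. Cst (g $$ (i, j)) * Var i)"

text \<open>In terms of symmetric matrices this is \<open>M \<mapsto> g M g\<^sup>T\<close>.\<close>

definition quad_form :: "'a::comm_ring_1 mat \<Rightarrow> (nat, 'a) mpol" where
  "quad_form M = (\<Sum>i<5. \<Sum>j<5. Cst (M $$ (i, j)) * Var i * Var j)"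

lemma act_quad_form:
  fixes g M :: "'a::comm_ring_1 mat"
  assumes g: "g \<in> carrier_mat 5 5" and M: "M \<in> carrier_mat 5 5"
  shows "act g (quad_form M) = quad_form (g * M * transpose_mat g)"
proof -
  have ent: "(g * M * transpose_mat g) $$ (i, j) =
      (\<Sum>l<5. \<Sum>k<5. g $$ (i, k) * M $$ (k, l) * g $$ (j, l))" if "i < 5" "j < 5" for i j
    using that g M
    by (simp add: scalar_prod_def sum_distrib_left sum_distrib_right lessThan_atLeast0 mult.assoc)
      (rule sum.swap)
  have Cs: "Cst (sum f A) = (\<Sum>x\<in>A. Cst (f x))" for f :: "nat \<Rightarrow> 'a" and A
    by (induction A rule: infinite_finite_induct) (auto simp: Cst_simps)
  have "act g (quad_form M) = (\<Sum>k<5. \<Sum>l<5. Cst (M $$ (k, l)) *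
      (\<Sum>i<5. Cst (g $$ (i, k)) * Var i) * (\<Sum>j<5. Cst (g $$ (j, l)) * Var j))"
    by (simp add: act_def quad_form_def mcst.msubst_sum mcst.msubst_mult mcst.msubst_Cst mcst.msubst_Var)
  also have "\<dots> = (\<Sum>k<5. \<Sum>l<5. \<Sum>i<5. \<Sum>j<5.
      Cst (g $$ (i, k) * M $$ (k, l) * g $$ (j, l)) * Var i * Var j)"
    by (simp add: sum_product sum_distrib_left Cst_simps mult_ac)
  also have "\<dots> = (\<Sum>k<5. \<Sum>i<5. \<Sum>l<5. \<Sum>j<5.
      Cst (g $$ (i, k) * M $$ (k, l) * g $$ (j, l)) * Var i * Var j)"
    by (intro sum.cong refl sum.swap)
  also have "\<dots> = (\<Sum>i<5. \<Sum>k<5. \<Sum>l<5. \<Sum>j<5.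
      Cst (g $$ (i, k) * M $$ (k, l) * g $$ (j, l)) * Var i * Var j)"
    by (rule sum.swap)
  also have "\<dots> = (\<Sum>i<5. \<Sum>k<5. \<Sum>j<5. \<Sum>l<5.
      Cst (g $$ (i, k) * M $$ (k, l) * g $$ (j, l)) * Var i * Var j)"
    by (intro sum.cong refl sum.swap)
  also have "\<dots> = (\<Sum>i<5. \<Sum>j<5. \<Sum>k<5. \<Sum>l<5.
      Cst (g $$ (i, k) * M $$ (k, l) * g $$ (j, l)) * Var i * Var j)"
    by (intro sum.cong refl sum.swap)
  also have "\<dots> = (\<Sum>i<5. \<Sum>j<5. \<Sum>l<5. \<Sum>k<5.
      Cst (g $$ (i, k) * M $$ (k, l) * g $$ (j, l)) * Var i * Var j)"
    by (intro sum.cong refl sum.swap)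
  also have "\<dots> = quad_form (g * M * transpose_mat g)"
    unfolding quad_form_def by (intro sum.cong refl) (simp add: ent Cs sum_distrib_right)
  finally show ?thesis .
qed

lemma T2_span: "(T2 :: (nat, 'a::field) mpol set) = mp.span ((\<lambda>m. Poly_Mapping.single m 1) ` T2_monoms)"
proof (intro equalityI subsetI)
  fix p :: "(nat, 'a) mpol" assume p: "p \<in> T2"
  have "p = (\<Sum>m\<in>Poly_Mapping.keys p. Cst (mcoeff p m) * Poly_Mapping.single m 1)"
    by (simp add: Cst_def mult_single flip: mpol_sum_monomials)
  also have "\<dots> \<in> mp.span ((\<lambda>m. Poly_Mapping.single m 1) ` T2_monoms)"
    using p by (intro mp.span_sum mp.span_scale mp.span_base)
      (auto simp: T2_def T2_monoms_def homogeneous_def mvars_def)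
  finally show "p \<in> mp.span ((\<lambda>m. Poly_Mapping.single m 1) ` T2_monoms)" .
next
  have eq: "T2 = {p :: (nat, 'a) mpol. \<forall>m. m \<notin> T2_monoms \<longrightarrow> mcoeff p m = 0}"
  proof -
    have "p \<in> T2 \<longleftrightarrow> Poly_Mapping.keys p \<subseteq> T2_monoms" for p :: "(nat, 'a) mpol"
      unfolding T2_def T2_monoms_def homogeneous_def mvars_def by blast
    then show ?thesis by (auto simp: subset_iff in_keys_iff)
  qed
  have sub: "mp.subspace (T2 :: (nat, 'a) mpol set)"
    unfolding eq by (rule mp.subspaceI) (auto simp: lookup_add mcoeff_Cst_mult)
  fix p :: "(nat, 'a) mpol" assume "p \<in> mp.span ((\<lambda>m. Poly_Mapping.single m 1) ` T2_monoms)"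
  then show "p \<in> T2"
    by (rule subsetD[OF mp.span_minimal[OF _ sub], rotated])
       (auto simp: eq lookup_single when_def)
qed

lemma T2_monoms_eq: "T2_monoms =
  (\<lambda>(i, j). Poly_Mapping.single i 1 + Poly_Mapping.single j 1) ` {(i, j). i \<le> j \<and> j < 5}"
proof (intro equalityI subsetI)
  fix m assume "m \<in> T2_monoms"
  then have k: "Poly_Mapping.keys m \<subseteq> {..<5}" and d: "mdeg m = 2"
    by (auto simp: T2_monoms_def)
  have "Poly_Mapping.keys m \<noteq> {}" using d by (auto simp: mdeg_def)
  then obtain i where i: "i \<in> Poly_Mapping.keys m" by blast
  define n where "n = m - Poly_Mapping.single i 1"
  have mn: "m = n + Poly_Mapping.single i 1"
    by (rule poly_mapping_eqI)
       (use i in \<open>auto simp: n_def lookup_add lookup_minus lookup_single when_def in_keys_iff\<close>)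
  have "mdeg (Poly_Mapping.single i 1) = 1" for i :: nat by (simp add: mdeg_def)
  then have dn: "mdeg n = 1" using d by (simp add: mn mdeg_add)
  then have "Poly_Mapping.keys n \<noteq> {}" by (auto simp: mdeg_def)
  then obtain j where j: "j \<in> Poly_Mapping.keys n" by blast
  define l where "l = n - Poly_Mapping.single j 1"
  have nl: "n = l + Poly_Mapping.single j 1"
    by (rule poly_mapping_eqI)
       (use j in \<open>auto simp: l_def lookup_add lookup_minus lookup_single when_def in_keys_iff\<close>)
  have "mdeg l = 0" using dn \<open>\<And>i. mdeg (Poly_Mapping.single i 1) = 1\<close> by (simp add: nl mdeg_add)
  then have "l = 0" by (auto simp: mdeg_def in_keys_iff intro!: poly_mapping_eqI)
  then have m: "m = Poly_Mapping.single j 1 + Poly_Mapping.single i 1" using mn nl by simp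
  have "i \<in> Poly_Mapping.keys m" "j \<in> Poly_Mapping.keys m"
    by (auto simp: m in_keys_iff lookup_add)
  then have "i < 5" "j < 5" using k by auto
  then show "m \<in> (\<lambda>(i, j). Poly_Mapping.single i 1 + Poly_Mapping.single j 1) ` {(i, j). i \<le> j \<and> j < 5}"
    using m image_eqI[of m "\<lambda>(i, j). Poly_Mapping.single i 1 + Poly_Mapping.single j 1" "(i, j)"]
      image_eqI[of m "\<lambda>(i, j). Poly_Mapping.single i 1 + Poly_Mapping.single j 1" "(j, i)"]
    by (cases "i \<le> j") (simp_all add: add.commute)
next
  fix m :: "nat \<Rightarrow>\<^sub>0 nat"
  assume "m \<in> (\<lambda>(i, j). Poly_Mapping.single i 1 + Poly_Mapping.single j 1) ` {(i, j). i \<le> j \<and> j < 5}"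
  then obtain i j where ij: "i \<le> j" "j < 5" "m = Poly_Mapping.single i 1 + Poly_Mapping.single j 1"
    by auto
  have "mdeg (Poly_Mapping.single i 1) = 1" for i :: nat by (simp add: mdeg_def)
  then have "mdeg m = 2" by (simp add: ij mdeg_add)
  moreover have "Poly_Mapping.keys m \<subseteq> {i, j}"
    using keys_add[of "Poly_Mapping.single i 1" "Poly_Mapping.single j (1::nat)"]
    unfolding ij(3) by (simp add: insert_commute)
  ultimately show "m \<in> T2_monoms" using ij(1,2) by (auto simp: T2_monoms_def)
qed

lemma card_T2_monoms: "card T2_monoms = 15"
proof -
  let ?f = "\<lambda>(i, j). Poly_Mapping.single i (1::nat) + Poly_Mapping.single j 1"
  have "{(i, j). i \<le> j \<and> j < (5::nat)} = (SIGMA i:{..<5}. {i..<5})" by auto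
  then have "card {(i, j). i \<le> j \<and> j < (5::nat)} = (\<Sum>i<5. 5 - i)" by simp
  also have "\<dots> = 15" by (simp add: eval_nat_numeral)
  finally have c: "card {(i, j). i \<le> j \<and> j < (5::nat)} = 15" .
  have "inj_on ?f {(i, j). i \<le> j \<and> j < (5::nat)}"
  proof (rule inj_onI, clarify)
    fix i j k l :: nat
    assume le: "i \<le> j" "k \<le> l"
      and e: "Poly_Mapping.single i (1::nat) + Poly_Mapping.single j 1 =
              Poly_Mapping.single k 1 + Poly_Mapping.single l 1"
    have "Poly_Mapping.lookup (Poly_Mapping.single i (1::nat) + Poly_Mapping.single j 1) x =
          Poly_Mapping.lookup (Poly_Mapping.single k 1 + Poly_Mapping.single l 1) x" for x
      using e by simp
    then have x: "(if i = x then 1 else 0) + (if j = x then 1 else 0) =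
       (if k = x then 1 else (0::nat)) + (if l = x then 1 else 0)" for x
      by (simp only: lookup_add lookup_single when_def)
    have "i = k \<or> i = l" using x[of i] by (auto split: if_splits)
    moreover have "j = k \<or> j = l" using x[of j] by (auto split: if_splits)
    moreover have "k = i \<or> k = j" using x[of k] by (auto split: if_splits)
    moreover have "l = i \<or> l = j" using x[of l] by (auto split: if_splits)
    ultimately show "i = k \<and> j = l" using le by linarith
  qed
  then show ?thesis unfolding T2_monoms_eq by (subst card_image) (auto simp: c)
qed

lemma finite_T2_monoms: "finite T2_monoms"
  by (rule card_ge_0_finite) (simp add: card_T2_monoms)

lemma dim_T2: "mp.dim (T2 :: (nat, 'a::field) mpol set) = 15"
proof -
  let ?s = "\<lambda>m. Poly_Mapping.single m (1::'a) :: (nat, 'a) mpol"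
  have inj: "inj_on ?s T2_monoms"
    by (rule inj_onI) (metis lookup_single_eq lookup_single_not_eq one_neq_zero)
  have "mp.independent (?s ` T2_monoms)"
  proof (rule mp.independent_if_scalars_zero)
    show "finite (?s ` T2_monoms)" using finite_T2_monoms by simp
    fix f :: "(nat, 'a) mpol \<Rightarrow> 'a" and p
    assume 0: "(\<Sum>p\<in>?s ` T2_monoms. Cst (f p) * p) = 0" and "p \<in> ?s ` T2_monoms"
    then obtain m where m: "m \<in> T2_monoms" "p = ?s m" by auto
    have "0 = mcoeff (\<Sum>n\<in>T2_monoms. Cst (f (?s n)) * ?s n) m"
      using 0 by (simp add: sum.reindex[OF inj])
    also have "\<dots> = f (?s m)" using m finite_T2_monoms
      by (simp add: lookup_sum mcoeff_Cst_mult lookup_single when_def if_distrib[of "(*) _"] cong: if_cong)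
    finally show "f p = 0" using m by simp
  qed
  then show ?thesis unfolding T2_span
    by (subst mp.dim_span_eq_card_independent) (simp_all add: card_image[OF inj] card_T2_monoms)
qed

section \<open>The Grassmannian and its Zariski topology\<close>

definition Gr :: "nat \<Rightarrow> (nat, 'a::field) mpol set set" where
  "Gr r = {W. mp.subspace W \<and> W \<subseteq> T2 \<and> mp.dim W = r}"

definition basis_of :: "nat \<Rightarrow> (nat \<Rightarrow> (nat, 'a::field) mpol) \<Rightarrow> (nat, 'a) mpol set \<Rightarrow> bool" where
  "basis_of r b W \<longleftrightarrow>
     inj_on b {..<r} \<and> mp.independent (b ` {..<r}) \<and> mp.span (b ` {..<r}) = W"

text \<open>The Pluecker coordinates of the row space of the coefficient matrix of
  \<open>b\<close> (rows \<open>b 0, \<dots>, b (r - 1)\<close>, columns the monomials of degree 2) are its maximal minors; they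
  are indexed by the \<open>r\<close>-element sets \<open>J\<close> of monomials. The order in which the columns are
  listed only affects signs; we use the linear order that \<^theory>\<open>HOL-Library.Poly_Mapping\<close>
  puts on monomials.\<close>

definition plucker :: "nat \<Rightarrow> (nat \<Rightarrow> (nat, 'a::comm_ring_1) mpol) \<Rightarrow> (nat \<Rightarrow>\<^sub>0 nat) set \<Rightarrow> 'a" where
  "plucker r b J = det (mat r r (\<lambda>(i, j). mcoeff (b i) (sorted_list_of_set J ! j)))"

definition plucker_polys :: "nat \<Rightarrow> ((nat \<Rightarrow>\<^sub>0 nat) set, 'a::zero) mpol set" where
  "plucker_polys r =
     {F. (\<exists>d. homogeneous d F) \<and> mvars F \<subseteq> {J. J \<subseteq> T2_monoms \<and> card J = r}}"

definition zero_locus ::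
  "nat \<Rightarrow> ((nat \<Rightarrow>\<^sub>0 nat) set, 'a::field) mpol set \<Rightarrow> (nat, 'a) mpol set set" where
  "zero_locus r S =
     {W \<in> Gr r. \<forall>F\<in>S. \<forall>b. basis_of r b W \<longrightarrow> meval (plucker r b) F = 0}"

definition gr_zariski :: "nat \<Rightarrow> (nat, 'a::field) mpol set topology" where
  "gr_zariski r = topology (\<lambda>U. \<exists>S\<subseteq>plucker_polys r. U = Gr r - zero_locus r S)"

lemma plucker_change:
  assumes "basis_of r b W" "basis_of r b' W"
  obtains c where "\<And>J. plucker r b' J = c * plucker r b J"
proof -
  have inj: "inj_on b {..<r}" using assms by (simp add: basis_of_def)
  have "\<exists>u. b' i = (\<Sum>k<r. Cst (u k) * b k)" if "i < r" for i
  proof -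
    have "b' i \<in> mp.span (b ` {..<r})"
      using assms that by (auto simp: basis_of_def intro: mp.span_base)
    then obtain u where "b' i = (\<Sum>v\<in>b ` {..<r}. Cst (u v) * v)"
      by (auto simp: mp.span_finite)
    then show ?thesis by (intro exI[of _ "u \<circ> b"]) (simp add: sum.reindex[OF inj])
  qed
  then obtain u where u: "\<And>i. i < r \<Longrightarrow> b' i = (\<Sum>k<r. Cst (u i k) * b k)" by metis
  let ?U = "mat r r (\<lambda>(i, k). u i k)"
  let ?B = "\<lambda>b J. mat r r (\<lambda>(i, j). mcoeff (b i) (sorted_list_of_set J ! j))"
  have "?B b' J = ?U * ?B b J" for J
    by (rule eq_matI)
       (auto simp: u scalar_prod_def lookup_sum mcoeff_Cst_mult lessThan_atLeast0)
  then have "plucker r b' J = det ?U * plucker r b J" for J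
    by (simp add: plucker_def det_mult[of _ r])
  then show thesis by (rule that)
qed

lemma plucker_zero_indep:
  assumes "basis_of r b W" "basis_of r b' W" "homogeneous d F" "meval (plucker r b) F = 0"
  shows "meval (plucker r b') F = 0"
proof -
  obtain c where "\<And>J. plucker r b' J = c * plucker r b J"
    using plucker_change[OF assms(1,2)] by blast
  then have "plucker r b' = (\<lambda>J. c * plucker r b J)" by blast
  then show ?thesis using assms(3,4) by (simp add: meval_homogeneous)
qed

lemma zero_locus_Un:
  assumes S: "S \<subseteq> plucker_polys r" and T: "T \<subseteq> plucker_polys r"
  shows "zero_locus r S \<union> zero_locus r T = zero_locus r {F * G |F G. F \<in> S \<and> G \<in> T}"
proof (intro equalityI subsetI)
  fix W assume "W \<in> zero_locus r S \<union> zero_locus r T"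
  then show "W \<in> zero_locus r {F * G |F G. F \<in> S \<and> G \<in> T}"
    by (fastforce simp: zero_locus_def meval.msubst_mult)
next
  fix W assume W: "W \<in> zero_locus r {F * G |F G. F \<in> S \<and> G \<in> T}"
  show "W \<in> zero_locus r S \<union> zero_locus r T"
  proof (cases "W \<in> zero_locus r S")
    case False
    then obtain F b where F: "F \<in> S" "basis_of r b W" "meval (plucker r b) F \<noteq> 0"
      using W by (auto simp: zero_locus_def)
    obtain d where "homogeneous d F" using F S by (auto simp: plucker_polys_def)
    then have "meval (plucker r b') F \<noteq> 0" if "basis_of r b' W" for b'
      using plucker_zero_indep[OF that F(2)] F(3) by blast
    then show ?thesis using W F by (fastforce simp: zero_locus_def meval.msubst_mult)
  qed auto
qed

lemma istopology_gr: "istopology (\<lambda>U. \<exists>S\<subseteq>plucker_polys r. U = Gr r - zero_locus r S)"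
  unfolding istopology_def
proof (intro conjI allI impI)
  fix U V :: "(nat, 'a) mpol set set"
  assume "\<exists>S\<subseteq>plucker_polys r. U = Gr r - zero_locus r S"
    and "\<exists>S\<subseteq>plucker_polys r. V = Gr r - zero_locus r S"
  then obtain S T where S: "S \<subseteq> plucker_polys r" "U = Gr r - zero_locus r S"
    and T: "T \<subseteq> plucker_polys r" "V = Gr r - zero_locus r T" by blast
  have "U \<inter> V = Gr r - zero_locus r {F * G |F G. F \<in> S \<and> G \<in> T}"
    unfolding zero_locus_Un[OF S(1) T(1), symmetric] using S T by blast
  moreover have "{F * G |F G. F \<in> S \<and> G \<in> T} \<subseteq> plucker_polys r"
  proof clarify
    fix F G assume "F \<in> S" "G \<in> T"
    then have "F \<in> plucker_polys r" "G \<in> plucker_polys r" using S T by auto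
    then obtain d e where "homogeneous d F" "homogeneous e G"
      "mvars F \<subseteq> {J. J \<subseteq> T2_monoms \<and> card J = r}" "mvars G \<subseteq> {J. J \<subseteq> T2_monoms \<and> card J = r}"
      unfolding plucker_polys_def by blast
    then have "homogeneous (d + e) (F * G)" "mvars (F * G) \<subseteq> {J. J \<subseteq> T2_monoms \<and> card J = r}"
      using homogeneous_mult order_trans[OF mvars_mult[of F G]] by simp_all
    then show "F * G \<in> plucker_polys r"
      unfolding plucker_polys_def by blast
  qed
  ultimately show "\<exists>S\<subseteq>plucker_polys r. U \<inter> V = Gr r - zero_locus r S" by blast
next
  fix K :: "(nat, 'a) mpol set set set"
  assume "\<forall>U\<in>K. \<exists>S\<subseteq>plucker_polys r. U = Gr r - zero_locus r S"
  then obtain S where S: "\<And>U. U \<in> K \<Longrightarrow> S U \<subseteq> plucker_polys r \<and> U = Gr r - zero_locus r (S U)"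
    by metis
  have "\<Union>K = (\<Union>U\<in>K. Gr r - zero_locus r (S U))" using S by blast
  also have "\<dots> = Gr r - zero_locus r (\<Union>(S ` K))"
    by (auto simp: zero_locus_def)
  finally show "\<exists>S\<subseteq>plucker_polys r. \<Union>K = Gr r - zero_locus r S"
    using S by (intro exI[of _ "\<Union>(S ` K)"]) auto
qed

lemma openin_gr_zariski:
  "openin (gr_zariski r) U \<longleftrightarrow> (\<exists>S\<subseteq>plucker_polys r. U = Gr r - zero_locus r S)"
  unfolding gr_zariski_def by (simp add: topology_inverse'[OF istopology_gr])

lemma basis_of_exists:
  assumes "W \<in> Gr r"
  obtains b where "basis_of r b W"
proof -
  have W: "mp.subspace W" "W \<subseteq> T2" "mp.dim W = r" using assms by (auto simp: Gr_def)
  obtain B where B: "B \<subseteq> W" "mp.independent B" "W \<subseteq> mp.span B" "card B = mp.dim W"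
    using mp.basis_exists by blast
  have "B \<subseteq> mp.span ((\<lambda>m. Poly_Mapping.single m 1) ` T2_monoms)"
    using B W by (simp add: T2_span)
  then have "finite B"
    using mp.independent_span_bound[OF _ B(2)] finite_T2_monoms by blast
  then obtain b where "bij_betw b {..<r} B"
    using B W by (metis ex_bij_betw_nat_finite lessThan_atLeast0)
  then have "basis_of r b W"
    using B W mp.span_minimal[of B W] by (auto simp: basis_of_def bij_betw_def)
  then show thesis by (rule that)
qed

lemma topspace_gr_zariski: "topspace (gr_zariski r) = (Gr r :: (nat, 'a::field) mpol set set)"
proof
  show "topspace (gr_zariski r) \<subseteq> (Gr r :: (nat, 'a) mpol set set)"
    by (auto simp: topspace_def openin_gr_zariski)
  have "W \<notin> zero_locus r {1}" for W :: "(nat, 'a) mpol set"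
  proof
    assume W: "W \<in> zero_locus r {1}"
    then obtain b where "basis_of r b W"
      using basis_of_exists[of W r] by (auto simp: zero_locus_def)
    then show False using W by (simp add: zero_locus_def meval.msubst_1)
  qed
  then have "zero_locus r {1 :: ((nat \<Rightarrow>\<^sub>0 nat) set, 'a) mpol} = {}" by blast
  moreover have "{1 :: ((nat \<Rightarrow>\<^sub>0 nat) set, 'a) mpol} \<subseteq> plucker_polys r"
    by (simp add: plucker_polys_def homogeneous_def mvars_def)
  ultimately have "openin (gr_zariski r) (Gr r :: (nat, 'a) mpol set set)"
    unfolding openin_gr_zariski by (intro exI[of _ "{1}"]) simp
  then show "Gr r \<subseteq> topspace (gr_zariski r :: (nat, 'a) mpol set topology)" by (rule openin_subset)
qed

lemma closedin_gr_zariski: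
  "closedin (gr_zariski r) Z \<longleftrightarrow> (\<exists>S\<subseteq>plucker_polys r. Z = zero_locus r S)"
proof -
  have "zero_locus r S \<subseteq> Gr r" for S :: "((nat \<Rightarrow>\<^sub>0 nat) set, 'a) mpol set"
    by (auto simp: zero_locus_def)
  then show ?thesis
    unfolding closedin_def openin_gr_zariski topspace_gr_zariski by blast
qed

section \<open>The rational map\<close>

definition Phi_domain :: "nat \<Rightarrow> ('a::field mat \<times> (nat \<Rightarrow> 'a vec)) set" where
  "Phi_domain r = {(g, a). g \<in> GL5 \<and> a \<in> {..<r} \<rightarrow>\<^sub>E carrier_vec 5 \<and>
     inj_on (\<lambda>i. q (a i)) {..<r} \<and> mp.independent ((\<lambda>i. q (a i)) ` {..<r})}"

definition Phi :: "nat \<Rightarrow> 'a::field mat \<times> (nat \<Rightarrow> 'a vec) \<Rightarrow> (nat, 'a) mpol set" where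
  "Phi r = (\<lambda>(g, a). act g ` mp.span ((\<lambda>i. q (a i)) ` {..<r}))"

text \<open>A map defined on the nonempty open subset \<open>D\<close> of an irreducible variety is dominant, as
  a rational map, iff the image of \<open>D\<close> is dense.\<close>

definition dominant :: "'s set \<Rightarrow> ('s \<Rightarrow> 't) \<Rightarrow> 't topology \<Rightarrow> bool" where
  "dominant D f Y \<longleftrightarrow> f ` D \<subseteq> topspace Y \<and> Abstract_Topology.closure_of Y (f ` D) = topspace Y"

end

theory Submission
  imports Defs
begin

text \<open>The map is dominant as soon as the differential of
  \<open>(g, h, a) \<mapsto> (\<Sum>\<^sub>j h\<^sub>i\<^sub>j g \<cdot> q(a\<^sub>j))\<^sub>i \<in> T\<^sub>2\<^sup>r\<close> is surjective at one point with \<open>g = 1\<close>, \<open>h = 1\<close>;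
  the forms \<open>q(a\<^sub>j)\<close> need not be independent there. By duality this says: symmetric matrices
  \<open>S\<^sub>1, \<dots>, S\<^sub>r\<close> such that every \<open>S\<^sub>i\<close> is orthogonal to all \<open>q(a\<^sub>j)\<close> and to the derivative of \<open>q\<close>
  at \<open>a\<^sub>i\<close>, and such that \<open>\<Sum>\<^sub>i q(a\<^sub>i) S\<^sub>i = 0\<close>, must vanish. For \<open>r \<ge> 10\<close> the conditions on the single
  \<open>S\<^sub>i\<close> already suffice and ten points can be repeated; for \<open>r = 6, \<dots>, 9\<close> explicit integral points
  with sparse equations do the job.\<close>

section \<open>Polynomials vanishing along curves in all directions\<close>

text \<open>Dominance is tested one polynomial at a time: a Pluecker polynomial F vanishing on the
  image, pulled back to the coefficients of r forms, must vanish identically. The surjective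
  differential supplies curves of frames in every direction from the base frame. The obstacle is
  that these curves meet frames where \<open>Phi\<close> is undefined. Dependent frames are absorbed
  by multiplying with one Pluecker coordinate; this also covers constant F and thus shows that the
  domain is nonempty. Singular g are absorbed by multiplying with det g(t) and cancelling it in
  k[t]. Counting: the matrices have 15r entries and meet r^2 conditions from h, 5r from the points
  and 25 from g. The trace of the last ones is a sum of conditions from h (scalars in GL_5 fix every
  subspace), so at most 24 of them are new. The surplus r^2 + 5r + 24 - 15r = (r-4)(r-6) is negative
  at r = 5 and 0 at r = 6: the smallest case has no slack. A single matrix has 15 entries and r + 5
  conditions of its own, whence the threshold 10.\<close>

lemma msubst_natural:
  assumes "coeff_hom \<psi>"
  shows "\<psi> (msubst \<phi> f p) = msubst (\<lambda>c. \<psi> (\<phi> c)) (\<lambda>x. \<psi> (f x)) p"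
proof -
  interpret h: coeff_hom \<psi> by fact
  have pow: "\<psi> (a ^ n) = \<psi> a ^ n" for a n
    by (induction n) (auto simp: h.hom1 h.hom_mult)
  have prd: "\<psi> (prod g A) = (\<Prod>x\<in>A. \<psi> (g x))" for g and A :: "'z set"
    by (induction A rule: infinite_finite_induct) (auto simp: h.hom1 h.hom_mult)
  have sm: "\<psi> (sum g A) = (\<Sum>x\<in>A. \<psi> (g x))" for g and A :: "'z set"
    by (induction A rule: infinite_finite_induct) (auto simp: h.hom0 h.hom_add)
  show ?thesis
    by (simp add: msubst_def monom_eval_def sm prd pow h.hom_mult)
qed

lemma (in coeff_hom) coeff_hom_msubst: "coeff_hom (msubst \<phi> f)"
  by unfold_locales (auto simp: msubst_0 msubst_1 msubst_add msubst_mult)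

lemma (in coeff_hom) msubst_msubst:
  "msubst \<phi> f (msubst Cst g p) = msubst \<phi> (\<lambda>x. msubst \<phi> f (g x)) p"
  by (simp add: msubst_natural[OF coeff_hom_msubst] msubst_Cst)

lemma msubst_cong:
  assumes "\<And>x. x \<in> mvars p \<Longrightarrow> f x = g x"
  shows "msubst \<phi> f p = msubst \<phi> g p"
proof -
  have "monom_eval f m = monom_eval g m" if "m \<in> Poly_Mapping.keys p" for m
    unfolding monom_eval_def using that assms unfolding mvars_def by (intro prod.cong refl) (metis UN_I)
  then show ?thesis by (simp add: msubst_def)
qed

lemma coeff_hom_const_poly: "coeff_hom (\<lambda>c::'a::comm_ring_1. [:c:])"
  by unfold_locales (auto simp: one_pCons)

lemma coeff_hom_eval_poly: "coeff_hom (\<lambda>p::'a::comm_ring_1 poly. poly p t)"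
  by unfold_locales auto

lemma poly_msubst_const:
  "poly (msubst (\<lambda>c. [:c:]) f p) t = meval (\<lambda>x. poly (f x) t) p"
  for p :: "('x, 'a::comm_ring_1) mpol"
  using msubst_natural[OF coeff_hom_eval_poly[of t], of "\<lambda>c. [:c:]" f p] by simp

text \<open>The coefficient map is a parameter so that a homogeneous part can be evaluated at
  scalars as well as at tuples of polynomials in t; \<open>poly_deg_part_const\<close> compares the
  two. A degree that does not occur gives the empty sum.\<close>

definition deg_part ::
  "('x, 'a::zero) mpol \<Rightarrow> nat \<Rightarrow> ('a \<Rightarrow> 'b::comm_semiring_1) \<Rightarrow> ('x \<Rightarrow> 'b) \<Rightarrow> 'b" where
  "deg_part p e \<phi> f =
     (\<Sum>m\<in>{m \<in> Poly_Mapping.keys p. mdeg m = e}. \<phi> (mcoeff p m) * monom_eval f m)"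

lemma msubst_scale_deg_parts:
  "msubst \<phi> (\<lambda>x. s * f x) p = (\<Sum>e\<in>mdeg ` Poly_Mapping.keys p. s ^ e * deg_part p e \<phi> f)"
proof -
  have "msubst \<phi> (\<lambda>x. s * f x) p =
      (\<Sum>m\<in>Poly_Mapping.keys p. s ^ mdeg m * (\<phi> (mcoeff p m) * monom_eval f m))"
    by (simp add: msubst_def monom_eval_scale mult_ac)
  also have "\<dots> = (\<Sum>e\<in>mdeg ` Poly_Mapping.keys p. \<Sum>m\<in>{m \<in> Poly_Mapping.keys p. mdeg m = e}.
      s ^ mdeg m * (\<phi> (mcoeff p m) * monom_eval f m))"
    by (rule sum.image_gen) simp
  also have "\<dots> = (\<Sum>e\<in>mdeg ` Poly_Mapping.keys p. s ^ e * deg_part p e \<phi> f)"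
    unfolding deg_part_def sum_distrib_left by (intro sum.cong refl) auto
  finally show ?thesis .
qed

lemma poly_deg_part_const:
  "poly (deg_part p e (\<lambda>c. [:c:]) f) t = deg_part p e (\<lambda>c. c) (\<lambda>x. poly (f x) t)"
  by (simp add: deg_part_def poly_sum monom_eval_def poly_prod)

text \<open>The lowest-degree homogeneous part of the Taylor expansion of \<open>G\<close> at \<open>b\<^sub>0\<close> only sees
  the tangent directions of the curves, so it vanishes at every \<open>y\<close>.\<close>

lemma vanishing_on_curves_in_all_directions:
  fixes G :: "('x, 'a::field_char_0) mpol"
  assumes curves: "\<And>y :: 'x \<Rightarrow> 'a. \<exists>w. (\<forall>x. coeff (w x) 0 = y x) \<and>
      msubst (\<lambda>c. [:c:]) (\<lambda>x. pCons (b\<^sub>0 x) (w x)) G = 0"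
  shows "meval b G = 0"
proof (rule ccontr)
  assume nz: "meval b G \<noteq> 0"
  interpret cp: coeff_hom "\<lambda>c::'a. [:c:]" by (rule coeff_hom_const_poly)
  define G0 where "G0 = msubst Cst (\<lambda>x. Cst (b\<^sub>0 x) + Var x) G"
  define ex where "ex y e \<longleftrightarrow> deg_part G0 e (\<lambda>c. c) y \<noteq> 0" for y :: "'x \<Rightarrow> 'a" and e
  \<comment> \<open>The factor 1 is there so that \<open>msubst_scale_deg_parts\<close> applies with
    s = 1 and splits the value into homogeneous parts.\<close>
  have sh: "meval (\<lambda>x. 1 * (b x - b\<^sub>0 x)) G0 = meval b G"
    by (simp add: G0_def meval.msubst_msubst meval.msubst_add meval.msubst_Cst meval.msubst_Var)
  have "\<exists>e. \<exists>y. ex y e"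
  proof (rule ccontr)
    assume "\<not> ?thesis"
    then have "meval (\<lambda>x. 1 * (b x - b\<^sub>0 x)) G0 = 0"
      by (subst msubst_scale_deg_parts) (simp add: ex_def)
    then show False using sh nz by simp
  qed
  \<comment> \<open>The order of vanishing is read off from values rather than from coefficients of
    \<open>G0\<close>, so a direction \<open>y\<close> with nonzero value in degree \<open>d\<close>
    comes with it.\<close>
  define d where "d = (LEAST e. \<exists>y. ex y e)"
  have "\<exists>y. ex y d" unfolding d_def by (rule LeastI_ex) fact
  then obtain y where y: "ex y d" by blast
  have low: "deg_part G0 e (\<lambda>c. c) z = 0" if "e < d" for e z
    using not_less_Least[of e "\<lambda>e. \<exists>y. ex y e"] that by (auto simp: d_def ex_def)
  obtain w where w: "\<And>x. coeff (w x) 0 = y x"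
    and 0: "msubst (\<lambda>c. [:c:]) (\<lambda>x. pCons (b\<^sub>0 x) (w x)) G = 0"
    using curves by metis
  \<comment> \<open>The displacement from the base point is t * w, so the part of degree e enters
    with the factor t^e.\<close>
  have pC: "(\<lambda>x. pCons (b\<^sub>0 x) (w x)) = (\<lambda>x. [:b\<^sub>0 x:] + monom 1 1 * w x)"
    by (simp add: monom_altdef)
  have "0 = msubst (\<lambda>c. [:c:]) (\<lambda>x. monom 1 1 * w x) G0"
    using 0 unfolding pC
    by (simp add: G0_def cp.msubst_msubst cp.msubst_add cp.msubst_Cst cp.msubst_Var)
  also have "\<dots> = (\<Sum>e\<in>mdeg ` Poly_Mapping.keys G0. monom 1 e * deg_part G0 e (\<lambda>c. [:c:]) w)"
    by (simp add: msubst_scale_deg_parts monom_power)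
  finally have "0 = coeff (\<Sum>e\<in>mdeg ` Poly_Mapping.keys G0. monom 1 e * deg_part G0 e (\<lambda>c. [:c:]) w) d"
    by simp
  \<comment> \<open>Only e = d contributes to t^d. For e < d the part vanishes at every scalar t,
    hence as a polynomial in t; for e > d the factor t^e is too high; for e = d the constant term is
    the value at w(0) = y.\<close>
  also have "\<dots> = (\<Sum>e\<in>mdeg ` Poly_Mapping.keys G0. if e = d then deg_part G0 d (\<lambda>c. c) y else 0)"
    unfolding coeff_sum
  proof (intro sum.cong refl)
    fix e
    have "deg_part G0 e (\<lambda>c. [:c:]) w = 0" if "e < d"
      by (subst poly_all_0_iff_0[symmetric]) (simp add: poly_deg_part_const low[OF that])
    moreover have "coeff (deg_part G0 d (\<lambda>c. [:c:]) w) 0 = deg_part G0 d (\<lambda>c. c) y"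
      unfolding poly_0_coeff_0[symmetric] poly_deg_part_const by (simp add: poly_0_coeff_0 w)
    ultimately show "coeff (monom 1 e * deg_part G0 e (\<lambda>c. [:c:]) w) d =
        (if e = d then deg_part G0 d (\<lambda>c. c) y else 0)"
      by (cases e d rule: linorder_cases) (auto simp: coeff_monom_mult)
  qed
  also have "\<dots> = deg_part G0 d (\<lambda>c. c) y"
  proof (cases "d \<in> mdeg ` Poly_Mapping.keys G0")
    case False
    then have "{m \<in> Poly_Mapping.keys G0. mdeg m = d} = {}" by auto
    then show ?thesis using y False unfolding ex_def deg_part_def by (simp only: sum.empty) blast
  qed simp
  finally show False using y by (simp add: ex_def)
qed

text \<open>Finite-dimensional duality: a proper subspace of k^X is killed by some nonzero
  functional. Functions live on the whole type and are compared on \<open>X\<close> only, so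
  \<open>U\<close> stays fixed while the induction enlarges \<open>X\<close>.\<close>

lemma interpolation_if_annihilator_trivial:
  fixes U :: "('x \<Rightarrow> 'a::field) set"
  assumes "finite X" and "(\<lambda>_. 0) \<in> U"
    and add: "\<And>u v. u \<in> U \<Longrightarrow> v \<in> U \<Longrightarrow> (\<lambda>x. u x + v x) \<in> U"
    and scale: "\<And>c u. u \<in> U \<Longrightarrow> (\<lambda>x. c * u x) \<in> U"
    and ann: "\<And>l. (\<forall>u\<in>U. (\<Sum>x\<in>X. l x * u x) = 0) \<Longrightarrow> \<forall>x\<in>X. l x = 0"
  shows "\<exists>u\<in>U. \<forall>x\<in>X. u x = y x"
  using assms(1) ann
proof (induction X arbitrary: y rule: finite_induct)
  case empty
  then show ?case using assms(2) by blast
next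
  case (insert z X)
  have "\<forall>x\<in>X. l x = 0" if l: "\<forall>u\<in>U. (\<Sum>x\<in>X. l x * u x) = 0" for l
  proof -
    \<comment> \<open>Extension by 0 at \<open>z\<close> turns an annihilating functional on
      \<open>X\<close> into one on the larger set.\<close>
    have "(\<Sum>x\<in>insert z X. (l(z := 0)) x * u x) = (\<Sum>x\<in>X. l x * u x)" for u
      using insert.hyps by (auto intro!: sum.cong)
    then have "\<forall>x\<in>insert z X. (l(z := 0)) x = 0" using l by (intro insert.prems) simp
    then show ?thesis using insert.hyps by (metis fun_upd_other insertCI)
  qed
  then have IH: "\<exists>u\<in>U. \<forall>x\<in>X. u x = y' x" for y' by (rule insert.IH)
  then have "\<forall>y'. \<exists>u. u \<in> U \<and> (\<forall>x\<in>X. u x = y' x)" by blast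
  then obtain f where f: "\<And>y'. f y' \<in> U" "\<And>y' x. x \<in> X \<Longrightarrow> f y' x = y' x" by metis
  have sums: "(\<lambda>x. \<Sum>i\<in>I. c i * g i x) \<in> U" if "finite I" "\<And>i. g i \<in> U" for I :: "'x set" and c g
    using that(1) by (induction I rule: finite_induct) (auto simp: assms(2) intro!: add scale that(2))
  \<comment> \<open>A member of \<open>U\<close> separating \<open>z\<close> from \<open>X\<close>.
    Without one, u z would depend linearly on the values of u on \<open>X\<close>, and this
    dependence is an annihilating functional with coefficient -1 at \<open>z\<close>.\<close>
  obtain w where w: "w \<in> U" "\<forall>x\<in>X. w x = 0" "w z \<noteq> 0"
  proof (rule ccontr)
    assume "\<not> thesis"
    then have zero: "\<And>w. w \<in> U \<Longrightarrow> \<forall>x\<in>X. w x = 0 \<Longrightarrow> w z = 0" using that by blast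
    define l where "l x = (if x = z then -1 else f (\<lambda>x'. if x' = x then 1 else 0) z)" for x
    have "(\<Sum>x\<in>insert z X. l x * u x) = 0" if "u \<in> U" for u
    proof -
      let ?g = "\<lambda>i. f (\<lambda>x'. if x' = i then 1 else 0)"
      \<comment> \<open>Subtracting the interpolants of the unit vectors, weighted by the values of
        \<open>u\<close>, leaves a member of \<open>U\<close> that vanishes on \<open>X\<close>,
        hence at \<open>z\<close>.\<close>
      define v where "v x = u x + (-1) * (\<Sum>i\<in>X. u i * ?g i x)" for x
      have "v \<in> U" unfolding v_def
        using add[OF that scale[OF sums[of X ?g u], of "-1"]] insert.hyps(1) f(1) by blast
      moreover have "v x = 0" if "x \<in> X" for x
        using that insert.hyps by (simp add: v_def f(2) if_distrib cong: if_cong)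
      ultimately have "v z = 0" using zero by blast
      then have "u z = (\<Sum>i\<in>X. u i * ?g i z)" by (simp add: v_def)
      moreover have "(\<Sum>x\<in>X. l x * u x) = (\<Sum>i\<in>X. u i * ?g i z)"
        using insert.hyps by (intro sum.cong) (auto simp: l_def)
      ultimately show ?thesis using insert.hyps by (simp add: l_def)
    qed
    then have "\<forall>x\<in>insert z X. l x = 0" by (intro insert.prems) blast
    then show False by (simp add: l_def)
  qed
  let ?v = "\<lambda>x. f y x + ((y z - f y z) / w z) * w x"
  have "?v \<in> U" using add[OF f(1) scale[OF w(1)]] .
  moreover have "\<forall>x\<in>insert z X. ?v x = y x"
    using w f by auto
  ultimately show ?case by (rule_tac bexI[where x = ?v])
qed

section \<open>The forms q and the group action\<close>

text \<open>Entry functions replace matrices because the entries will later be polynomials in t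
  whose coefficients and values are taken one entry at a time. In this encoding
  \<open>q_mat a\<close> is diag(a) - a a^T and \<open>congruence g N\<close> is g N g^T.\<close>

definition form_of :: "(nat \<Rightarrow> nat \<Rightarrow> 'a::comm_ring_1) \<Rightarrow> (nat, 'a) mpol" where
  "form_of N = quad_form (mat 5 5 (\<lambda>(p, l). N p l))"

definition q_mat :: "(nat \<Rightarrow> 'a::comm_ring_1) \<Rightarrow> nat \<Rightarrow> nat \<Rightarrow> 'a" where
  "q_mat a p l = (if p = l then a p else 0) - a p * a l"

definition congruence :: "(nat \<Rightarrow> nat \<Rightarrow> 'a::comm_ring_1) \<Rightarrow> (nat \<Rightarrow> nat \<Rightarrow> 'a) \<Rightarrow> nat \<Rightarrow> nat \<Rightarrow> 'a" where
  "congruence g N p l = (\<Sum>k<5. \<Sum>m<5. g p k * N k m * g l m)"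

lemma Cst_sum: "Cst (sum f A) = (\<Sum>x\<in>A. Cst (f x))" for f :: "'b \<Rightarrow> 'a::comm_monoid_add"
  by (induction A rule: infinite_finite_induct) (auto simp: Cst_simps)

lemma Cst_uminus: "Cst (- c) = - Cst (c :: 'a::ab_group_add)"
  by (simp add: Cst_def single_uminus)

lemma Cst_diff: "Cst (c - d) = Cst c - Cst (d :: 'a::ab_group_add)"
  by (simp add: Cst_def single_diff)

lemma form_of_eq: "form_of N = (\<Sum>p<5. \<Sum>l<5. Cst (N p l) * Var p * Var l)"
  by (simp add: form_of_def quad_form_def)

lemma q_eq_form_of: "q (vec 5 a) = form_of (q_mat a)"
proof -
  have "(\<Sum>p<5. \<Sum>l<5. Cst (if p = l then a p else 0) * Var p * Var l) = (\<Sum>p<5. Cst (a p) * Var p ^ 2)"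
    by (intro sum.cong refl)
      (simp add: if_distrib[of Cst] if_distrib[of "\<lambda>x. x * _"] Cst_simps power2_eq_square mult.assoc cong: if_cong)
  moreover have "(\<Sum>p<5. \<Sum>l<5. Cst (a p * a l) * Var p * Var l) = (\<Sum>p<5. Cst (a p) * Var p) ^ 2"
    by (simp add: power2_eq_square sum_product Cst_simps mult_ac)
  ultimately show ?thesis
    by (simp add: form_of_eq q_mat_def q_def Cst_diff algebra_simps sum_subtractf)
qed

lemma act_form_of: "act (mat 5 5 (\<lambda>(p, l). g p l)) (form_of N) = form_of (congruence g N)"
proof -
  have "mat 5 5 (\<lambda>(p, l). g p l) * mat 5 5 (\<lambda>(p, l). N p l) * transpose_mat (mat 5 5 (\<lambda>(p, l). g p l))
      = mat 5 5 (\<lambda>(p, l). congruence g N p l)"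
    by (rule eq_matI)
      (auto simp: scalar_prod_def congruence_def sum_distrib_right lessThan_atLeast0 intro: sum.swap)
  then show ?thesis by (simp add: form_of_def act_quad_form)
qed

lemma act_sum:
  "act g (\<Sum>j\<in>A. Cst (u j) * v j) = (\<Sum>j\<in>A. Cst (u j) * act g (v j))"
  by (simp add: act_def mcst.msubst_sum mcst.msubst_mult mcst.msubst_Cst)

text \<open>Used to carry linear relations among translated forms back to the original ones. On Gram
  matrices it reads g' (g N g^T) g'^T = N.\<close>

lemma act_act_inverse:
  assumes "g \<in> carrier_mat 5 5" "g' \<in> carrier_mat 5 5" "g' * g = 1\<^sub>m 5"
  shows "act g' (act g (form_of N)) = form_of N"
proof -
  let ?N = "mat 5 5 (\<lambda>(p, l). N p l)"
  have N: "?N \<in> carrier_mat 5 5" by simp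
  have T: "transpose_mat g * transpose_mat g' = 1\<^sub>m 5"
    using assms transpose_mult[of g' 5 5 g 5] by simp
  have gN: "g * ?N \<in> carrier_mat 5 5" "g' * (g * ?N) \<in> carrier_mat 5 5"
    using assms N by auto
  have "g' * (g * ?N * transpose_mat g) * transpose_mat g' =
      g' * (g * ?N) * transpose_mat g * transpose_mat g'"
    using assms gN by (subst assoc_mult_mat[of g' 5 5 "g * ?N" 5 "transpose_mat g" 5]) auto
  also have "\<dots> = g' * (g * ?N) * (transpose_mat g * transpose_mat g')"
    using assms gN by (intro assoc_mult_mat[of _ 5 5 _ 5 _ 5]) auto
  also have "\<dots> = g' * (g * ?N)"
    unfolding T using gN(2) by (rule right_mult_one_mat)
  also have "\<dots> = (g' * g) * ?N"
    using assms by (intro assoc_mult_mat[of _ 5 5 _ 5 _ 5, symmetric]) auto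
  also have "\<dots> = ?N" using assms N by simp
  finally have "act g' (quad_form (g * ?N * transpose_mat g)) = quad_form ?N"
    using assms act_quad_form[of g' "g * ?N * transpose_mat g"]
      mult_carrier_mat[OF gN(1), of "transpose_mat g" 5] by simp
  then show ?thesis
    using assms by (simp add: form_of_def act_quad_form)
qed

text \<open>The sum runs over ordered pairs: a mixed monomial collects both N p l and N l p, which
  covers non-symmetric N as well.\<close>

lemma mcoeff_form_of:
  "mcoeff (form_of N) m = (\<Sum>p<5. \<Sum>l<5.
     if Poly_Mapping.single p 1 + Poly_Mapping.single l 1 = m then N p l else 0)"
  by (simp add: form_of_eq lookup_sum Cst_def Var_def mult_single lookup_single when_def)

lemma form_of_sum: "form_of (\<lambda>p l. \<Sum>j\<in>A. c j * N j p l) = (\<Sum>j\<in>A. Cst (c j) * form_of (N j))"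
proof -
  have "form_of (\<lambda>p l. \<Sum>j\<in>A. c j * N j p l) =
      (\<Sum>p<5. \<Sum>l<5. \<Sum>j\<in>A. Cst (c j) * (Cst (N j p l) * Var p * Var l))"
    by (simp add: form_of_eq Cst_sum Cst_simps sum_distrib_right mult.assoc)
  also have "\<dots> = (\<Sum>p<5. \<Sum>j\<in>A. \<Sum>l<5. Cst (c j) * (Cst (N j p l) * Var p * Var l))"
    by (intro sum.cong refl sum.swap)
  also have "\<dots> = (\<Sum>j\<in>A. \<Sum>p<5. \<Sum>l<5. Cst (c j) * (Cst (N j p l) * Var p * Var l))"
    by (rule sum.swap)
  finally show ?thesis by (simp add: form_of_eq sum_distrib_left)
qed

lemma single_add_single_in_T2_monoms:
  assumes "p < 5" "l < 5"
  shows "Poly_Mapping.single p 1 + Poly_Mapping.single l 1 \<in> T2_monoms"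
  using assms image_eqI[OF refl, of "(p, l)" "{(i, j). i \<le> j \<and> j < 5}"
      "\<lambda>(i, j). Poly_Mapping.single i (1::nat) + Poly_Mapping.single j 1"]
    image_eqI[OF refl, of "(l, p)" "{(i, j). i \<le> j \<and> j < 5}"
      "\<lambda>(i, j). Poly_Mapping.single i (1::nat) + Poly_Mapping.single j 1"]
  unfolding T2_monoms_eq by (cases "p \<le> l") (simp_all add: add.commute)

lemma form_of_in_T2: "form_of N \<in> T2"
proof -
  have "mcoeff (form_of N) m = 0" if "m \<notin> T2_monoms" for m
    unfolding mcoeff_form_of using that single_add_single_in_T2_monoms
    by (intro sum.neutral ballI if_not_P) (metis lessThan_iff)
  then have "Poly_Mapping.keys (form_of N) \<subseteq> T2_monoms" by (auto simp: in_keys_iff)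
  then show ?thesis
    unfolding T2_def T2_monoms_def homogeneous_def mvars_def by blast
qed

section \<open>Invertible matrices and independent families of forms\<close>

lemma GL5_inverse:
  assumes "g \<in> GL5"
  obtains g' where "g' \<in> carrier_mat 5 5" "g' * g = 1\<^sub>m 5"
proof -
  have g: "g \<in> carrier_mat 5 5" and "invertible_mat g" using assms by (auto simp: GL5_def)
  then obtain B where B: "inverts_mat g B" "inverts_mat B g" by (auto simp: invertible_mat_def)
  \<comment> \<open>\<open>invertible_mat\<close> leaves the size of the inverse open; its
    dimensions are read off from the two products.\<close>
  have "B \<in> carrier_mat 5 5"
  proof
    show "dim_row B = 5" using B(2) g unfolding inverts_mat_def
      by (metis carrier_matD(2) index_mult_mat(3) index_one_mat(3))
    show "dim_col B = 5" using B(1) g unfolding inverts_mat_def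
      by (metis carrier_matD(1) index_mult_mat(3) index_one_mat(3))
  qed
  then show thesis using B(2) g that by (auto simp: inverts_mat_def)
qed

lemma GL5_if_det_nonzero:
  fixes g :: "'a::field mat"
  assumes g: "g \<in> carrier_mat 5 5" and "det g \<noteq> 0"
  shows "g \<in> GL5"
proof -
  \<comment> \<open>The \<open>()\<close> fills the extension slot of the ring record.\<close>
  from det_non_zero_imp_unit[OF assms, of "()"] obtain B where
    "B \<in> carrier_mat 5 5" "B * g = 1\<^sub>m 5" "g * B = 1\<^sub>m 5"
    by (auto simp: Units_def ring_mat_def)
  then show ?thesis using g
    by (auto simp: GL5_def invertible_mat_def inverts_mat_def intro!: exI[of _ B])
qed

text \<open>\<open>mp.independent\<close> is a property of sets, so for a family it has to be paired
  with injectivity. A repetition v i = v j shows up as a relation with coefficients 1 and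
  -1.\<close>

lemma lin_indep_family:
  fixes v :: "nat \<Rightarrow> (nat, 'a::field) mpol"
  shows "inj_on v {..<r} \<and> mp.independent (v ` {..<r}) \<longleftrightarrow>
    (\<forall>u. (\<Sum>j<r. Cst (u j) * v j) = 0 \<longrightarrow> (\<forall>j<r. u j = 0))"
proof (intro iffI conjI allI impI)
  fix u j assume *: "inj_on v {..<r} \<and> mp.independent (v ` {..<r})"
    and 0: "(\<Sum>j<r. Cst (u j) * v j) = 0" and j: "j < r"
  then have inj: "inj_on v {..<r}" by simp
  let ?u = "\<lambda>x. u (the_inv_into {..<r} v x)"
  have "(\<Sum>x\<in>v ` {..<r}. Cst (?u x) * x) = (\<Sum>j<r. Cst (u j) * v j)"
    by (subst sum.reindex[OF inj]) (auto intro!: sum.cong simp: the_inv_into_f_f[OF inj])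
  then have "?u (v j) = 0"
    using * 0 j by (intro mp.independentD[of "v ` {..<r}" "v ` {..<r}" ?u "v j"]) auto
  then show "u j = 0" using j by (simp add: the_inv_into_f_f[OF inj])
next
  assume *: "\<forall>u. (\<Sum>j<r. Cst (u j) * v j) = 0 \<longrightarrow> (\<forall>j<r. u j = 0)"
  show inj: "inj_on v {..<r}"
  proof (rule inj_onI, rule ccontr)
    fix i j assume ij: "i \<in> {..<r}" "j \<in> {..<r}" "v i = v j" "i \<noteq> j"
    let ?u = "\<lambda>k. if k = i then 1 else if k = j then - 1 else (0::'a)"
    have "(\<Sum>k<r. Cst (?u k) * v k) = (\<Sum>k\<in>{i, j}. Cst (?u k) * v k)"
      using ij by (intro sum.mono_neutral_right) (auto simp: Cst_simps)
    also have "\<dots> = 0" using ij by (simp add: Cst_simps Cst_uminus)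
    finally have "\<forall>k<r. ?u k = 0" by (rule spec[OF *, of ?u, THEN mp])
    then have "?u i = 0" using ij by blast
    then show False by simp
  qed
  show "mp.independent (v ` {..<r})"
  proof (rule mp.independent_if_scalars_zero)
    fix f x assume "(\<Sum>x\<in>v ` {..<r}. Cst (f x) * x) = 0" "x \<in> v ` {..<r}"
    then show "f x = 0" using * by (auto simp: sum.reindex[OF inj])
  qed simp
qed

text \<open>A linear relation among the forms is a relation among the rows of every minor, that is,
  a kernel vector of the transposed matrix.\<close>

lemma lin_indep_if_plucker_nonzero:
  fixes v :: "nat \<Rightarrow> (nat, 'a::field) mpol"
  assumes "plucker r v J \<noteq> 0"
  shows "inj_on v {..<r} \<and> mp.independent (v ` {..<r})"
  unfolding lin_indep_family
proof (rule, rule, rule ccontr)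
  fix u assume 0: "(\<Sum>j<r. Cst (u j) * v j) = 0" and nz: "\<not> (\<forall>j<r. u j = 0)"
  let ?M = "mat r r (\<lambda>(i, j). mcoeff (v i) (sorted_list_of_set J ! j))"
  have "transpose_mat ?M *\<^sub>v vec r u = 0\<^sub>v r"
  proof (rule eq_vecI)
    fix k assume "k < dim_vec (0\<^sub>v r :: 'a vec)"
    then have k: "k < r" by simp
    have "(\<Sum>j<r. u j * mcoeff (v j) (sorted_list_of_set J ! k)) = 0"
      using arg_cong[OF 0, of "\<lambda>p. mcoeff p (sorted_list_of_set J ! k)"]
      by (simp add: lookup_sum mcoeff_Cst_mult)
    then show "(transpose_mat ?M *\<^sub>v vec r u) $ k = 0\<^sub>v r $ k"
      using k by (simp add: scalar_prod_def lessThan_atLeast0 mult.commute)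
  qed simp
  moreover have "vec r u \<noteq> 0\<^sub>v r" using nz by (metis index_vec index_zero_vec(1))
  ultimately have "det (transpose_mat ?M) = 0"
    by (subst det_0_iff_vec_prod_zero_field[of _ r]) (auto intro!: exI[of _ "vec r u"])
  then show False using assms by (simp add: plucker_def det_transpose[of _ r])
qed

text \<open>Serves frames that may be dependent, where \<open>plucker_change\<close> does not
  apply.\<close>

lemma plucker_linear_combination:
  assumes "\<And>i. i < r \<Longrightarrow> b i = (\<Sum>k<r. Cst (u i k) * v k)"
  shows "plucker r b J = det (mat r r (\<lambda>(i, k). u i k)) * plucker r v J"
proof -
  have "mat r r (\<lambda>(i, j). mcoeff (b i) (sorted_list_of_set J ! j)) =
      mat r r (\<lambda>(i, k). u i k) * mat r r (\<lambda>(i, j). mcoeff (v i) (sorted_list_of_set J ! j))"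
    by (rule eq_matI)
       (auto simp: assms scalar_prod_def lookup_sum mcoeff_Cst_mult lessThan_atLeast0)
  then show ?thesis by (simp add: plucker_def det_mult[of _ r])
qed

lemma act_span: "act g ` mp.span S = mp.span (act g ` S)" for g :: "'a::field mat"
proof -
  have "Vector_Spaces.linear (\<lambda>(c::'a) (p::(nat, 'a) mpol). Cst c * p) (\<lambda>c p. Cst c * p) (act g)"
    by unfold_locales
      (simp_all add: act_def mcst.msubst_add mcst.msubst_mult mcst.msubst_Cst)
  then interpret l: Vector_Spaces.linear
    "\<lambda>(c::'a) (p::(nat, 'a) mpol). Cst c * p" "\<lambda>c p. Cst c * p" "act g" .
  show ?thesis by (rule l.span_image[symmetric])
qed

text \<open>Independence survives the action because an inverse of \<open>g\<close> carries any
  relation among the translates back to the same relation among the q (a i).\<close>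

lemma basis_of_Phi:
  fixes g :: "'a::field mat"
  assumes "(g, a) \<in> Phi_domain r"
  shows "basis_of r (\<lambda>i. act g (q (a i))) (Phi r (g, a))"
proof -
  have g: "g \<in> GL5" and a: "\<And>i. i < r \<Longrightarrow> a i \<in> carrier_vec 5"
    and ind: "inj_on (\<lambda>i. q (a i)) {..<r} \<and> mp.independent ((\<lambda>i. q (a i)) ` {..<r})"
    using assms by (auto simp: Phi_domain_def)
  obtain g' where g': "g' \<in> carrier_mat 5 5" "g' * g = 1\<^sub>m 5"
    using GL5_inverse[OF g] .
  have "act g' (act g (q (a i))) = q (a i)" if "i < r" for i
  proof -
    have "a i = vec 5 (\<lambda>p. a i $ p)" using a[OF that] by auto
    then show ?thesis using g g' act_act_inverse[of g g'] q_eq_form_of[of "\<lambda>p. a i $ p"]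
      by (simp add: GL5_def)
  qed
  then have pb: "(\<Sum>j<r. Cst (u j) * q (a j)) = act g' (\<Sum>j<r. Cst (u j) * act g (q (a j)))" for u
    unfolding act_sum by (intro sum.cong) auto
  have "act g' 0 = 0" by (simp add: act_def mcst.msubst_0)
  then have "(\<Sum>j<r. Cst (u j) * q (a j)) = 0" if "(\<Sum>j<r. Cst (u j) * act g (q (a j))) = 0" for u
    unfolding pb that .
  then have "inj_on (\<lambda>i. act g (q (a i))) {..<r} \<and>
      mp.independent ((\<lambda>i. act g (q (a i))) ` {..<r})"
    using ind unfolding lin_indep_family by blast
  then show ?thesis
    by (auto simp: basis_of_def Phi_def act_span image_image)
qed

lemma Phi_in_Gr:
  fixes g :: "'a::field mat"
  assumes "(g, a) \<in> Phi_domain r"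
  shows "Phi r (g, a) \<in> Gr r"
proof -
  let ?b = "\<lambda>i. act g (q (a i))"
  have b: "basis_of r ?b (Phi r (g, a))" by (rule basis_of_Phi[OF assms])
  then have S: "mp.span (?b ` {..<r}) = Phi r (g, a)" by (simp add: basis_of_def)
  have g: "g \<in> carrier_mat 5 5" and a: "\<And>i. i < r \<Longrightarrow> a i \<in> carrier_vec 5"
    using assms by (auto simp: Phi_domain_def GL5_def)
  have "?b i \<in> T2" if "i < r" for i
  proof -
    have "a i = vec 5 (\<lambda>p. a i $ p)" using a[OF that] by auto
    moreover have "g = mat 5 5 (\<lambda>(p, l). g $$ (p, l))" using g by auto
    ultimately show ?thesis using form_of_in_T2 act_form_of q_eq_form_of by metis
  qed
  moreover have "mp.subspace (T2 :: (nat, 'a) mpol set)"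
    unfolding T2_span by (rule mp.subspace_span)
  ultimately have "mp.span (?b ` {..<r}) \<subseteq> T2" by (intro mp.span_minimal) auto
  moreover have "mp.dim (mp.span (?b ` {..<r})) = r"
  proof -
    have "inj_on ?b {..<r}" "mp.independent (?b ` {..<r})"
      using b by (auto simp: basis_of_def)
    \<comment> \<open>As a simp rule \<open>mp.dim_span\<close> would strip the span that
      \<open>mp.dim_span_eq_card_independent\<close> has to match.\<close>
    then show ?thesis
      by (simp add: mp.dim_span_eq_card_independent card_image del: mp.dim_span)
  qed
  ultimately show ?thesis
    using mp.subspace_span[of "?b ` {..<r}"] unfolding S Gr_def by blast
qed

section \<open>Pluecker polynomials as polynomials in the coefficients of r forms\<close>

definition minor ::
  "nat \<Rightarrow> (nat \<Rightarrow>\<^sub>0 nat) set \<Rightarrow> (nat \<times> (nat \<Rightarrow>\<^sub>0 nat), 'a::comm_ring_1) mpol" where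
  "minor r J = det (mat r r (\<lambda>(i, j). Var (i, sorted_list_of_set J ! j)))"

text \<open>At a dependent frame all Pluecker coordinates are 0, which makes F vanish only if its
  degree is positive. The factor \<open>minor r J\<close> makes the product vanish there for
  constant F too. J is chosen so that this factor is nonzero at a basis of the subspace to be
  reached.\<close>

definition plucker_pullback ::
  "nat \<Rightarrow> ((nat \<Rightarrow>\<^sub>0 nat) set, 'a::comm_ring_1) mpol \<Rightarrow> (nat \<Rightarrow>\<^sub>0 nat) set \<Rightarrow>
    (nat \<times> (nat \<Rightarrow>\<^sub>0 nat), 'a) mpol" where
  "plucker_pullback r F J = msubst Cst (minor r) F * minor r J"

lemma msubst_minor:
  fixes \<phi> :: "'a::comm_ring_1 \<Rightarrow> 'b::comm_ring_1"
  assumes "coeff_hom \<phi>"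
  shows "msubst \<phi> f (minor r J) = det (mat r r (\<lambda>(i, j). f (i, sorted_list_of_set J ! j)))"
proof -
  interpret h: coeff_hom \<phi> by fact
  interpret c: comm_ring_hom "msubst \<phi> f"
    by unfold_locales (auto simp: h.msubst_0 h.msubst_1 h.msubst_add h.msubst_mult)
  have "map_mat (msubst \<phi> f) (mat r r (\<lambda>(i, j). Var (i, sorted_list_of_set J ! j))) =
      mat r r (\<lambda>(i, j). f (i, sorted_list_of_set J ! j))"
    by (rule eq_matI) (auto simp: h.msubst_Var)
  then show ?thesis unfolding minor_def c.hom_det[symmetric] by simp
qed

text \<open>The minor involves only variables (i, m) with i < r and m of degree 2, so
  \<open>f\<close> is compared with the coefficients of \<open>b\<close> just there.\<close>

lemma msubst_minor_plucker:
  fixes \<phi> :: "'a::comm_ring_1 \<Rightarrow> 'b::comm_ring_1"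
  assumes "coeff_hom \<phi>" and J: "J \<subseteq> T2_monoms" "card J = r"
    and f: "\<And>i m. i < r \<Longrightarrow> m \<in> T2_monoms \<Longrightarrow> f (i, m) = mcoeff (b i) m"
  shows "msubst \<phi> f (minor r J) = plucker r b J"
  unfolding msubst_minor[OF assms(1)] plucker_def
proof (rule arg_cong[of _ _ det], rule eq_matI)
  fix i j assume "i < dim_row (mat r r (\<lambda>(i, j). mcoeff (b i) (sorted_list_of_set J ! j)))"
    "j < dim_col (mat r r (\<lambda>(i, j). mcoeff (b i) (sorted_list_of_set J ! j)))"
  then have ij: "i < r" "j < r" by auto
  have "finite J" using J finite_T2_monoms finite_subset by blast
  then have "sorted_list_of_set J ! j \<in> J"
    using ij J by (metis nth_mem set_sorted_list_of_set length_sorted_list_of_set)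
  then show "mat r r (\<lambda>(i, j). f (i, sorted_list_of_set J ! j)) $$ (i, j) =
      mat r r (\<lambda>(i, j). mcoeff (b i) (sorted_list_of_set J ! j)) $$ (i, j)"
    using ij J by (auto intro: f)
qed auto

lemma msubst_plucker_pullback:
  fixes \<phi> :: "'a::comm_ring_1 \<Rightarrow> 'b::comm_ring_1"
  assumes "coeff_hom \<phi>" and F: "F \<in> plucker_polys r" and J: "J \<subseteq> T2_monoms" "card J = r"
    and f: "\<And>i m. i < r \<Longrightarrow> m \<in> T2_monoms \<Longrightarrow> f (i, m) = mcoeff (b i) m"
  shows "msubst \<phi> f (plucker_pullback r F J) = msubst \<phi> (plucker r b) F * plucker r b J"
proof -
  interpret h: coeff_hom \<phi> by fact
  have "msubst \<phi> (\<lambda>J. msubst \<phi> f (minor r J)) F = msubst \<phi> (plucker r b) F"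
    using F by (intro msubst_cong msubst_minor_plucker[OF assms(1)] f) (auto simp: plucker_polys_def)
  then show ?thesis
    by (simp add: plucker_pullback_def h.msubst_mult h.msubst_msubst
        msubst_minor_plucker[OF assms(1) J f])
qed

definition vanishes_on_image :: "nat \<Rightarrow> ((nat \<Rightarrow>\<^sub>0 nat) set, 'a::field) mpol \<Rightarrow> bool" where
  "vanishes_on_image r F \<longleftrightarrow>
     (\<forall>x\<in>Phi_domain r. \<forall>b. basis_of r b (Phi r x) \<longrightarrow> meval (plucker r b) F = 0)"

text \<open>Passing from the translated forms v to b = h v multiplies all Pluecker coordinates by
  det h. If coordinate J of v is nonzero, then v is independent, (g, a) lies in the domain and F
  vanishes at v; otherwise the second factor is 0. A singular h is harmless in both cases.\<close>

lemma pullback_vanishes_on_frames: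
  fixes a :: "nat \<Rightarrow> nat \<Rightarrow> 'a::field"
  assumes F: "homogeneous d F" "vanishes_on_image r F"
    and g: "mat 5 5 (\<lambda>(p, l). g p l) \<in> GL5"
    and b: "\<And>i. i < r \<Longrightarrow> b i = (\<Sum>j<r. Cst (h i j) * form_of (congruence g (q_mat (a j))))"
  shows "meval (plucker r b) F * plucker r b J = 0"
proof -
  define v where "v j = form_of (congruence g (q_mat (a j)))" for j
  let ?D = "det (mat r r (\<lambda>(i, k). h i k))"
  have pl: "plucker r b J = ?D * plucker r v J" for J
    by (rule plucker_linear_combination) (simp add: b v_def)
  then have "plucker r b = (\<lambda>J. ?D * plucker r v J)" by blast
  then have FD: "meval (plucker r b) F = ?D ^ d * meval (plucker r v) F"
    using F(1) by (simp add: meval_homogeneous)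
  have "meval (plucker r v) F = 0" if nz: "plucker r v J \<noteq> 0"
  proof -
    let ?g = "mat 5 5 (\<lambda>(p, l). g p l)"
    \<comment> \<open>\<open>Phi_domain\<close> consists of extensional tuples, hence the
      restriction to indices below r.\<close>
    let ?a = "restrict (\<lambda>j. vec 5 (a j)) {..<r}"
    have act: "act ?g (q (?a j)) = v j" if "j < r" for j
      using that by (simp add: v_def q_eq_form_of act_form_of)
    have act_u: "act ?g (\<Sum>j<r. Cst (u j) * q (?a j)) = (\<Sum>j<r. Cst (u j) * v j)" for u
      unfolding act_sum by (intro sum.cong refl) (simp only: act lessThan_iff)
    have "act ?g 0 = 0" by (simp add: act_def mcst.msubst_0)
    then have "(\<Sum>j<r. Cst (u j) * v j) = 0" if "(\<Sum>j<r. Cst (u j) * q (?a j)) = 0" for u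
      unfolding act_u[symmetric] that .
    then have "inj_on (\<lambda>i. q (?a i)) {..<r} \<and> mp.independent ((\<lambda>i. q (?a i)) ` {..<r})"
      using lin_indep_if_plucker_nonzero[OF nz] unfolding lin_indep_family by blast
    then have dom: "(?g, ?a) \<in> Phi_domain r" using g by (simp add: Phi_domain_def)
    have "inj_on (\<lambda>i. act ?g (q (?a i))) {..<r} \<longleftrightarrow> inj_on v {..<r}"
      by (intro inj_on_cong) (simp only: act lessThan_iff)
    moreover have "(\<lambda>i. act ?g (q (?a i))) ` {..<r} = v ` {..<r}"
      by (intro image_cong refl) (simp only: act lessThan_iff)
    ultimately have "basis_of r v (Phi r (?g, ?a))"
      using basis_of_Phi[OF dom] by (simp only: basis_of_def simp_thms)
    then show ?thesis using F(2) dom by (auto simp: vanishes_on_image_def)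
  qed
  then show ?thesis by (auto simp: FD pl)
qed

section \<open>The tangent space at a tuple of points\<close>

text \<open>The first-order term of the \<open>i\<close>-th form along \<open>g = 1 + t M\<close>, \<open>h = 1 + t H\<close>, \<open>a + t \<beta>\<close>.\<close>

definition tangent_form ::
  "nat \<Rightarrow> (nat \<Rightarrow> nat \<Rightarrow> 'a::comm_ring_1) \<Rightarrow> (nat \<Rightarrow> nat \<Rightarrow> 'a) \<Rightarrow> (nat \<Rightarrow> nat \<Rightarrow> 'a) \<Rightarrow> (nat \<Rightarrow> nat \<Rightarrow> 'a)
    \<Rightarrow> nat \<Rightarrow> nat \<Rightarrow> nat \<Rightarrow> 'a" where
  "tangent_form r a M H \<beta> i p l =
     (\<Sum>j<r. H i j * q_mat (a j) p l) + (\<Sum>k<5. M p k * q_mat (a i) k l) + (\<Sum>k<5. q_mat (a i) p k * M l k)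
     + ((if p = l then \<beta> i p else 0) - \<beta> i p * a i l - a i p * \<beta> i l)"

text \<open>The \<open>S i\<close> represent a linear functional on \<open>T\<^sub>2\<^sup>r\<close>; the three conditions say that it annihilates
  \<open>tangent_form\<close> for variations of \<open>h\<close> (the parameter \<open>H\<close>), of the points (\<open>\<beta>\<close>) and of \<open>g\<close> (\<open>M\<close>).\<close>

definition rigid :: "nat \<Rightarrow> (nat \<Rightarrow> nat \<Rightarrow> 'a::comm_ring_1) \<Rightarrow> bool" where
  "rigid r a \<longleftrightarrow> (\<forall>S :: nat \<Rightarrow> nat \<Rightarrow> nat \<Rightarrow> 'a.
     (\<forall>i p l. S i p l = S i l p) \<longrightarrow>
     (\<forall>i<r. \<forall>j<r. (\<Sum>p<5. \<Sum>l<5. q_mat (a j) p l * S i p l) = 0) \<longrightarrow>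
     (\<forall>i<r. \<forall>p<5. S i p p = 2 * (\<Sum>l<5. a i l * S i p l)) \<longrightarrow>
     (\<forall>k<5. \<forall>p<5. (\<Sum>i<r. \<Sum>l<5. q_mat (a i) k l * S i l p) = 0) \<longrightarrow>
     (\<forall>i<r. \<forall>p<5. \<forall>l<5. S i p l = 0))"

lemma form_of_cong:
  assumes "\<And>p l. p < 5 \<Longrightarrow> l < 5 \<Longrightarrow> N p l = N' p l"
  shows "form_of N = form_of N'"
  unfolding form_of_eq using assms by (intro sum.cong) auto

lemma form_of_add: "form_of (\<lambda>p l. N p l + N' p l) = form_of N + form_of N'"
  by (simp add: form_of_eq Cst_simps distrib_right sum.distrib)

lemma form_of_scale: "form_of (\<lambda>p l. c * N p l) = Cst c * form_of N"
  by (simp add: form_of_eq Cst_simps sum_distrib_left mult.assoc)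

text \<open>Rewrites a functional on coefficients as the trace pairing with the symmetric matrix of
  its values on the monomials y_p y_l. For mixed monomials both orders of (p, l) contribute on
  either side.\<close>

lemma sum_T2_monoms_mcoeff_form_of:
  "(\<Sum>m\<in>T2_monoms. f m * mcoeff (form_of N) m) =
     (\<Sum>p<5. \<Sum>l<5. f (Poly_Mapping.single p 1 + Poly_Mapping.single l 1) * N p l)"
proof -
  let ?e = "\<lambda>p l. Poly_Mapping.single p 1 + Poly_Mapping.single l (1::nat)"
  have "(\<Sum>m\<in>T2_monoms. f m * mcoeff (form_of N) m) =
      (\<Sum>m\<in>T2_monoms. \<Sum>p<5. \<Sum>l<5. if ?e p l = m then f m * N p l else 0)"
    unfolding mcoeff_form_of sum_distrib_left by (intro sum.cong refl) simp
  also have "\<dots> = (\<Sum>p<5. \<Sum>m\<in>T2_monoms. \<Sum>l<5. if ?e p l = m then f m * N p l else 0)"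
    by (rule sum.swap)
  also have "\<dots> = (\<Sum>p<5. \<Sum>l<5. \<Sum>m\<in>T2_monoms. if ?e p l = m then f m * N p l else 0)"
    by (intro sum.cong refl sum.swap)
  also have "\<dots> = (\<Sum>p<5. \<Sum>l<5. f (?e p l) * N p l)"
    using finite_T2_monoms single_add_single_in_T2_monoms by (intro sum.cong refl) simp
  finally show ?thesis .
qed

lemma tangent_form_add:
  "tangent_form r a (\<lambda>p k. M p k + M' p k) (\<lambda>i j. H i j + H' i j) (\<lambda>i p. \<beta> i p + \<beta>' i p) i =
   (\<lambda>p l. tangent_form r a M H \<beta> i p l + tangent_form r a M' H' \<beta>' i p l)"
  by (intro ext) (simp add: tangent_form_def algebra_simps sum.distrib)

lemma tangent_form_scale:
  "tangent_form r a (\<lambda>p k. c * M p k) (\<lambda>i j. c * H i j) (\<lambda>i p. c * \<beta> i p) i =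
   (\<lambda>p l. c * tangent_form r a M H \<beta> i p l)"
  by (intro ext) (simp add: tangent_form_def algebra_simps sum_distrib_left)

text \<open>The first-order terms form a subspace, so by
  \<open>interpolation_if_annihilator_trivial\<close> only functionals killing it have to be
  excluded. Testing such a functional on unit variations of \<open>H\<close>, \<open>\<beta>\<close>
  and \<open>M\<close> produces the three conditions in \<open>rigid\<close>.\<close>

lemma rigid_imp_tangent_surj:
  fixes a :: "nat \<Rightarrow> nat \<Rightarrow> 'a::field_char_0"
  assumes "rigid r a"
  shows "\<exists>M H \<beta>. \<forall>i<r. \<forall>m\<in>T2_monoms. mcoeff (form_of (tangent_form r a M H \<beta> i)) m = y (i, m)"
proof -
  define T where "T M H \<beta> = (\<lambda>(i, m). mcoeff (form_of (tangent_form r a M H \<beta> i)) m)" for M H \<beta>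
  define U where "U = {u. \<exists>M H \<beta>. u = T M H \<beta>}"
  have "\<exists>u\<in>U. \<forall>x\<in>{..<r} \<times> T2_monoms. u x = y x"
  proof (rule interpolation_if_annihilator_trivial)
    show "finite ({..<r} \<times> T2_monoms)" using finite_T2_monoms by simp
    have "(\<lambda>_. 0) = T (\<lambda>_ _. 0) (\<lambda>_ _. 0) (\<lambda>_ _. 0)"
      by (rule ext) (simp add: T_def tangent_form_def mcoeff_form_of cong: if_cong split: prod.splits)
    then show "(\<lambda>_. 0) \<in> U" unfolding U_def by blast
  next
    fix u v assume "u \<in> U" "v \<in> U"
    then obtain M H \<beta> M' H' \<beta>' where "u = T M H \<beta>" "v = T M' H' \<beta>'" unfolding U_def by blast
    then have "(\<lambda>x. u x + v x) =
        T (\<lambda>p k. M p k + M' p k) (\<lambda>i j. H i j + H' i j) (\<lambda>i p. \<beta> i p + \<beta>' i p)"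
      by (intro ext) (simp add: T_def form_of_add tangent_form_add lookup_add split: prod.splits)
    then show "(\<lambda>x. u x + v x) \<in> U" unfolding U_def by blast
  next
    fix c u assume "u \<in> U"
    then obtain M H \<beta> where "u = T M H \<beta>" unfolding U_def by blast
    then have "(\<lambda>x. c * u x) = T (\<lambda>p k. c * M p k) (\<lambda>i j. c * H i j) (\<lambda>i p. c * \<beta> i p)"
      by (intro ext) (simp add: T_def form_of_scale tangent_form_scale mcoeff_Cst_mult split: prod.splits)
    then show "(\<lambda>x. c * u x) \<in> U" unfolding U_def by blast
  next
    fix f assume f: "\<forall>u\<in>U. (\<Sum>x\<in>{..<r} \<times> T2_monoms. f x * u x) = 0"
    define S where "S i p l = f (i, Poly_Mapping.single p 1 + Poly_Mapping.single l 1)" for i p l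
    have pair: "(\<Sum>i<r. \<Sum>p<5. \<Sum>l<5. S i p l * tangent_form r a M H \<beta> i p l) = 0" for M H \<beta>
    proof -
      have "0 = (\<Sum>x\<in>{..<r} \<times> T2_monoms. f x * T M H \<beta> x)" using f unfolding U_def by auto
      also have "\<dots> = (\<Sum>i<r. \<Sum>m\<in>T2_monoms. f (i, m) * T M H \<beta> (i, m))"
        by (simp add: sum.cartesian_product case_prod_unfold)
      also have "\<dots> = (\<Sum>i<r. \<Sum>p<5. \<Sum>l<5. S i p l * tangent_form r a M H \<beta> i p l)"
        by (simp add: T_def S_def sum_T2_monoms_mcoeff_form_of)
      finally show ?thesis by simp
    qed
    have sym: "S i p l = S i l p" for i p l by (simp add: S_def add.commute)
    have "(\<Sum>p<5. \<Sum>l<5. q_mat (a j) p l * S i p l) = 0" if "i < r" "j < r" for i j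
    proof -
      \<comment> \<open>The unit variation of \<open>H\<close> at (i, j) adds q (a j) to the i-th
        form and leaves the others fixed.\<close>
      have "tangent_form r a (\<lambda>_ _. 0) (\<lambda>i' j'. if i' = i then if j' = j then 1 else 0 else 0) (\<lambda>_ _. 0) i' p l
          = (if i' = i then q_mat (a j) p l else 0)" for i' p l
        using that by (simp add: tangent_form_def if_distrib[of "\<lambda>x. x * _"] cong: if_cong)
      then have "(\<Sum>i'<r. \<Sum>p<5. \<Sum>l<5. S i' p l * (if i' = i then q_mat (a j) p l else 0)) = 0"
        using pair[of "\<lambda>_ _. 0" "\<lambda>i' j'. if i' = i then if j' = j then 1 else 0 else 0" "\<lambda>_ _. 0"] by simp
      moreover have "(\<Sum>p<5. \<Sum>l<5. S i' p l * (if i' = i then q_mat (a j) p l else 0)) =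
          (if i' = i then (\<Sum>p<5. \<Sum>l<5. S i p l * q_mat (a j) p l) else 0)" for i'
        by simp
      ultimately show ?thesis using that by (simp add: mult.commute)
    qed
    moreover have "S i s s = 2 * (\<Sum>l<5. a i l * S i s l)" if "i < r" "s < 5" for i s
    proof -
      \<comment> \<open>Unit variation of coordinate s of point i: the derivative of q is E_ss - e_s
        a^T - a e_s^T, and its pairing with a symmetric S is S_ss - 2 (S a)_s.\<close>
      let ?b = "\<lambda>i' p. if i' = i then if p = s then 1 else 0 else (0::'a)"
      have "tangent_form r a (\<lambda>_ _. 0) (\<lambda>_ _. 0) ?b i' p l
          = (if i' = i then (if p = s then if l = s then 1 else 0 else 0) - (if p = s then a i l else 0)
              - (if l = s then a i p else 0) else 0)" for i' p l
        by (simp add: tangent_form_def)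
      then have "(\<Sum>i'<r. \<Sum>p<5. \<Sum>l<5. S i' p l * (if i' = i then (if p = s then if l = s then 1 else 0 else 0)
          - (if p = s then a i l else 0) - (if l = s then a i p else 0) else 0)) = 0"
        using pair[of "\<lambda>_ _. 0" "\<lambda>_ _. 0" ?b] by simp
      moreover have "(\<Sum>p<5. \<Sum>l<5. S i' p l * (if i' = i then (if p = s then if l = s then 1 else 0 else 0)
          - (if p = s then a i l else 0) - (if l = s then a i p else 0) else 0)) =
          (if i' = i then (\<Sum>p<5. \<Sum>l<5. (if p = s then if l = s then S i p l else 0 else 0)
            - (if p = s then S i p l * a i l else 0) - (if l = s then S i p l * a i p else 0)) else 0)" for i'
        by (auto intro!: sum.cong simp: algebra_simps)
      ultimately have "(\<Sum>p<5. \<Sum>l<5. (if p = s then if l = s then S i p l else 0 else 0)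
            - (if p = s then S i p l * a i l else 0) - (if l = s then S i p l * a i p else 0)) = 0"
        using that by simp
      moreover have "(\<Sum>l<5. if p = s then c l else 0) = (if p = s then \<Sum>l<5. c l else 0)"
        for p and c :: "nat \<Rightarrow> 'a" by simp
      ultimately have "S i s s - (\<Sum>l<5. S i s l * a i l) - (\<Sum>p<5. S i p s * a i p) = 0"
        using that by (simp add: sum_subtractf)
      moreover have "(\<Sum>p<5. S i p s * a i p) = (\<Sum>l<5. a i l * S i s l)"
        by (intro sum.cong refl) (simp add: sym[of i _ s] mult.commute)
      ultimately show ?thesis by (simp add: mult.commute algebra_simps)
    qed
    moreover have "(\<Sum>i<r. \<Sum>l<5. q_mat (a i) k l * S i l s) = 0" if "k < 5" "s < 5" for k s
    proof -
      \<comment> \<open>For the matrix unit M at (s, k) the terms M q and q M^T pair equally with a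
        symmetric S. The resulting factor 2 is cancelled in characteristic zero.\<close>
      let ?M = "\<lambda>p k'. if p = s then if k' = k then 1 else 0 else (0::'a)"
      have Qs: "q_mat (a i) p l = q_mat (a i) l p" for i p l by (simp add: q_mat_def mult.commute)
      have "tangent_form r a ?M (\<lambda>_ _. 0) (\<lambda>_ _. 0) i p l =
          (if p = s then q_mat (a i) k l else 0) + (if l = s then q_mat (a i) p k else 0)" for i p l
        using that by (simp add: tangent_form_def if_distrib[of "\<lambda>x. x * _"] if_distrib[of "\<lambda>x. _ * x"] cong: if_cong)
      then have "(\<Sum>i<r. \<Sum>p<5. \<Sum>l<5. S i p l * ((if p = s then q_mat (a i) k l else 0)
          + (if l = s then q_mat (a i) p k else 0))) = 0"
        using pair[of ?M "\<lambda>_ _. 0" "\<lambda>_ _. 0"] by simp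
      moreover have "(\<Sum>p<5. \<Sum>l<5. S i p l * ((if p = s then q_mat (a i) k l else 0)
          + (if l = s then q_mat (a i) p k else 0))) = 2 * (\<Sum>l<5. q_mat (a i) k l * S i l s)" for i
      proof -
        have "(\<Sum>l<5. if p = s then c l else 0) = (if p = s then \<Sum>l<5. c l else 0)"
          for p and c :: "nat \<Rightarrow> 'a" by simp
        then have "(\<Sum>p<5. \<Sum>l<5. S i p l * ((if p = s then q_mat (a i) k l else 0)
          + (if l = s then q_mat (a i) p k else 0))) =
           (\<Sum>l<5. S i s l * q_mat (a i) k l) + (\<Sum>p<5. S i p s * q_mat (a i) p k)"
          using that by (simp add: distrib_left sum.distrib if_distrib[of "\<lambda>x. _ * x"] cong: if_cong)
        also have "(\<Sum>l<5. S i s l * q_mat (a i) k l) = (\<Sum>l<5. q_mat (a i) k l * S i l s)"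
          by (intro sum.cong refl) (simp add: sym[of i _ s] mult.commute)
        also have "(\<Sum>p<5. S i p s * q_mat (a i) p k) = (\<Sum>l<5. q_mat (a i) k l * S i l s)"
          by (intro sum.cong refl) (simp add: Qs[of i _ k] mult.commute)
        finally show ?thesis by simp
      qed
      ultimately show ?thesis by (simp flip: sum_distrib_left)
    qed
    ultimately have S0: "\<And>i p l. i < r \<Longrightarrow> p < 5 \<Longrightarrow> l < 5 \<Longrightarrow> S i p l = 0"
      using assms sym unfolding rigid_def by blast
    show "\<forall>x\<in>{..<r} \<times> T2_monoms. f x = 0"
    proof
      fix x assume "x \<in> {..<r} \<times> T2_monoms"
      then obtain i p l where "x = (i, Poly_Mapping.single p 1 + Poly_Mapping.single l 1)"
        "i < r" "p < 5" "l < 5"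
        unfolding T2_monoms_eq by force
      then show "f x = 0" using S0 unfolding S_def by simp
    qed
  qed
  then show ?thesis unfolding U_def T_def by fastforce
qed

section \<open>Coefficients of t^0 and t^1 along polynomial curves of frames\<close>

lemma coeff_mult_1: "coeff (x * y) (Suc 0) = coeff x 0 * coeff y (Suc 0) + coeff x (Suc 0) * coeff y 0"
  for x y :: "'a::comm_ring_1 poly"
  by (simp add: coeff_mult)

lemma coeff_mcoeff_form_of:
  "coeff (mcoeff (form_of N) m) n = mcoeff (form_of (\<lambda>p l. coeff (N p l) n)) m"
  by (simp add: mcoeff_form_of coeff_sum if_distrib[of "\<lambda>x. coeff x n"] cong: if_cong)

lemma poly_mcoeff_form_of:
  "poly (mcoeff (form_of N) m) t = mcoeff (form_of (\<lambda>p l. poly (N p l) t)) m"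
  by (simp add: mcoeff_form_of poly_sum if_distrib[of "\<lambda>x. poly x t"] cong: if_cong)

text \<open>At t = 0 the matrix 1 + t A is the identity, so the determinant takes the value 1
  there.\<close>

lemma poly_det_nonzero:
  fixes A :: "nat \<Rightarrow> nat \<Rightarrow> 'a::field"
  shows "det (mat n n (\<lambda>(i, j). [:if i = j then 1 else 0, A i j:])) \<noteq> 0" (is "det ?M \<noteq> 0")
proof
  assume "det ?M = 0"
  interpret c: comm_ring_hom "\<lambda>p::'a poly. poly p 0"
    by unfold_locales auto
  have "map_mat (\<lambda>p. poly p 0) ?M = 1\<^sub>m n"
    by (rule eq_matI) auto
  then have "poly (det ?M) 0 = 1" by (simp flip: c.hom_det)
  then show False using \<open>det ?M = 0\<close> by simp
qed

lemma poly_det: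
  fixes A :: "nat \<Rightarrow> nat \<Rightarrow> 'a::field poly"
  shows "poly (det (mat n n (\<lambda>(i, j). A i j))) t = det (mat n n (\<lambda>(i, j). poly (A i j) t))"
proof -
  interpret c: comm_ring_hom "\<lambda>p::'a poly. poly p t"
    by unfold_locales auto
  have "map_mat (\<lambda>p. poly p t) (mat n n (\<lambda>(i, j). A i j)) = mat n n (\<lambda>(i, j). poly (A i j) t)"
    by (rule eq_matI) auto
  then show ?thesis by (simp flip: c.hom_det)
qed

text \<open>Rigidity lets the curve g = 1 + t M, h = 1 + t H, a + t \<beta> leave the base frame
  with any prescribed velocity y. Wherever g(t) is invertible,
  \<open>pullback_vanishes_on_frames\<close> applies to the frame at t.\<close>

lemma pullback_vanishes_if_rigid:
  fixes a :: "nat \<Rightarrow> nat \<Rightarrow> 'a::field_char_0" and F :: "((nat \<Rightarrow>\<^sub>0 nat) set, 'a) mpol"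
  assumes "rigid r a" and F: "F \<in> plucker_polys r" "vanishes_on_image r F"
    and J: "J \<subseteq> T2_monoms" "card J = r"
  shows "meval f (plucker_pullback r F J) = 0"
proof (rule vanishing_on_curves_in_all_directions)
  fix y :: "nat \<times> (nat \<Rightarrow>\<^sub>0 nat) \<Rightarrow> 'a"
  obtain d where hom: "homogeneous d F" using F(1) by (auto simp: plucker_polys_def)
  obtain M H \<beta> where T: "\<And>i m. i < r \<Longrightarrow> m \<in> T2_monoms \<Longrightarrow> mcoeff (form_of (tangent_form r a M H \<beta> i)) m = y (i, m)"
    using rigid_imp_tangent_surj[OF assms(1), of y] by blast
  define gp where "gp p k = [:if p = k then 1 else 0, M p k:]" for p k
  define hp where "hp i j = [:if i = j then 1 else 0, H i j:]" for i j
  define ap where "ap i p = [:a i p, \<beta> i p:]" for i p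
  define Np where "Np i p l = (\<Sum>j<r. hp i j * congruence gp (q_mat (ap j)) p l)" for i p l
  define c where "c = (\<lambda>(i, m). mcoeff (form_of (Np i)) m)"
  \<comment> \<open>\<open>poly_shift 1\<close> drops the constant term and divides by t. The
    remaining variables do not occur in the pullback; there the curve only has to have velocity
    \<open>y\<close>.\<close>
  define w where "w = (\<lambda>(i, m). if i < r \<and> m \<in> T2_monoms then poly_shift 1 (c (i, m)) else [:y (i, m):])"
  define b where "b = (\<lambda>(i, m). mcoeff (form_of (q_mat (a i))) m)"
  have Q0: "coeff (q_mat (ap j) p l) 0 = q_mat (a j) p l" for j p l
    by (simp add: q_mat_def ap_def)
  have Q1: "coeff (q_mat (ap j) p l) (Suc 0) =
      (if p = l then \<beta> j p else 0) - \<beta> j p * a j l - a j p * \<beta> j l" for j p l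
    by (simp add: q_mat_def ap_def coeff_mult_1)
  have g0: "coeff (gp p k) 0 = (if p = k then 1 else 0)" and g1: "coeff (gp p k) (Suc 0) = M p k" for p k
    by (simp_all add: gp_def)
  have delta: "(\<Sum>k<5. (if p = k then 1 else 0) * u k) = (u p :: 'a)"
    "(\<Sum>k<5. u k * (if p = k then 1 else 0)) = u p" if "p < 5" for p :: nat and u
    using that by (simp_all add: if_distrib[of "\<lambda>x. x * _"] if_distrib[of "\<lambda>x. _ * x"] cong: if_cong)
  have C0: "coeff (congruence gp N p l) 0 = coeff (N p l) 0" if "p < 5" "l < 5" for N p l
    using that by (simp add: congruence_def coeff_sum coeff_mult_0 g0 delta)
  \<comment> \<open>The product rule for g N g^T at g = 1.\<close>
  have C1: "coeff (congruence gp N p l) (Suc 0) = (\<Sum>k<5. M p k * coeff (N k l) 0)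
      + (\<Sum>k<5. coeff (N p k) 0 * M l k) + coeff (N p l) (Suc 0)" if "p < 5" "l < 5" for N p l
  proof -
    have "coeff (congruence gp N p l) (Suc 0) = (\<Sum>k<5. \<Sum>m<5.
        (if p = k then 1 else 0) * (coeff (N k m) 0 * M l m)
        + (if p = k then 1 else 0) * (coeff (N k m) (Suc 0) * (if l = m then 1 else 0))
        + M p k * (coeff (N k m) 0 * (if l = m then 1 else 0)))"
      by (simp add: congruence_def coeff_sum coeff_mult_0 coeff_mult_1 g0 g1 algebra_simps)
    then show ?thesis
      using that by (simp add: sum.distrib delta flip: sum_distrib_left)
  qed
  have deltar: "(\<Sum>k<r. (if p = k then 1 else 0) * u k) = (u p :: 'a)" if "p < r" for p u
    using that by (simp add: if_distrib[of "\<lambda>x. x * _"] cong: if_cong)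
  have N0: "coeff (Np i p l) 0 = q_mat (a i) p l" if "i < r" "p < 5" "l < 5" for i p l
    using that by (simp add: Np_def coeff_sum coeff_mult_0 C0 Q0 hp_def deltar)
  \<comment> \<open>The velocity of h multiplies the base forms; since h = 1 at t = 0, the rest is
    the velocity of the i-th translated form.\<close>
  have N1: "coeff (Np i p l) (Suc 0) = tangent_form r a M H \<beta> i p l" if "i < r" "p < 5" "l < 5" for i p l
  proof -
    have "coeff (Np i p l) (Suc 0) = (\<Sum>j<r. (if i = j then 1 else 0) * coeff (congruence gp (q_mat (ap j)) p l) (Suc 0))
      + (\<Sum>j<r. H i j * q_mat (a j) p l)"
      using that by (simp add: Np_def coeff_sum coeff_mult_1 C0 Q0 hp_def sum.distrib)
    then show ?thesis
      using that by (simp add: deltar C1 Q0 Q1 tangent_form_def)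
  qed
  have c0: "coeff (c (i, m)) 0 = b (i, m)" if "i < r" for i m
    using that unfolding c_def b_def prod.case coeff_mcoeff_form_of
    by (intro arg_cong2[of _ _ _ _ mcoeff] form_of_cong N0 refl)
  have c1: "coeff (c (i, m)) (Suc 0) = y (i, m)" if "i < r" "m \<in> T2_monoms" for i m
  proof -
    have "coeff (c (i, m)) (Suc 0) = mcoeff (form_of (tangent_form r a M H \<beta> i)) m"
      using that(1) unfolding c_def prod.case coeff_mcoeff_form_of
      by (intro arg_cong2[of _ _ _ _ mcoeff] form_of_cong N1 refl)
    then show ?thesis using T that by simp
  qed
  have bw: "pCons (b (i, m)) (w (i, m)) = mcoeff (form_of (Np i)) m" if "i < r" "m \<in> T2_monoms" for i m
  proof -
    have "pCons (b (i, m)) (w (i, m)) = c (i, m)"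
    proof (rule poly_eqI)
      fix n show "coeff (pCons (b (i, m)) (w (i, m))) n = coeff (c (i, m)) n"
        using that by (cases n) (simp_all add: c0 w_def coeff_poly_shift)
    qed
    then show ?thesis by (simp add: c_def)
  qed
  have w0: "coeff (w x) 0 = y x" for x
    by (cases x) (simp add: w_def coeff_poly_shift c1)
  let ?E = "msubst (\<lambda>c. [:c:]) (\<lambda>x. pCons (b x) (w x)) (plucker_pullback r F J)"
  \<comment> \<open>The factor det g(t) takes care of the t where g(t) is singular. It is a nonzero
    polynomial and is cancelled at the end.\<close>
  let ?P = "det (mat 5 5 (\<lambda>(i, j). gp i j)) * ?E"
  have "poly ?P t = 0" for t
  proof (cases "poly (det (mat 5 5 (\<lambda>(i, j). gp i j))) t = 0")
    case False
    let ?b = "\<lambda>i. form_of (\<lambda>p l. poly (Np i p l) t)"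
    have "poly ?E t = meval (\<lambda>x. poly (pCons (b x) (w x)) t) (plucker_pullback r F J)"
      by (rule poly_msubst_const)
    also have "\<dots> = meval (plucker r ?b) F * plucker r ?b J"
      by (intro msubst_plucker_pullback meval.coeff_hom_axioms F J)
        (simp only: bw poly_mcoeff_form_of)
    also have "\<dots> = 0"
    proof (rule pullback_vanishes_on_frames[OF hom F(2)])
      show "mat 5 5 (\<lambda>(p, l). poly (gp p l) t) \<in> GL5"
        using False by (intro GL5_if_det_nonzero) (auto simp: poly_det)
      fix i
      have "poly (Np i p l) t = (\<Sum>j<r. poly (hp i j) t *
          congruence (\<lambda>p l. poly (gp p l) t) (q_mat (\<lambda>p. poly (ap j p) t)) p l)" for p l
        unfolding Np_def congruence_def q_mat_def poly_sum poly_mult poly_diff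
        by (intro sum.cong refl arg_cong2[of _ _ _ _ "(*)"]) auto
      then show "?b i = (\<Sum>j<r. Cst (poly (hp i j) t) *
          form_of (congruence (\<lambda>p l. poly (gp p l) t) (q_mat (\<lambda>p. poly (ap j p) t))))"
        by (simp add: form_of_sum)
    qed
    finally show ?thesis by simp
  qed simp
  then have "?P = 0" by (simp only: poly_all_0_iff_0[symmetric]) blast
  moreover have "det (mat 5 5 (\<lambda>(i, j). gp i j)) \<noteq> 0"
    unfolding gp_def by (rule poly_det_nonzero)
  ultimately have "?E = 0" by simp
  then show "\<exists>w. (\<forall>x. coeff (w x) 0 = y x) \<and>
      msubst (\<lambda>c. [:c:]) (\<lambda>x. pCons (b x) (w x)) (plucker_pullback r F J) = 0"
    using w0 by blast
qed

text \<open>Extend \<open>b\<close> to a basis of \<open>T2\<close> by monomials; \<open>J\<close> consists of the monomials not used.\<close>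

lemma plucker_nonzero_if_indep:
  fixes b :: "nat \<Rightarrow> (nat, 'a::field) mpol"
  assumes "basis_of r b W" "W \<in> Gr r"
  obtains J where "J \<subseteq> T2_monoms" "card J = r" "plucker r b J \<noteq> 0"
proof -
  let ?s = "\<lambda>m. Poly_Mapping.single m (1::'a)" and ?S = "b ` {..<r}"
  have inj: "inj_on b {..<r}" and ind: "mp.independent ?S" and spn: "mp.span ?S = W"
    using assms(1) by (auto simp: basis_of_def)
  have inj_s: "inj_on ?s A" for A
    by (rule inj_onI) (metis lookup_single_eq lookup_single_not_eq one_neq_zero)
  have S_T2: "?S \<subseteq> T2"
    using assms(2) spn mp.span_superset[of ?S] by (auto simp: Gr_def)
  obtain B where B: "?S \<subseteq> B" "B \<subseteq> ?S \<union> ?s ` T2_monoms" "mp.independent B"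
      "?S \<union> ?s ` T2_monoms \<subseteq> mp.span B"
    using mp.maximal_independent_subset_extend[OF _ ind, of "?S \<union> ?s ` T2_monoms"] by blast
  have finB: "finite B" by (rule finite_subset[OF B(2)]) (simp add: finite_T2_monoms)
  have "mp.span B = T2"
  proof
    show "mp.span B \<subseteq> T2"
      unfolding T2_span using B(2) S_T2[unfolded T2_span]
      by (intro mp.span_minimal mp.subspace_span) (auto intro: mp.span_base)
    show "T2 \<subseteq> mp.span B"
      unfolding T2_span using B(4) by (intro mp.span_minimal mp.subspace_span) auto
  qed
  then have cardB: "card B = 15"
    using mp.dim_span_eq_card_independent[OF B(3)] dim_T2[where 'a = 'a] by simp
  define K where "K = {m \<in> T2_monoms. ?s m \<in> B - ?S}"
  have sK: "?s ` K = B - ?S" using B(2) by (auto simp: K_def)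
  have finK: "finite K" by (simp add: K_def finite_T2_monoms)
  have "card K = card (B - ?S)" unfolding sK[symmetric] by (simp add: card_image inj_s)
  also have "\<dots> = 15 - r" using B(1) cardB by (simp add: card_Diff_subset card_image[OF inj])
  finally have cardK: "card K = 15 - r" .
  have "r \<le> 15" using card_mono[OF finB B(1)] cardB by (simp add: card_image[OF inj])
  define J where "J = T2_monoms - K"
  have "card J = card T2_monoms - card K"
    unfolding J_def using finK by (intro card_Diff_subset) (auto simp: K_def)
  then have J: "J \<subseteq> T2_monoms" "card J = r"
    using \<open>r \<le> 15\<close> by (auto simp: J_def card_T2_monoms cardK)
  have finJ: "finite J" using J(1) finite_T2_monoms finite_subset by blast
  moreover have "plucker r b J \<noteq> 0"
  proof
    let ?M = "mat r r (\<lambda>(i, j). mcoeff (b i) (sorted_list_of_set J ! j))"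
    assume "plucker r b J = 0"
    then have "det (transpose_mat ?M) = 0" by (simp add: plucker_def det_transpose[of _ r])
    then obtain v where v: "v \<in> carrier_vec r" "v \<noteq> 0\<^sub>v r" "transpose_mat ?M *\<^sub>v v = 0\<^sub>v r"
      by (subst (asm) det_0_iff_vec_prod_zero_field[of _ r]) auto
    \<comment> \<open>A kernel vector of the transposed minor gives a combination of the b i without
      monomials from J, so it is supported on K. Expanding it in the monomials of K is a relation
      inside the independent set B, which forces v = 0.\<close>
    define p where "p = (\<Sum>i<r. Cst (v $ i) * b i)"
    have pJ: "mcoeff p m = 0" if "m \<in> J" for m
    proof -
      have "m \<in> set (sorted_list_of_set J)" using that finJ by simp
      then obtain k where k: "k < r" "sorted_list_of_set J ! k = m"
        using J(2) by (auto simp: in_set_conv_nth)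
      have "(transpose_mat ?M *\<^sub>v v) $ k = 0" using v k by simp
      then show ?thesis using k v(1)
        by (simp add: p_def lookup_sum mcoeff_Cst_mult scalar_prod_def lessThan_atLeast0)
          (simp only: mult.commute)
    qed
    have "p \<in> mp.span ?S" unfolding p_def by (intro mp.span_sum mp.span_scale mp.span_base) auto
    also have "\<dots> \<subseteq> T2" using S_T2 \<open>mp.span B = T2\<close> B(1) mp.span_mono by blast
    finally have "Poly_Mapping.keys p \<subseteq> T2_monoms"
      by (auto simp: T2_def T2_monoms_def homogeneous_def mvars_def)
    then have "Poly_Mapping.keys p \<subseteq> K" using pJ by (auto simp: J_def in_keys_iff)
    then have "p = (\<Sum>m\<in>K. Poly_Mapping.single m (mcoeff p m))"
      by (subst mpol_sum_monomials[of p]) (auto intro!: sum.mono_neutral_left simp: finK in_keys_iff)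
    also have "\<dots> = (\<Sum>m\<in>K. Cst (mcoeff p m) * ?s m)" by (simp add: Cst_def mult_single)
    finally have pK: "p = (\<Sum>m\<in>K. Cst (mcoeff p m) * ?s m)" .
    \<comment> \<open>Coefficients of this relation as a function on B: v on the forms, minus the
      coefficients of \<open>p\<close> on the monomials. \<open>the_inv_into\<close> recovers the
      indices.\<close>
    define f where "f x = (if x \<in> ?S then v $ the_inv_into {..<r} b x
        else - mcoeff p (the_inv_into K ?s x))" for x
    have fb: "f (b i) = v $ i" if "i < r" for i
      using that by (simp add: f_def the_inv_into_f_f[OF inj])
    have fs: "f (?s m) = - mcoeff p m" if "m \<in> K" for m
      using that by (simp add: f_def the_inv_into_f_f[OF inj_s] K_def)
    have "(\<Sum>x\<in>B. Cst (f x) * x) = (\<Sum>x\<in>B - ?S. Cst (f x) * x) + (\<Sum>x\<in>?S. Cst (f x) * x)"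
      by (rule sum.subset_diff[OF B(1) finB])
    also have "(\<Sum>x\<in>?S. Cst (f x) * x) = p" by (simp add: sum.reindex[OF inj] fb p_def)
    also have "(\<Sum>x\<in>B - ?S. Cst (f x) * x) = (\<Sum>m\<in>K. Cst (- mcoeff p m) * ?s m)"
      unfolding sK[symmetric] by (simp add: sum.reindex[OF inj_s] fs)
    also have "\<dots> = - p" by (subst (2) pK) (simp add: Cst_uminus sum_negf)
    finally have "(\<Sum>x\<in>B. Cst (f x) * x) = 0" by simp
    then have "f (b i) = 0" if "i < r" for i
      using B(1) that mp.independentD[OF B(3) finB order_refl, of f "b i"] by blast
    then have "v = 0\<^sub>v r" using v(1) by (intro eq_vecI) (auto simp: fb)
    then show False using v(2) by simp
  qed
  ultimately show thesis using J that by blast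
qed

text \<open>An open neighbourhood of W comes with a defining F that is nonzero at W. If the image
  missed the neighbourhood, F would vanish on the whole image and its pullback would be 0
  everywhere; yet at a basis of W both factors of the pullback are nonzero.\<close>

lemma dominant_if_rigid:
  fixes a :: "nat \<Rightarrow> nat \<Rightarrow> 'k::{alg_closed_field, field_char_0}"
  assumes "rigid r a"
  shows "dominant
    (Phi_domain r :: ('k mat \<times> (nat \<Rightarrow> 'k vec)) set)
    (Phi r) (gr_zariski r)"
  unfolding dominant_def
proof
  show sub: "Phi r ` Phi_domain r \<subseteq> topspace (gr_zariski r :: (nat, 'k) mpol set topology)"
    unfolding topspace_gr_zariski using Phi_in_Gr by auto
  show "gr_zariski r closure_of Phi r ` Phi_domain r = topspace (gr_zariski r :: (nat, 'k) mpol set topology)"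
  proof
    show "topspace (gr_zariski r) \<subseteq> gr_zariski r closure_of Phi r ` (Phi_domain r :: ('k mat \<times> (nat \<Rightarrow> 'k vec)) set)"
    proof
      fix W :: "(nat, 'k) mpol set" assume W: "W \<in> topspace (gr_zariski r)"
      show "W \<in> gr_zariski r closure_of Phi r ` Phi_domain r"
        unfolding in_closure_of
      proof (intro conjI W allI impI, elim conjE)
        fix V assume "W \<in> V" "openin (gr_zariski r) V"
        then obtain S where S: "S \<subseteq> plucker_polys r" "V = Gr r - zero_locus r S"
          unfolding openin_gr_zariski by blast
        then obtain F b where F: "F \<in> S" "basis_of r b W" "meval (plucker r b) F \<noteq> 0"
          using \<open>W \<in> V\<close> by (auto simp: zero_locus_def)
        obtain J where J: "J \<subseteq> T2_monoms" "card J = r" "plucker r b J \<noteq> 0"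
          using plucker_nonzero_if_indep[OF F(2)] W by (auto simp: topspace_gr_zariski)
        have "F \<in> plucker_polys r" using F S by blast
        show "\<exists>y. y \<in> Phi r ` Phi_domain r \<and> y \<in> V"
        proof (rule ccontr)
          assume no: "\<not> ?thesis"
          have "vanishes_on_image r F"
            unfolding vanishes_on_image_def
          proof (intro ballI allI impI)
            fix x :: "'k mat \<times> (nat \<Rightarrow> 'k vec)" and b' assume x: "x \<in> Phi_domain r" "basis_of r b' (Phi r x)"
            then have "Phi r x \<in> Gr r" "Phi r x \<notin> V" using sub no topspace_gr_zariski by blast+
            then have "Phi r x \<in> zero_locus r S" using S by blast
            then show "meval (plucker r b') F = 0" using F(1) x(2) by (auto simp: zero_locus_def)
          qed
          then have "meval (\<lambda>(i, m). mcoeff (b i) m) (plucker_pullback r F J) = 0"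
            by (intro pullback_vanishes_if_rigid[OF assms \<open>F \<in> plucker_polys r\<close>] J)
          also have "meval (\<lambda>(i, m). mcoeff (b i) m) (plucker_pullback r F J) =
              meval (plucker r b) F * plucker r b J"
            by (intro msubst_plucker_pullback meval.coeff_hom_axioms \<open>F \<in> plucker_polys r\<close> J) simp
          finally show False using F J by simp
        qed
      qed
    qed
  qed (rule closure_of_subset_topspace)
qed

section \<open>Explicit points\<close>

text \<open>The condition on the points is restated as a difference equal to 0, so that all three
  families of equations can be written out by one pattern.\<close>

lemma rigidI:
  assumes "\<And>S :: nat \<Rightarrow> nat \<Rightarrow> nat \<Rightarrow> 'a.
    (\<And>i p l. S i p l = S i l p) \<Longrightarrow>
    (\<And>i j. i < r \<Longrightarrow> j < r \<Longrightarrow> (\<Sum>p<5. \<Sum>l<5. q_mat (a j) p l * S i p l) = 0) \<Longrightarrow>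
    (\<And>i p. i < r \<Longrightarrow> p < 5 \<Longrightarrow> S i p p - 2 * (\<Sum>l<5. a i l * S i p l) = 0) \<Longrightarrow>
    (\<And>k p. k < 5 \<Longrightarrow> p < 5 \<Longrightarrow> (\<Sum>i<r. \<Sum>l<5. q_mat (a i) k l * S i l p) = 0) \<Longrightarrow>
    \<forall>i<r. \<forall>p<5. \<forall>l<5. S i p l = 0"
  shows "rigid r (a :: nat \<Rightarrow> nat \<Rightarrow> 'a::comm_ring_1)"
  unfolding rigid_def
proof (intro allI impI)
  fix S :: "nat \<Rightarrow> nat \<Rightarrow> nat \<Rightarrow> 'a" and i p l :: nat
  assume h: "\<forall>i p l. S i p l = S i l p"
    "\<forall>i<r. \<forall>j<r. (\<Sum>p<5. \<Sum>l<5. q_mat (a j) p l * S i p l) = 0"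
    "\<forall>i<r. \<forall>p<5. S i p p = 2 * (\<Sum>l<5. a i l * S i p l)"
    "\<forall>k<5. \<forall>p<5. (\<Sum>i<r. \<Sum>l<5. q_mat (a i) k l * S i l p) = 0"
    and "i < r" "p < 5" "l < 5"
  have "\<forall>i<r. \<forall>p<5. \<forall>l<5. S i p l = 0"
  proof (rule assms)
    show "S i p p - 2 * (\<Sum>l<5. a i l * S i p l) = 0" if "i < r" "p < 5" for i p
      using h(3) that by simp
  qed (rule h[rule_format]; assumption)+
  then show "S i p l = 0" using \<open>i < r\<close> \<open>p < 5\<close> \<open>l < 5\<close> by simp
qed

text \<open>Moves every entry into the upper triangle, leaving 15 unknowns per matrix.\<close>

lemma symmetric_entries:
  fixes S :: "nat \<Rightarrow> nat \<Rightarrow> nat \<Rightarrow> 'a"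
  assumes "\<And>i p l. S i p l = S i l p"
  shows "S i 1 0 = S i 0 1" "S i 2 0 = S i 0 2" "S i 3 0 = S i 0 3" "S i 4 0 = S i 0 4"
    "S i 2 1 = S i 1 2" "S i 3 1 = S i 1 3" "S i 4 1 = S i 1 4"
    "S i 3 2 = S i 2 3" "S i 4 2 = S i 2 4" "S i 4 3 = S i 3 4"
  by (rule assms)+

lemma sum_5: "(\<Sum>l<5. f l) = f 0 + f 1 + f 2 + f 3 + f 4" for f :: "nat \<Rightarrow> 'a::comm_monoid_add"
  by (simp add: numeral_eq_Suc)

lemma all_less_5: "(\<forall>l<5. P l) \<longleftrightarrow> P 0 \<and> P 1 \<and> P 2 \<and> P 3 \<and> P 4" for P :: "nat \<Rightarrow> bool"
  by (simp add: numeral_eq_Suc All_less_Suc conj_ac)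

lemma sum_6: "(\<Sum>l<6. f l) = f 0 + f 1 + f 2 + f 3 + f 4 + f 5" for f :: "nat \<Rightarrow> 'a::comm_monoid_add"
  by (simp add: numeral_eq_Suc)

lemma all_less_6: "(\<forall>l<6. P l) \<longleftrightarrow> P 0 \<and> P 1 \<and> P 2 \<and> P 3 \<and> P 4 \<and> P 5" for P :: "nat \<Rightarrow> bool"
  by (simp add: numeral_eq_Suc All_less_Suc conj_ac)

lemma sum_7: "(\<Sum>l<7. f l) = f 0 + f 1 + f 2 + f 3 + f 4 + f 5 + f 6" for f :: "nat \<Rightarrow> 'a::comm_monoid_add"
  by (simp add: numeral_eq_Suc)

lemma all_less_7: "(\<forall>l<7. P l) \<longleftrightarrow> P 0 \<and> P 1 \<and> P 2 \<and> P 3 \<and> P 4 \<and> P 5 \<and> P 6" for P :: "nat \<Rightarrow> bool"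
  by (simp add: numeral_eq_Suc All_less_Suc conj_ac)

lemma sum_8: "(\<Sum>l<8. f l) = f 0 + f 1 + f 2 + f 3 + f 4 + f 5 + f 6 + f 7" for f :: "nat \<Rightarrow> 'a::comm_monoid_add"
  by (simp add: numeral_eq_Suc)

lemma all_less_8: "(\<forall>l<8. P l) \<longleftrightarrow> P 0 \<and> P 1 \<and> P 2 \<and> P 3 \<and> P 4 \<and> P 5 \<and> P 6 \<and> P 7" for P :: "nat \<Rightarrow> bool"
  by (simp add: numeral_eq_Suc All_less_Suc conj_ac)

lemma sum_9: "(\<Sum>l<9. f l) = f 0 + f 1 + f 2 + f 3 + f 4 + f 5 + f 6 + f 7 + f 8" for f :: "nat \<Rightarrow> 'a::comm_monoid_add"
  by (simp add: numeral_eq_Suc)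

lemma all_less_9: "(\<forall>l<9. P l) \<longleftrightarrow> P 0 \<and> P 1 \<and> P 2 \<and> P 3 \<and> P 4 \<and> P 5 \<and> P 6 \<and> P 7 \<and> P 8" for P :: "nat \<Rightarrow> bool"
  by (simp add: numeral_eq_Suc All_less_Suc conj_ac)

text \<open>One elimination step: the pivot x is solved for as a rewrite rule that removes it from
  all later equations.\<close>

lemma solve_two_terms:
  fixes x y :: "'a::field"
  assumes "\<alpha> * x + \<beta> * y = 0" "\<beta> = - (\<alpha> * c)" "\<alpha> \<noteq> 0"
  shows "x = c * y"
proof -
  have "\<alpha> * (x - c * y) = 0" using assms(1,2) by (simp add: algebra_simps)
  then show ?thesis using assms(3) by simp
qed

section \<open>The case r = 6\<close>

text \<open>The points were found by a computer search for tuples whose linear system can be solved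
  using only equations in one or two remaining unknowns.\<close>

definition base_points_6 :: "nat \<Rightarrow> nat \<Rightarrow> 'a::comm_ring_1" where
  "base_points_6 i p =
    ([[0, -1, 1, 1, 0],
     [0, -1, 0, 0, 1],
     [1, 0, 0, 1, 1],
     [1, 0, 0, 1, 0],
     [0, 1, 1, 0, 0],
     [1, 0, 1, 0, 1]] ! i) ! p"

text \<open>The 90 unknowns meet exactly 36 + 30 + 24 equations, which are therefore independent.
  The g-equation for the entry (4, 4) is left out: the trace of the g-equations is a sum of
  Q-equations.\<close>

lemma rigid_base_points_6: "rigid 6 (base_points_6 :: nat \<Rightarrow> nat \<Rightarrow> 'a::field_char_0)"
proof (rule rigidI)
  let ?a = "base_points_6 :: nat \<Rightarrow> nat \<Rightarrow> 'a"
  have A: "?a 0 0 = 0" "?a 0 1 = -1" "?a 0 2 = 1" "?a 0 3 = 1" "?a 0 4 = 0"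
    "?a 1 0 = 0" "?a 1 1 = -1" "?a 1 2 = 0" "?a 1 3 = 0" "?a 1 4 = 1"
    "?a 2 0 = 1" "?a 2 1 = 0" "?a 2 2 = 0" "?a 2 3 = 1" "?a 2 4 = 1"
    "?a 3 0 = 1" "?a 3 1 = 0" "?a 3 2 = 0" "?a 3 3 = 1" "?a 3 4 = 0"
    "?a 4 0 = 0" "?a 4 1 = 1" "?a 4 2 = 1" "?a 4 3 = 0" "?a 4 4 = 0"
    "?a 5 0 = 1" "?a 5 1 = 0" "?a 5 2 = 1" "?a 5 3 = 0" "?a 5 4 = 1"
    by (simp_all add: base_points_6_def)
  fix S :: "nat \<Rightarrow> nat \<Rightarrow> nat \<Rightarrow> 'a"
  assume sym: "\<And>i p l. S i p l = S i l p"
  \<comment> \<open>Keeps the index 1 from becoming Suc 0, where the rewrite rules about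
    \<open>S i 1 l\<close> would not match.\<close>
  note [simp del] = One_nat_def
  assume h1: "\<And>i j. i < 6 \<Longrightarrow> j < 6 \<Longrightarrow> (\<Sum>p<5. \<Sum>l<5. q_mat (?a j) p l * S i p l) = 0"
    and h2: "\<And>i p. i < 6 \<Longrightarrow> p < 5 \<Longrightarrow> S i p p - 2 * (\<Sum>l<5. ?a i l * S i p l) = 0"
    and h3: "\<And>k p. k < 5 \<Longrightarrow> p < 5 \<Longrightarrow> (\<Sum>i<6. \<Sum>l<5. q_mat (?a i) k l * S i l p) = 0"
  note ev = sum_5 sum_6 q_mat_def A symmetric_entries[of S, OF sym] algebra_simps
  \<comment> \<open>The equations are written out under systematic names: \<open>Qj\<close> is
    orthogonality to q of point j, \<open>Tip\<close> belongs to coordinate p of point i, and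
    \<open>Gkp\<close> to the entry (p, k) of the variation of g. \<open>trans\<close> reduces each
    to an identity between the short form and the expanded sum.\<close>
  have Q0: "- 2 * S i 1 1 + 2 * S i 1 2 + 2 * S i 1 3 - 2 * S i 2 3 = 0" if "i < 6" for i
    by (rule trans[OF _ h1[OF that, of 0]]) (simp_all add: ev)
  have Q1: "- 2 * S i 1 1 + 2 * S i 1 4 = 0" if "i < 6" for i
    by (rule trans[OF _ h1[OF that, of 1]]) (simp_all add: ev)
  have Q2: "- 2 * S i 0 3 - 2 * S i 0 4 - 2 * S i 3 4 = 0" if "i < 6" for i
    by (rule trans[OF _ h1[OF that, of 2]]) (simp_all add: ev)
  have Q3: "- 2 * S i 0 3 = 0" if "i < 6" for i
    by (rule trans[OF _ h1[OF that, of 3]]) (simp_all add: ev)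
  have Q4: "- 2 * S i 1 2 = 0" if "i < 6" for i
    by (rule trans[OF _ h1[OF that, of 4]]) (simp_all add: ev)
  have Q5: "- 2 * S i 0 2 - 2 * S i 0 4 - 2 * S i 2 4 = 0" if "i < 6" for i
    by (rule trans[OF _ h1[OF that, of 5]]) (simp_all add: ev)
  have T00: "S 0 0 0 + 2 * S 0 0 1 - 2 * S 0 0 2 - 2 * S 0 0 3 = 0"
    by (rule trans[OF _ h2[of 0 0]]) (simp_all add: ev)
  have T01: "3 * S 0 1 1 - 2 * S 0 1 2 - 2 * S 0 1 3 = 0"
    by (rule trans[OF _ h2[of 0 1]]) (simp_all add: ev)
  have T02: "2 * S 0 1 2 - S 0 2 2 - 2 * S 0 2 3 = 0"
    by (rule trans[OF _ h2[of 0 2]]) (simp_all add: ev)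
  have T03: "2 * S 0 1 3 - 2 * S 0 2 3 - S 0 3 3 = 0"
    by (rule trans[OF _ h2[of 0 3]]) (simp_all add: ev)
  have T04: "2 * S 0 1 4 - 2 * S 0 2 4 - 2 * S 0 3 4 + S 0 4 4 = 0"
    by (rule trans[OF _ h2[of 0 4]]) (simp_all add: ev)
  have T10: "S 1 0 0 + 2 * S 1 0 1 - 2 * S 1 0 4 = 0"
    by (rule trans[OF _ h2[of 1 0]]) (simp_all add: ev)
  have T11: "3 * S 1 1 1 - 2 * S 1 1 4 = 0"
    by (rule trans[OF _ h2[of 1 1]]) (simp_all add: ev)
  have T12: "2 * S 1 1 2 + S 1 2 2 - 2 * S 1 2 4 = 0"
    by (rule trans[OF _ h2[of 1 2]]) (simp_all add: ev)
  have T13: "2 * S 1 1 3 + S 1 3 3 - 2 * S 1 3 4 = 0"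
    by (rule trans[OF _ h2[of 1 3]]) (simp_all add: ev)
  have T14: "2 * S 1 1 4 - S 1 4 4 = 0"
    by (rule trans[OF _ h2[of 1 4]]) (simp_all add: ev)
  have T20: "- S 2 0 0 - 2 * S 2 0 3 - 2 * S 2 0 4 = 0"
    by (rule trans[OF _ h2[of 2 0]]) (simp_all add: ev)
  have T21: "- 2 * S 2 0 1 + S 2 1 1 - 2 * S 2 1 3 - 2 * S 2 1 4 = 0"
    by (rule trans[OF _ h2[of 2 1]]) (simp_all add: ev)
  have T22: "- 2 * S 2 0 2 + S 2 2 2 - 2 * S 2 2 3 - 2 * S 2 2 4 = 0"
    by (rule trans[OF _ h2[of 2 2]]) (simp_all add: ev)
  have T23: "- 2 * S 2 0 3 - S 2 3 3 - 2 * S 2 3 4 = 0"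
    by (rule trans[OF _ h2[of 2 3]]) (simp_all add: ev)
  have T24: "- 2 * S 2 0 4 - 2 * S 2 3 4 - S 2 4 4 = 0"
    by (rule trans[OF _ h2[of 2 4]]) (simp_all add: ev)
  have T30: "- S 3 0 0 - 2 * S 3 0 3 = 0"
    by (rule trans[OF _ h2[of 3 0]]) (simp_all add: ev)
  have T31: "- 2 * S 3 0 1 + S 3 1 1 - 2 * S 3 1 3 = 0"
    by (rule trans[OF _ h2[of 3 1]]) (simp_all add: ev)
  have T32: "- 2 * S 3 0 2 + S 3 2 2 - 2 * S 3 2 3 = 0"
    by (rule trans[OF _ h2[of 3 2]]) (simp_all add: ev)
  have T33: "- 2 * S 3 0 3 - S 3 3 3 = 0"
    by (rule trans[OF _ h2[of 3 3]]) (simp_all add: ev)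
  have T34: "- 2 * S 3 0 4 - 2 * S 3 3 4 + S 3 4 4 = 0"
    by (rule trans[OF _ h2[of 3 4]]) (simp_all add: ev)
  have T40: "S 4 0 0 - 2 * S 4 0 1 - 2 * S 4 0 2 = 0"
    by (rule trans[OF _ h2[of 4 0]]) (simp_all add: ev)
  have T41: "- S 4 1 1 - 2 * S 4 1 2 = 0"
    by (rule trans[OF _ h2[of 4 1]]) (simp_all add: ev)
  have T42: "- 2 * S 4 1 2 - S 4 2 2 = 0"
    by (rule trans[OF _ h2[of 4 2]]) (simp_all add: ev)
  have T43: "- 2 * S 4 1 3 - 2 * S 4 2 3 + S 4 3 3 = 0"
    by (rule trans[OF _ h2[of 4 3]]) (simp_all add: ev)
  have T44: "- 2 * S 4 1 4 - 2 * S 4 2 4 + S 4 4 4 = 0"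
    by (rule trans[OF _ h2[of 4 4]]) (simp_all add: ev)
  have T50: "- S 5 0 0 - 2 * S 5 0 2 - 2 * S 5 0 4 = 0"
    by (rule trans[OF _ h2[of 5 0]]) (simp_all add: ev)
  have T51: "- 2 * S 5 0 1 + S 5 1 1 - 2 * S 5 1 2 - 2 * S 5 1 4 = 0"
    by (rule trans[OF _ h2[of 5 1]]) (simp_all add: ev)
  have T52: "- 2 * S 5 0 2 - S 5 2 2 - 2 * S 5 2 4 = 0"
    by (rule trans[OF _ h2[of 5 2]]) (simp_all add: ev)
  have T53: "- 2 * S 5 0 3 - 2 * S 5 2 3 + S 5 3 3 - 2 * S 5 3 4 = 0"
    by (rule trans[OF _ h2[of 5 3]]) (simp_all add: ev)
  have T54: "- 2 * S 5 0 4 - 2 * S 5 2 4 - S 5 4 4 = 0"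
    by (rule trans[OF _ h2[of 5 4]]) (simp_all add: ev)
  have G00: "- S 2 0 3 - S 2 0 4 - S 3 0 3 - S 5 0 2 - S 5 0 4 = 0"
    by (rule trans[OF _ h3[of 0 0]]) (simp_all add: ev)
  have G01: "- S 2 1 3 - S 2 1 4 - S 3 1 3 - S 5 1 2 - S 5 1 4 = 0"
    by (rule trans[OF _ h3[of 0 1]]) (simp_all add: ev)
  have G02: "- S 2 2 3 - S 2 2 4 - S 3 2 3 - S 5 2 2 - S 5 2 4 = 0"
    by (rule trans[OF _ h3[of 0 2]]) (simp_all add: ev)
  have G03: "- S 2 3 3 - S 2 3 4 - S 3 3 3 - S 5 2 3 - S 5 3 4 = 0"
    by (rule trans[OF _ h3[of 0 3]]) (simp_all add: ev)
  have G04: "- S 2 3 4 - S 2 4 4 - S 3 3 4 - S 5 2 4 - S 5 4 4 = 0"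
    by (rule trans[OF _ h3[of 0 4]]) (simp_all add: ev)
  have G10: "- 2 * S 0 0 1 + S 0 0 2 + S 0 0 3 - 2 * S 1 0 1 + S 1 0 4 - S 4 0 2 = 0"
    by (rule trans[OF _ h3[of 1 0]]) (simp_all add: ev)
  have G11: "- 2 * S 0 1 1 + S 0 1 2 + S 0 1 3 - 2 * S 1 1 1 + S 1 1 4 - S 4 1 2 = 0"
    by (rule trans[OF _ h3[of 1 1]]) (simp_all add: ev)
  have G12: "- 2 * S 0 1 2 + S 0 2 2 + S 0 2 3 - 2 * S 1 1 2 + S 1 2 4 - S 4 2 2 = 0"
    by (rule trans[OF _ h3[of 1 2]]) (simp_all add: ev)
  have G13: "- 2 * S 0 1 3 + S 0 2 3 + S 0 3 3 - 2 * S 1 1 3 + S 1 3 4 - S 4 2 3 = 0"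
    by (rule trans[OF _ h3[of 1 3]]) (simp_all add: ev)
  have G14: "- 2 * S 0 1 4 + S 0 2 4 + S 0 3 4 - 2 * S 1 1 4 + S 1 4 4 - S 4 2 4 = 0"
    by (rule trans[OF _ h3[of 1 4]]) (simp_all add: ev)
  have G20: "S 0 0 1 - S 0 0 3 - S 4 0 1 - S 5 0 0 - S 5 0 4 = 0"
    by (rule trans[OF _ h3[of 2 0]]) (simp_all add: ev)
  have G21: "S 0 1 1 - S 0 1 3 - S 4 1 1 - S 5 0 1 - S 5 1 4 = 0"
    by (rule trans[OF _ h3[of 2 1]]) (simp_all add: ev)
  have G22: "S 0 1 2 - S 0 2 3 - S 4 1 2 - S 5 0 2 - S 5 2 4 = 0"
    by (rule trans[OF _ h3[of 2 2]]) (simp_all add: ev)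
  have G23: "S 0 1 3 - S 0 3 3 - S 4 1 3 - S 5 0 3 - S 5 3 4 = 0"
    by (rule trans[OF _ h3[of 2 3]]) (simp_all add: ev)
  have G24: "S 0 1 4 - S 0 3 4 - S 4 1 4 - S 5 0 4 - S 5 4 4 = 0"
    by (rule trans[OF _ h3[of 2 4]]) (simp_all add: ev)
  have G30: "S 0 0 1 - S 0 0 2 - S 2 0 0 - S 2 0 4 - S 3 0 0 = 0"
    by (rule trans[OF _ h3[of 3 0]]) (simp_all add: ev)
  have G31: "S 0 1 1 - S 0 1 2 - S 2 0 1 - S 2 1 4 - S 3 0 1 = 0"
    by (rule trans[OF _ h3[of 3 1]]) (simp_all add: ev)
  have G32: "S 0 1 2 - S 0 2 2 - S 2 0 2 - S 2 2 4 - S 3 0 2 = 0"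
    by (rule trans[OF _ h3[of 3 2]]) (simp_all add: ev)
  have G33: "S 0 1 3 - S 0 2 3 - S 2 0 3 - S 2 3 4 - S 3 0 3 = 0"
    by (rule trans[OF _ h3[of 3 3]]) (simp_all add: ev)
  have G34: "S 0 1 4 - S 0 2 4 - S 2 0 4 - S 2 4 4 - S 3 0 4 = 0"
    by (rule trans[OF _ h3[of 3 4]]) (simp_all add: ev)
  have G40: "S 1 0 1 - S 2 0 0 - S 2 0 3 - S 5 0 0 - S 5 0 2 = 0"
    by (rule trans[OF _ h3[of 4 0]]) (simp_all add: ev)
  have G41: "S 1 1 1 - S 2 0 1 - S 2 1 3 - S 5 0 1 - S 5 1 2 = 0"
    by (rule trans[OF _ h3[of 4 1]]) (simp_all add: ev)
  have G42: "S 1 1 2 - S 2 0 2 - S 2 2 3 - S 5 0 2 - S 5 2 2 = 0"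
    by (rule trans[OF _ h3[of 4 2]]) (simp_all add: ev)
  have G43: "S 1 1 3 - S 2 0 3 - S 2 3 3 - S 5 0 3 - S 5 2 3 = 0"
    by (rule trans[OF _ h3[of 4 3]]) (simp_all add: ev)
  \<comment> \<open>Points 3 and 4 are e_0 + e_3 and e_1 + e_2. Since q(e_p + e_l) = -2 y_p y_l,
    each of them kills one entry of every matrix.\<close>
  have [simp]: "S 0 0 3 = 0" "S 0 1 2 = 0" "S 1 0 3 = 0" "S 1 1 2 = 0" "S 2 0 3 = 0" "S 2 1 2 = 0"
    "S 3 0 3 = 0" "S 3 1 2 = 0" "S 4 0 3 = 0" "S 4 1 2 = 0" "S 5 0 3 = 0" "S 5 1 2 = 0"
    using Q3[of 0] Q4[of 0] Q3[of 1] Q4[of 1] Q3[of 2] Q4[of 2] Q3[of 3] Q4[of 3] Q3[of 4] Q4[of 4]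
      Q3[of 5] Q4[of 5]
    by simp_all
  \<comment> \<open>For a point e_p + e_l the entry S_pl is already 0, so its T-equations kill the
    diagonal entries p and l of its own matrix.\<close>
  have [simp]: "S 3 0 0 = 0" "S 3 3 3 = 0" "S 4 1 1 = 0" "S 4 2 2 = 0"
    using T30 T33 T41 T42
    by simp_all
  have [simp]: "S 4 1 4 = 0"
    using Q1[of 4]
    by simp_all
  \<comment> \<open>\<open>trans\<close> leaves the goal that the two-term expression equals the
    left side of \<open>T14\<close> once the known entries are substituted. All later eliminations
    follow this pattern.\<close>
  have [simp]: "S 1 4 4 = 2 * S 1 1 4"
    by (rule solve_two_terms[of "-1" _ "2", OF trans[OF _ T14]])
      (simp_all add: algebra_simps)
  have [simp]: "S 0 2 2 = -2 * S 0 2 3"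
    by (rule solve_two_terms[of "-1" _ "-2", OF trans[OF _ T02]])
      (simp_all add: algebra_simps)
  \<comment> \<open>The factor 1 keeps the shape c * y of the conclusion of
    \<open>solve_two_terms\<close>.\<close>
  have [simp]: "S 1 2 4 = 1 * S 0 2 3"
    by (rule solve_two_terms[of "1" _ "-1", OF trans[OF _ G12]])
      (simp_all add: algebra_simps)
  have [simp]: "S 2 0 0 = -2 * S 2 0 4"
    by (rule solve_two_terms[of "-1" _ "-2", OF trans[OF _ T20]])
      (simp_all add: algebra_simps)
  have [simp]: "S 2 3 3 = -2 * S 2 3 4"
    by (rule solve_two_terms[of "-1" _ "-2", OF trans[OF _ T23]])
      (simp_all add: algebra_simps)
  have [simp]: "S 4 4 4 = 2 * S 4 2 4"
    by (rule solve_two_terms[of "1" _ "-2", OF trans[OF _ T44]])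
      (simp_all add: algebra_simps)
  have [simp]: "S 1 2 2 = 2 * S 0 2 3"
    by (rule solve_two_terms[of "1" _ "-2", OF trans[OF _ T12]])
      (simp_all add: algebra_simps)
  have [simp]: "S 0 1 4 = 1 * S 0 1 1"
    by (rule solve_two_terms[of "2" _ "-2", OF trans[OF _ Q1[of 0]]])
      (simp_all add: algebra_simps)
  have [simp]: "S 1 1 4 = 1 * S 1 1 1"
    by (rule solve_two_terms[of "2" _ "-2", OF trans[OF _ Q1[of 1]]])
      (simp_all add: algebra_simps)
  have [simp]: "S 1 1 1 = 0"
    using T11
    by simp_all
  have [simp]: "S 0 1 3 = 2 * S 0 1 1"
    by (rule solve_two_terms[of "1" _ "-2", OF trans[OF _ G11]])
      (simp_all add: algebra_simps)
  have [simp]: "S 0 1 1 = 0"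
    using T01
    by simp_all
  have [simp]: "S 0 2 3 = 0"
    using Q0[of 0]
    by simp_all
  have [simp]: "S 0 3 3 = 0" "S 2 3 4 = 0"
    using T03 G33
    by simp_all
  have [simp]: "S 2 0 4 = 0"
    using Q2[of 2]
    by simp_all
  have [simp]: "S 2 4 4 = 0"
    using T24
    by simp_all
  have [simp]: "S 5 0 2 = -1 * S 5 0 4"
    by (rule solve_two_terms[of "-1" _ "-1", OF trans[OF _ G00]])
      (simp_all add: algebra_simps)
  have [simp]: "S 5 0 0 = 0" "S 5 2 4 = 0"
    using T50 Q5[of 5]
    by simp_all
  have [simp]: "S 5 0 4 = 0"
    using G22
    by simp_all
  have [simp]: "S 5 4 4 = 0" "S 5 2 2 = 0" "S 1 0 1 = 0" "S 5 3 4 = 0"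
    using T54 T52 G40 Q2[of 5]
    by simp_all
  have [simp]: "S 3 3 4 = 0" "S 0 3 4 = 0" "S 5 2 3 = 0" "S 4 1 3 = 0"
    using G04 G24 G03 G23
    by simp_all
  have [simp]: "S 0 0 4 = 0" "S 3 0 4 = 0" "S 5 3 3 = 0" "S 1 1 3 = 0" "S 4 2 3 = 0"
    using Q2[of 0] Q2[of 3] T53 G43 Q0[of 4]
    by simp_all
  have [simp]: "S 3 4 4 = 0" "S 0 2 4 = 0" "S 1 2 3 = 0" "S 4 3 3 = 0" "S 1 3 4 = 0"
    using T34 G34 Q0[of 1] T43 G13
    by simp_all
  have [simp]: "S 0 4 4 = 0" "S 4 2 4 = 0" "S 0 0 2 = 0" "S 1 3 3 = 0" "S 1 0 4 = 0"
    using T04 G14 Q5[of 0] T13 Q2[of 1]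
    by simp_all
  have [simp]: "S 0 0 1 = 0" "S 1 0 0 = 0" "S 1 0 2 = 0"
    using G30 T10 Q5[of 1]
    by simp_all
  have [simp]: "S 0 0 0 = 0" "S 4 0 1 = 0" "S 4 0 2 = 0"
    using T00 G20 G10
    by simp_all
  have [simp]: "S 4 0 0 = 0" "S 4 0 4 = 0"
    using T40 Q5[of 4]
    by simp_all
  have [simp]: "S 4 3 4 = 0"
    using Q2[of 4]
    by simp_all
  have [simp]: "S 5 0 1 = -1 * S 5 1 4"
    by (rule solve_two_terms[of "-1" _ "-1", OF trans[OF _ G21]])
      (simp_all add: algebra_simps)
  have [simp]: "S 5 1 1 = 0"
    using T51
    by simp_all
  have [simp]: "S 5 1 4 = 0" "S 5 1 3 = 0"
    using Q1[of 5] Q0[of 5]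
    by simp_all
  have [simp]: "S 2 0 1 = -1 * S 2 1 3"
    by (rule solve_two_terms[of "-1" _ "-1", OF trans[OF _ G41]])
      (simp_all add: algebra_simps)
  have [simp]: "S 2 0 2 = -1 * S 2 2 3"
    by (rule solve_two_terms[of "-1" _ "-1", OF trans[OF _ G42]])
      (simp_all add: algebra_simps)
  have [simp]: "S 2 1 1 = 2 * S 2 1 4"
    by (rule solve_two_terms[of "1" _ "-2", OF trans[OF _ T21]])
      (simp_all add: algebra_simps)
  have [simp]: "S 2 1 4 = 0"
    using Q1[of 2]
    by simp_all
  have [simp]: "S 2 1 3 = -1 * S 3 1 3"
    by (rule solve_two_terms[of "-1" _ "-1", OF trans[OF _ G01]])
      (simp_all add: algebra_simps)
  have [simp]: "S 3 0 1 = -1 * S 3 1 3"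
    by (rule solve_two_terms[of "-1" _ "-1", OF trans[OF _ G31]])
      (simp_all add: algebra_simps)
  have [simp]: "S 3 1 1 = 0"
    using T31
    by simp_all
  have [simp]: "S 3 1 4 = 0"
    using Q1[of 3]
    by simp_all
  have [simp]: "S 2 2 2 = 2 * S 2 2 4"
    by (rule solve_two_terms[of "1" _ "-2", OF trans[OF _ T22]])
      (simp_all add: algebra_simps)
  have [simp]: "S 3 2 4 = -1 * S 3 0 2"
    by (rule solve_two_terms[of "-2" _ "-2", OF trans[OF _ Q5[of 3]]])
      (simp_all add: algebra_simps)
  have [simp]: "S 2 2 4 = 1 * S 2 2 3"
    by (rule solve_two_terms[of "-2" _ "2", OF trans[OF _ Q5[of 2]]])
      (simp_all add: algebra_simps)
  have [simp]: "S 3 0 2 = 0"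
    using G32
    by simp_all
  have [simp]: "S 3 2 2 = 2 * S 3 2 3"
    by (rule solve_two_terms[of "1" _ "-2", OF trans[OF _ T32]])
      (simp_all add: algebra_simps)
  have [simp]: "S 3 2 3 = -2 * S 2 2 3"
    by (rule solve_two_terms[of "-1" _ "-2", OF trans[OF _ G02]])
      (simp_all add: algebra_simps)
  have [simp]: "S 3 1 3 = -2 * S 2 2 3"
    by (rule solve_two_terms[of "2" _ "4", OF trans[OF _ Q0[of 3]]])
      (simp_all add: algebra_simps)
  \<comment> \<open>All entries still open are by now multiples of \<open>S 2 2 3\<close>; in
    particular \<open>S 2 1 3\<close> is twice it, and Q0 becomes 2 * S 2 2 3 = 0.\<close>
  have [simp]: "S 2 2 3 = 0"
    using Q0[of 2]
    by simp_all
  show "\<forall>i<6. \<forall>p<5. \<forall>l<5. S i p l = 0"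
    by (simp add: all_less_5 all_less_6 symmetric_entries[of S, OF sym])
qed

section \<open>The case r = 7\<close>

definition base_points_7 :: "nat \<Rightarrow> nat \<Rightarrow> 'a::comm_ring_1" where
  "base_points_7 i p =
    ([[0, 0, 1, 0, 1],
     [1, 0, 0, 1, 0],
     [1, 1, -1, 0, 0],
     [0, 1, 0, -1, 0],
     [-1, 0, 0, 0, 1],
     [-1, 0, 1, 1, 1],
     [0, 1, 0, 0, 1]] ! i) ! p"

text \<open>The surplus is 3. Points 0, 1 and 6 are sums of two unit vectors and kill one entry of
  every matrix each. Points 3 and 4 are differences of two unit vectors: q then has one square and
  one mixed term, and identifies an off-diagonal entry with a diagonal one.\<close>

lemma rigid_base_points_7: "rigid 7 (base_points_7 :: nat \<Rightarrow> nat \<Rightarrow> 'a::field_char_0)"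
proof (rule rigidI)
  let ?a = "base_points_7 :: nat \<Rightarrow> nat \<Rightarrow> 'a"
  have A: "?a 0 0 = 0" "?a 0 1 = 0" "?a 0 2 = 1" "?a 0 3 = 0" "?a 0 4 = 1"
    "?a 1 0 = 1" "?a 1 1 = 0" "?a 1 2 = 0" "?a 1 3 = 1" "?a 1 4 = 0"
    "?a 2 0 = 1" "?a 2 1 = 1" "?a 2 2 = -1" "?a 2 3 = 0" "?a 2 4 = 0"
    "?a 3 0 = 0" "?a 3 1 = 1" "?a 3 2 = 0" "?a 3 3 = -1" "?a 3 4 = 0"
    "?a 4 0 = -1" "?a 4 1 = 0" "?a 4 2 = 0" "?a 4 3 = 0" "?a 4 4 = 1"
    "?a 5 0 = -1" "?a 5 1 = 0" "?a 5 2 = 1" "?a 5 3 = 1" "?a 5 4 = 1"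
    "?a 6 0 = 0" "?a 6 1 = 1" "?a 6 2 = 0" "?a 6 3 = 0" "?a 6 4 = 1"
    by (simp_all add: base_points_7_def)
  fix S :: "nat \<Rightarrow> nat \<Rightarrow> nat \<Rightarrow> 'a"
  assume sym: "\<And>i p l. S i p l = S i l p"
  note [simp del] = One_nat_def
  assume h1: "\<And>i j. i < 7 \<Longrightarrow> j < 7 \<Longrightarrow> (\<Sum>p<5. \<Sum>l<5. q_mat (?a j) p l * S i p l) = 0"
    and h2: "\<And>i p. i < 7 \<Longrightarrow> p < 5 \<Longrightarrow> S i p p - 2 * (\<Sum>l<5. ?a i l * S i p l) = 0"
    and h3: "\<And>k p. k < 5 \<Longrightarrow> p < 5 \<Longrightarrow> (\<Sum>i<7. \<Sum>l<5. q_mat (?a i) k l * S i l p) = 0"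
  note ev = sum_5 sum_7 q_mat_def A symmetric_entries[of S, OF sym] algebra_simps
  have Q0: "- 2 * S i 2 4 = 0" if "i < 7" for i
    by (rule trans[OF _ h1[OF that, of 0]]) (simp_all add: ev)
  have Q1: "- 2 * S i 0 3 = 0" if "i < 7" for i
    by (rule trans[OF _ h1[OF that, of 1]]) (simp_all add: ev)
  have Q2: "- 2 * S i 0 1 + 2 * S i 0 2 + 2 * S i 1 2 - 2 * S i 2 2 = 0" if "i < 7" for i
    by (rule trans[OF _ h1[OF that, of 2]]) (simp_all add: ev)
  have Q3: "2 * S i 1 3 - 2 * S i 3 3 = 0" if "i < 7" for i
    by (rule trans[OF _ h1[OF that, of 3]]) (simp_all add: ev)
  have Q4: "- 2 * S i 0 0 + 2 * S i 0 4 = 0" if "i < 7" for i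
    by (rule trans[OF _ h1[OF that, of 4]]) (simp_all add: ev)
  have Q5: "- 2 * S i 0 0 + 2 * S i 0 2 + 2 * S i 0 3 + 2 * S i 0 4 - 2 * S i 2 3 - 2 * S i 2 4 - 2 * S i 3 4 = 0" if "i < 7" for i
    by (rule trans[OF _ h1[OF that, of 5]]) (simp_all add: ev)
  have Q6: "- 2 * S i 1 4 = 0" if "i < 7" for i
    by (rule trans[OF _ h1[OF that, of 6]]) (simp_all add: ev)
  have T00: "S 0 0 0 - 2 * S 0 0 2 - 2 * S 0 0 4 = 0"
    by (rule trans[OF _ h2[of 0 0]]) (simp_all add: ev)
  have T01: "S 0 1 1 - 2 * S 0 1 2 - 2 * S 0 1 4 = 0"
    by (rule trans[OF _ h2[of 0 1]]) (simp_all add: ev)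
  have T02: "- S 0 2 2 - 2 * S 0 2 4 = 0"
    by (rule trans[OF _ h2[of 0 2]]) (simp_all add: ev)
  have T03: "- 2 * S 0 2 3 + S 0 3 3 - 2 * S 0 3 4 = 0"
    by (rule trans[OF _ h2[of 0 3]]) (simp_all add: ev)
  have T04: "- 2 * S 0 2 4 - S 0 4 4 = 0"
    by (rule trans[OF _ h2[of 0 4]]) (simp_all add: ev)
  have T10: "- S 1 0 0 - 2 * S 1 0 3 = 0"
    by (rule trans[OF _ h2[of 1 0]]) (simp_all add: ev)
  have T11: "- 2 * S 1 0 1 + S 1 1 1 - 2 * S 1 1 3 = 0"
    by (rule trans[OF _ h2[of 1 1]]) (simp_all add: ev)
  have T12: "- 2 * S 1 0 2 + S 1 2 2 - 2 * S 1 2 3 = 0"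
    by (rule trans[OF _ h2[of 1 2]]) (simp_all add: ev)
  have T13: "- 2 * S 1 0 3 - S 1 3 3 = 0"
    by (rule trans[OF _ h2[of 1 3]]) (simp_all add: ev)
  have T14: "- 2 * S 1 0 4 - 2 * S 1 3 4 + S 1 4 4 = 0"
    by (rule trans[OF _ h2[of 1 4]]) (simp_all add: ev)
  have T21: "- 2 * S 2 0 1 - S 2 1 1 + 2 * S 2 1 2 = 0"
    by (rule trans[OF _ h2[of 2 1]]) (simp_all add: ev)
  have T22: "- 2 * S 2 0 2 - 2 * S 2 1 2 + 3 * S 2 2 2 = 0"
    by (rule trans[OF _ h2[of 2 2]]) (simp_all add: ev)
  have T23: "- 2 * S 2 0 3 - 2 * S 2 1 3 + 2 * S 2 2 3 + S 2 3 3 = 0"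
    by (rule trans[OF _ h2[of 2 3]]) (simp_all add: ev)
  have T24: "- 2 * S 2 0 4 - 2 * S 2 1 4 + 2 * S 2 2 4 + S 2 4 4 = 0"
    by (rule trans[OF _ h2[of 2 4]]) (simp_all add: ev)
  have T30: "S 3 0 0 - 2 * S 3 0 1 + 2 * S 3 0 3 = 0"
    by (rule trans[OF _ h2[of 3 0]]) (simp_all add: ev)
  have T31: "- S 3 1 1 + 2 * S 3 1 3 = 0"
    by (rule trans[OF _ h2[of 3 1]]) (simp_all add: ev)
  have T32: "- 2 * S 3 1 2 + S 3 2 2 + 2 * S 3 2 3 = 0"
    by (rule trans[OF _ h2[of 3 2]]) (simp_all add: ev)
  have T33: "- 2 * S 3 1 3 + 3 * S 3 3 3 = 0"
    by (rule trans[OF _ h2[of 3 3]]) (simp_all add: ev)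
  have T34: "- 2 * S 3 1 4 + 2 * S 3 3 4 + S 3 4 4 = 0"
    by (rule trans[OF _ h2[of 3 4]]) (simp_all add: ev)
  have T40: "3 * S 4 0 0 - 2 * S 4 0 4 = 0"
    by (rule trans[OF _ h2[of 4 0]]) (simp_all add: ev)
  have T41: "2 * S 4 0 1 + S 4 1 1 - 2 * S 4 1 4 = 0"
    by (rule trans[OF _ h2[of 4 1]]) (simp_all add: ev)
  have T42: "2 * S 4 0 2 + S 4 2 2 - 2 * S 4 2 4 = 0"
    by (rule trans[OF _ h2[of 4 2]]) (simp_all add: ev)
  have T43: "2 * S 4 0 3 + S 4 3 3 - 2 * S 4 3 4 = 0"
    by (rule trans[OF _ h2[of 4 3]]) (simp_all add: ev)
  have T44: "2 * S 4 0 4 - S 4 4 4 = 0"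
    by (rule trans[OF _ h2[of 4 4]]) (simp_all add: ev)
  have T50: "3 * S 5 0 0 - 2 * S 5 0 2 - 2 * S 5 0 3 - 2 * S 5 0 4 = 0"
    by (rule trans[OF _ h2[of 5 0]]) (simp_all add: ev)
  have T51: "2 * S 5 0 1 + S 5 1 1 - 2 * S 5 1 2 - 2 * S 5 1 3 - 2 * S 5 1 4 = 0"
    by (rule trans[OF _ h2[of 5 1]]) (simp_all add: ev)
  have T52: "2 * S 5 0 2 - S 5 2 2 - 2 * S 5 2 3 - 2 * S 5 2 4 = 0"
    by (rule trans[OF _ h2[of 5 2]]) (simp_all add: ev)
  have T53: "2 * S 5 0 3 - 2 * S 5 2 3 - S 5 3 3 - 2 * S 5 3 4 = 0"
    by (rule trans[OF _ h2[of 5 3]]) (simp_all add: ev)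
  have T54: "2 * S 5 0 4 - 2 * S 5 2 4 - 2 * S 5 3 4 - S 5 4 4 = 0"
    by (rule trans[OF _ h2[of 5 4]]) (simp_all add: ev)
  have T60: "S 6 0 0 - 2 * S 6 0 1 - 2 * S 6 0 4 = 0"
    by (rule trans[OF _ h2[of 6 0]]) (simp_all add: ev)
  have T61: "- S 6 1 1 - 2 * S 6 1 4 = 0"
    by (rule trans[OF _ h2[of 6 1]]) (simp_all add: ev)
  have T62: "- 2 * S 6 1 2 + S 6 2 2 - 2 * S 6 2 4 = 0"
    by (rule trans[OF _ h2[of 6 2]]) (simp_all add: ev)
  have T63: "- 2 * S 6 1 3 + S 6 3 3 - 2 * S 6 3 4 = 0"
    by (rule trans[OF _ h2[of 6 3]]) (simp_all add: ev)
  have T64: "- 2 * S 6 1 4 - S 6 4 4 = 0"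
    by (rule trans[OF _ h2[of 6 4]]) (simp_all add: ev)
  have G00: "- S 1 0 3 - S 2 0 1 + S 2 0 2 - 2 * S 4 0 0 + S 4 0 4 - 2 * S 5 0 0 + S 5 0 2 + S 5 0 3 + S 5 0 4 = 0"
    by (rule trans[OF _ h3[of 0 0]]) (simp_all add: ev)
  have G01: "- S 1 1 3 - S 2 1 1 + S 2 1 2 - 2 * S 4 0 1 + S 4 1 4 - 2 * S 5 0 1 + S 5 1 2 + S 5 1 3 + S 5 1 4 = 0"
    by (rule trans[OF _ h3[of 0 1]]) (simp_all add: ev)
  have G02: "- S 1 2 3 - S 2 1 2 + S 2 2 2 - 2 * S 4 0 2 + S 4 2 4 - 2 * S 5 0 2 + S 5 2 2 + S 5 2 3 + S 5 2 4 = 0"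
    by (rule trans[OF _ h3[of 0 2]]) (simp_all add: ev)
  have G03: "- S 1 3 3 - S 2 1 3 + S 2 2 3 - 2 * S 4 0 3 + S 4 3 4 - 2 * S 5 0 3 + S 5 2 3 + S 5 3 3 + S 5 3 4 = 0"
    by (rule trans[OF _ h3[of 0 3]]) (simp_all add: ev)
  have G04: "- S 1 3 4 - S 2 1 4 + S 2 2 4 - 2 * S 4 0 4 + S 4 4 4 - 2 * S 5 0 4 + S 5 2 4 + S 5 3 4 + S 5 4 4 = 0"
    by (rule trans[OF _ h3[of 0 4]]) (simp_all add: ev)
  have G10: "- S 2 0 0 + S 2 0 2 + S 3 0 3 - S 6 0 4 = 0"
    by (rule trans[OF _ h3[of 1 0]]) (simp_all add: ev)
  have G11: "- S 2 0 1 + S 2 1 2 + S 3 1 3 - S 6 1 4 = 0"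
    by (rule trans[OF _ h3[of 1 1]]) (simp_all add: ev)
  have G12: "- S 2 0 2 + S 2 2 2 + S 3 2 3 - S 6 2 4 = 0"
    by (rule trans[OF _ h3[of 1 2]]) (simp_all add: ev)
  have G13: "- S 2 0 3 + S 2 2 3 + S 3 3 3 - S 6 3 4 = 0"
    by (rule trans[OF _ h3[of 1 3]]) (simp_all add: ev)
  have G14: "- S 2 0 4 + S 2 2 4 + S 3 3 4 - S 6 4 4 = 0"
    by (rule trans[OF _ h3[of 1 4]]) (simp_all add: ev)
  have G20: "- S 0 0 4 + S 2 0 0 + S 2 0 1 - 2 * S 2 0 2 + S 5 0 0 - S 5 0 3 - S 5 0 4 = 0"
    by (rule trans[OF _ h3[of 2 0]]) (simp_all add: ev)
  have G21: "- S 0 1 4 + S 2 0 1 + S 2 1 1 - 2 * S 2 1 2 + S 5 0 1 - S 5 1 3 - S 5 1 4 = 0"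
    by (rule trans[OF _ h3[of 2 1]]) (simp_all add: ev)
  have G23: "- S 0 3 4 + S 2 0 3 + S 2 1 3 - 2 * S 2 2 3 + S 5 0 3 - S 5 3 3 - S 5 3 4 = 0"
    by (rule trans[OF _ h3[of 2 3]]) (simp_all add: ev)
  have G24: "- S 0 4 4 + S 2 0 4 + S 2 1 4 - 2 * S 2 2 4 + S 5 0 4 - S 5 3 4 - S 5 4 4 = 0"
    by (rule trans[OF _ h3[of 2 4]]) (simp_all add: ev)
  have G30: "- S 1 0 0 + S 3 0 1 - 2 * S 3 0 3 + S 5 0 0 - S 5 0 2 - S 5 0 4 = 0"
    by (rule trans[OF _ h3[of 3 0]]) (simp_all add: ev)
  have G31: "- S 1 0 1 + S 3 1 1 - 2 * S 3 1 3 + S 5 0 1 - S 5 1 2 - S 5 1 4 = 0"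
    by (rule trans[OF _ h3[of 3 1]]) (simp_all add: ev)
  have G32: "- S 1 0 2 + S 3 1 2 - 2 * S 3 2 3 + S 5 0 2 - S 5 2 2 - S 5 2 4 = 0"
    by (rule trans[OF _ h3[of 3 2]]) (simp_all add: ev)
  have G33: "- S 1 0 3 + S 3 1 3 - 2 * S 3 3 3 + S 5 0 3 - S 5 2 3 - S 5 3 4 = 0"
    by (rule trans[OF _ h3[of 3 3]]) (simp_all add: ev)
  have G34: "- S 1 0 4 + S 3 1 4 - 2 * S 3 3 4 + S 5 0 4 - S 5 2 4 - S 5 4 4 = 0"
    by (rule trans[OF _ h3[of 3 4]]) (simp_all add: ev)
  have G40: "- S 0 0 2 + S 4 0 0 + S 5 0 0 - S 5 0 2 - S 5 0 3 - S 6 0 1 = 0"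
    by (rule trans[OF _ h3[of 4 0]]) (simp_all add: ev)
  have G41: "- S 0 1 2 + S 4 0 1 + S 5 0 1 - S 5 1 2 - S 5 1 3 - S 6 1 1 = 0"
    by (rule trans[OF _ h3[of 4 1]]) (simp_all add: ev)
  have G42: "- S 0 2 2 + S 4 0 2 + S 5 0 2 - S 5 2 2 - S 5 2 3 - S 6 1 2 = 0"
    by (rule trans[OF _ h3[of 4 2]]) (simp_all add: ev)
  have G43: "- S 0 2 3 + S 4 0 3 + S 5 0 3 - S 5 2 3 - S 5 3 3 - S 6 1 3 = 0"
    by (rule trans[OF _ h3[of 4 3]]) (simp_all add: ev)
  have G44: "- S 0 2 4 + S 4 0 4 + S 5 0 4 - S 5 2 4 - S 5 3 4 - S 6 1 4 = 0"
    by (rule trans[OF _ h3[of 4 4]]) (simp_all add: ev)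
  have [simp]: "S 0 2 4 = 0" "S 0 0 3 = 0" "S 0 1 4 = 0" "S 1 2 4 = 0" "S 1 0 3 = 0" "S 1 1 4 = 0"
    "S 2 2 4 = 0" "S 2 0 3 = 0" "S 2 1 4 = 0" "S 3 2 4 = 0" "S 3 0 3 = 0" "S 3 1 4 = 0"
    "S 4 2 4 = 0" "S 4 0 3 = 0" "S 4 1 4 = 0" "S 5 2 4 = 0" "S 5 0 3 = 0" "S 5 1 4 = 0"
    "S 6 2 4 = 0" "S 6 0 3 = 0" "S 6 1 4 = 0"
    using Q0[of 0] Q1[of 0] Q6[of 0] Q0[of 1] Q1[of 1] Q6[of 1] Q0[of 2] Q1[of 2] Q6[of 2] Q0[of 3]
      Q1[of 3] Q6[of 3] Q0[of 4] Q1[of 4] Q6[of 4] Q0[of 5] Q1[of 5] Q6[of 5] Q0[of 6] Q1[of 6]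
      Q6[of 6]
    by simp_all
  have [simp]: "S 0 2 2 = 0" "S 0 4 4 = 0" "S 1 0 0 = 0" "S 1 3 3 = 0" "S 6 1 1 = 0" "S 6 4 4 = 0"
    using T02 T04 T10 T13 T61 T64
    by simp_all
  have [simp]: "S 1 1 3 = 0" "S 1 0 4 = 0"
    using Q3[of 1] Q4[of 1]
    by simp_all
  have [simp]: "S 3 3 4 = 1 * S 2 0 4"
    by (rule solve_two_terms[of "1" _ "-1", OF trans[OF _ G14]])
      (simp_all add: algebra_simps)
  have [simp]: "S 3 1 1 = 2 * S 3 1 3"
    by (rule solve_two_terms[of "-1" _ "2", OF trans[OF _ T31]])
      (simp_all add: algebra_simps)
  have [simp]: "S 4 4 4 = 2 * S 4 0 4"
    by (rule solve_two_terms[of "-1" _ "2", OF trans[OF _ T44]])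
      (simp_all add: algebra_simps)
  have [simp]: "S 0 1 1 = 2 * S 0 1 2"
    by (rule solve_two_terms[of "1" _ "-2", OF trans[OF _ T01]])
      (simp_all add: algebra_simps)
  have [simp]: "S 1 1 1 = 2 * S 1 0 1"
    by (rule solve_two_terms[of "1" _ "-2", OF trans[OF _ T11]])
      (simp_all add: algebra_simps)
  have [simp]: "S 1 4 4 = 2 * S 1 3 4"
    by (rule solve_two_terms[of "1" _ "-2", OF trans[OF _ T14]])
      (simp_all add: algebra_simps)
  have [simp]: "S 3 0 0 = 2 * S 3 0 1"
    by (rule solve_two_terms[of "1" _ "-2", OF trans[OF _ T30]])
      (simp_all add: algebra_simps)
  have [simp]: "S 4 1 1 = -2 * S 4 0 1"
    by (rule solve_two_terms[of "1" _ "2", OF trans[OF _ T41]])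
      (simp_all add: algebra_simps)
  have [simp]: "S 4 2 2 = -2 * S 4 0 2"
    by (rule solve_two_terms[of "1" _ "2", OF trans[OF _ T42]])
      (simp_all add: algebra_simps)
  have [simp]: "S 4 3 3 = 2 * S 4 3 4"
    by (rule solve_two_terms[of "1" _ "-2", OF trans[OF _ T43]])
      (simp_all add: algebra_simps)
  have [simp]: "S 6 2 2 = 2 * S 6 1 2"
    by (rule solve_two_terms[of "1" _ "-2", OF trans[OF _ T62]])
      (simp_all add: algebra_simps)
  have [simp]: "S 2 4 4 = 2 * S 2 0 4"
    by (rule solve_two_terms[of "1" _ "-2", OF trans[OF _ T24]])
      (simp_all add: algebra_simps)
  have [simp]: "S 3 4 4 = -2 * S 2 0 4"
    by (rule solve_two_terms[of "1" _ "2", OF trans[OF _ T34]])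
      (simp_all add: algebra_simps)
  have [simp]: "S 0 1 3 = 1 * S 0 3 3"
    by (rule solve_two_terms[of "2" _ "-2", OF trans[OF _ Q3[of 0]]])
      (simp_all add: algebra_simps)
  have [simp]: "S 0 0 0 = 1 * S 0 0 4"
    by (rule solve_two_terms[of "-2" _ "2", OF trans[OF _ Q4[of 0]]])
      (simp_all add: algebra_simps)
  have [simp]: "S 0 0 4 = -2 * S 0 0 2"
    by (rule solve_two_terms[of "-1" _ "-2", OF trans[OF _ T00]])
      (simp_all add: algebra_simps)
  have [simp]: "S 2 3 3 = 1 * S 2 1 3"
    by (rule solve_two_terms[of "-2" _ "2", OF trans[OF _ Q3[of 2]]])
      (simp_all add: algebra_simps)
  have [simp]: "S 2 1 3 = 2 * S 2 2 3"
    by (rule solve_two_terms[of "-1" _ "2", OF trans[OF _ T23]])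
      (simp_all add: algebra_simps)
  have [simp]: "S 2 0 0 = 1 * S 2 0 4"
    by (rule solve_two_terms[of "-2" _ "2", OF trans[OF _ Q4[of 2]]])
      (simp_all add: algebra_simps)
  have [simp]: "S 3 1 3 = 1 * S 3 3 3"
    by (rule solve_two_terms[of "2" _ "-2", OF trans[OF _ Q3[of 3]]])
      (simp_all add: algebra_simps)
  have [simp]: "S 3 3 3 = 0"
    using T33
    by simp_all
  have [simp]: "S 2 2 3 = 1 * S 6 3 4"
    by (rule solve_two_terms[of "1" _ "-1", OF trans[OF _ G13]])
      (simp_all add: algebra_simps)
  have [simp]: "S 2 0 1 = 1 * S 2 1 2"
    by (rule solve_two_terms[of "-1" _ "1", OF trans[OF _ G11]])
      (simp_all add: algebra_simps)
  have [simp]: "S 2 1 1 = 0"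
    using T21
    by simp_all
  have [simp]: "S 5 2 3 = -1 * S 5 3 4"
    by (rule solve_two_terms[of "-1" _ "-1", OF trans[OF _ G33]])
      (simp_all add: algebra_simps)
  have [simp]: "S 5 3 3 = 0"
    using T53
    by simp_all
  have [simp]: "S 5 1 3 = 0"
    using Q3[of 5]
    by simp_all
  have [simp]: "S 0 3 4 = -1 * S 5 3 4"
    by (rule solve_two_terms[of "-1" _ "-1", OF trans[OF _ G23]])
      (simp_all add: algebra_simps)
  have [simp]: "S 5 0 1 = 1 * S 2 1 2"
    by (rule solve_two_terms[of "1" _ "-1", OF trans[OF _ G21]])
      (simp_all add: algebra_simps)
  have [simp]: "S 4 3 4 = 1 * S 6 3 4"
    by (rule solve_two_terms[of "1" _ "-1", OF trans[OF _ G03]])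
      (simp_all add: algebra_simps)
  have [simp]: "S 4 0 0 = 1 * S 4 0 4"
    by (rule solve_two_terms[of "-2" _ "2", OF trans[OF _ Q4[of 4]]])
      (simp_all add: algebra_simps)
  have [simp]: "S 4 0 4 = 0"
    using T40
    by simp_all
  have [simp]: "S 5 0 4 = 1 * S 5 3 4"
    by (rule solve_two_terms[of "1" _ "-1", OF trans[OF _ G44]])
      (simp_all add: algebra_simps)
  have [simp]: "S 5 4 4 = 0"
    using T54
    by simp_all
  have [simp]: "S 2 0 4 = 0"
    using G24
    by simp_all
  have [simp]: "S 5 3 4 = 0"
    using G34
    by simp_all
  have [simp]: "S 1 3 4 = 0" "S 5 0 0 = 0"
    using G04 Q4[of 5]
    by simp_all
  have [simp]: "S 5 0 2 = 0"
    using T50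
    by simp_all
  have [simp]: "S 5 2 2 = 0" "S 3 0 1 = 0"
    using T52 G30
    by simp_all
  have [simp]: "S 3 0 4 = 0"
    using Q4[of 3]
    by simp_all
  have [simp]: "S 6 0 4 = 1 * S 2 0 2"
    by (rule solve_two_terms[of "-1" _ "1", OF trans[OF _ G10]])
      (simp_all add: algebra_simps)
  have [simp]: "S 6 0 1 = -1 * S 0 0 2"
    by (rule solve_two_terms[of "-1" _ "-1", OF trans[OF _ G40]])
      (simp_all add: algebra_simps)
  have [simp]: "S 6 1 2 = 1 * S 4 0 2"
    by (rule solve_two_terms[of "-1" _ "1", OF trans[OF _ G42]])
      (simp_all add: algebra_simps)
  have [simp]: "S 0 2 3 = -1 * S 6 1 3"
    by (rule solve_two_terms[of "-1" _ "-1", OF trans[OF _ G43]])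
      (simp_all add: algebra_simps)
  have [simp]: "S 2 0 2 = 1 * S 2 1 2"
    by (rule solve_two_terms[of "1" _ "-1", OF trans[OF _ G00]])
      (simp_all add: algebra_simps)
  have [simp]: "S 0 3 3 = -2 * S 6 1 3"
    by (rule solve_two_terms[of "1" _ "2", OF trans[OF _ T03]])
      (simp_all add: algebra_simps)
  have [simp]: "S 2 1 2 = 2 * S 0 0 2"
    by (rule solve_two_terms[of "-1" _ "2", OF trans[OF _ G20]])
      (simp_all add: algebra_simps)
  have [simp]: "S 6 0 0 = 2 * S 0 0 2"
    by (rule solve_two_terms[of "1" _ "-2", OF trans[OF _ T60]])
      (simp_all add: algebra_simps)
  have [simp]: "S 6 3 3 = 1 * S 6 1 3"
    by (rule solve_two_terms[of "-2" _ "2", OF trans[OF _ Q3[of 6]]])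
      (simp_all add: algebra_simps)
  have [simp]: "S 6 1 3 = -2 * S 6 3 4"
    by (rule solve_two_terms[of "-1" _ "-2", OF trans[OF _ T63]])
      (simp_all add: algebra_simps)
  \<comment> \<open>\<open>S 2 0 2\<close> and \<open>S 2 1 2\<close> are both 2 * S 0 0 2 by now,
    so T22 reads 3 x - 8 y = 0. Q2 demands the ratio 2 instead of 8/3, which forces y = 0 in the
    next step.\<close>
  have [simp]: "S 2 2 2 = (8 / 3) * S 0 0 2"
    by (rule solve_two_terms[of "3" _ "-8", OF trans[OF _ T22]])
      (simp_all add: algebra_simps)
  have [simp]: "S 0 0 2 = 0"
    using Q2[of 2]
    by simp_all
  have [simp]: "S 3 2 3 = 0" "S 5 1 2 = 0" "S 6 3 4 = 0"
    using G12 Q2[of 5] Q5[of 0]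
    by simp_all
  have [simp]: "S 5 1 1 = 0" "S 1 0 1 = 0" "S 4 1 3 = 0" "S 2 3 4 = 0" "S 3 0 2 = 0" "S 4 0 1 = 0"
    using T51 G31 Q3[of 4] Q5[of 2] Q5[of 3] G01
    by simp_all
  have [simp]: "S 0 1 2 = 0"
    using G41
    by simp_all
  have [simp]: "S 0 0 1 = 0"
    using Q2[of 0]
    by simp_all
  have [simp]: "S 3 1 2 = 1 * S 1 0 2"
    by (rule solve_two_terms[of "1" _ "-1", OF trans[OF _ G32]])
      (simp_all add: algebra_simps)
  have [simp]: "S 3 2 2 = 2 * S 1 0 2"
    by (rule solve_two_terms[of "1" _ "-2", OF trans[OF _ T32]])
      (simp_all add: algebra_simps)
  \<comment> \<open>With y = \<open>S 1 0 2\<close>, the entries \<open>S 3 1 2\<close> and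
    \<open>S 3 2 2\<close> are y and 2 y, so Q2 reads -2 y = 0.\<close>
  have [simp]: "S 1 0 2 = 0"
    using Q2[of 3]
    by simp_all
  have [simp]: "S 1 2 3 = 0"
    using Q5[of 1]
    by simp_all
  have [simp]: "S 1 2 2 = 0" "S 4 0 2 = 0"
    using T12 G02
    by simp_all
  have [simp]: "S 1 1 2 = 0" "S 4 1 2 = 0" "S 6 0 2 = 0" "S 4 2 3 = 0"
    using Q2[of 1] Q2[of 4] Q2[of 6] Q5[of 4]
    by simp_all
  have [simp]: "S 6 2 3 = 0"
    using Q5[of 6]
    by simp_all
  show "\<forall>i<7. \<forall>p<5. \<forall>l<5. S i p l = 0"
    by (simp add: all_less_5 all_less_7 symmetric_entries[of S, OF sym])
qed

section \<open>The case r = 8\<close>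

definition base_points_8 :: "nat \<Rightarrow> nat \<Rightarrow> 'a::comm_ring_1" where
  "base_points_8 i p =
    ([[-1, 0, 1, 1, 0],
     [0, 1, 0, 0, 1],
     [2, 0, 0, 1, -2],
     [0, 1, 1, 0, 0],
     [1, -1, 1, 1, -1],
     [0, 0, 1, 0, 1],
     [1, 0, 0, 0, -1],
     [0, 1, 0, 1, 0]] ! i) ! p"

text \<open>The surplus is 8. Points 1, 3, 5 and 7 are sums of two unit vectors and kill the entries
  14, 12, 24 and 13 of every matrix, which isolates rows 1 and 4 from most of the rest.\<close>

lemma rigid_base_points_8: "rigid 8 (base_points_8 :: nat \<Rightarrow> nat \<Rightarrow> 'a::field_char_0)"
proof (rule rigidI)
  let ?a = "base_points_8 :: nat \<Rightarrow> nat \<Rightarrow> 'a"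
  have A: "?a 0 0 = -1" "?a 0 1 = 0" "?a 0 2 = 1" "?a 0 3 = 1" "?a 0 4 = 0"
    "?a 1 0 = 0" "?a 1 1 = 1" "?a 1 2 = 0" "?a 1 3 = 0" "?a 1 4 = 1"
    "?a 2 0 = 2" "?a 2 1 = 0" "?a 2 2 = 0" "?a 2 3 = 1" "?a 2 4 = -2"
    "?a 3 0 = 0" "?a 3 1 = 1" "?a 3 2 = 1" "?a 3 3 = 0" "?a 3 4 = 0"
    "?a 4 0 = 1" "?a 4 1 = -1" "?a 4 2 = 1" "?a 4 3 = 1" "?a 4 4 = -1"
    "?a 5 0 = 0" "?a 5 1 = 0" "?a 5 2 = 1" "?a 5 3 = 0" "?a 5 4 = 1"
    "?a 6 0 = 1" "?a 6 1 = 0" "?a 6 2 = 0" "?a 6 3 = 0" "?a 6 4 = -1"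
    "?a 7 0 = 0" "?a 7 1 = 1" "?a 7 2 = 0" "?a 7 3 = 1" "?a 7 4 = 0"
    by (simp_all add: base_points_8_def)
  fix S :: "nat \<Rightarrow> nat \<Rightarrow> nat \<Rightarrow> 'a"
  assume sym: "\<And>i p l. S i p l = S i l p"
  note [simp del] = One_nat_def
  assume h1: "\<And>i j. i < 8 \<Longrightarrow> j < 8 \<Longrightarrow> (\<Sum>p<5. \<Sum>l<5. q_mat (?a j) p l * S i p l) = 0"
    and h2: "\<And>i p. i < 8 \<Longrightarrow> p < 5 \<Longrightarrow> S i p p - 2 * (\<Sum>l<5. ?a i l * S i p l) = 0"
    and h3: "\<And>k p. k < 5 \<Longrightarrow> p < 5 \<Longrightarrow> (\<Sum>i<8. \<Sum>l<5. q_mat (?a i) k l * S i l p) = 0"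
  note ev = sum_5 sum_8 q_mat_def A symmetric_entries[of S, OF sym] algebra_simps
  have Q0: "- 2 * S i 0 0 + 2 * S i 0 2 + 2 * S i 0 3 - 2 * S i 2 3 = 0" if "i < 8" for i
    by (rule trans[OF _ h1[OF that, of 0]]) (simp_all add: ev)
  have Q1: "- 2 * S i 1 4 = 0" if "i < 8" for i
    by (rule trans[OF _ h1[OF that, of 1]]) (simp_all add: ev)
  have Q2: "- 2 * S i 0 0 - 4 * S i 0 3 + 8 * S i 0 4 + 4 * S i 3 4 - 6 * S i 4 4 = 0" if "i < 8" for i
    by (rule trans[OF _ h1[OF that, of 2]]) (simp_all add: ev)
  have Q3: "- 2 * S i 1 2 = 0" if "i < 8" for i
    by (rule trans[OF _ h1[OF that, of 3]]) (simp_all add: ev)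
  have Q4: "2 * S i 0 1 - 2 * S i 0 2 - 2 * S i 0 3 + 2 * S i 0 4 - 2 * S i 1 1 + 2 * S i 1 2 + 2 * S i 1 3 - 2 * S i 1 4 - 2 * S i 2 3 + 2 * S i 2 4 + 2 * S i 3 4 - 2 * S i 4 4 = 0" if "i < 8" for i
    by (rule trans[OF _ h1[OF that, of 4]]) (simp_all add: ev)
  have Q5: "- 2 * S i 2 4 = 0" if "i < 8" for i
    by (rule trans[OF _ h1[OF that, of 5]]) (simp_all add: ev)
  have Q6: "2 * S i 0 4 - 2 * S i 4 4 = 0" if "i < 8" for i
    by (rule trans[OF _ h1[OF that, of 6]]) (simp_all add: ev)
  have Q7: "- 2 * S i 1 3 = 0" if "i < 8" for i
    by (rule trans[OF _ h1[OF that, of 7]]) (simp_all add: ev)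
  have T00: "3 * S 0 0 0 - 2 * S 0 0 2 - 2 * S 0 0 3 = 0"
    by (rule trans[OF _ h2[of 0 0]]) (simp_all add: ev)
  have T01: "2 * S 0 0 1 + S 0 1 1 - 2 * S 0 1 2 - 2 * S 0 1 3 = 0"
    by (rule trans[OF _ h2[of 0 1]]) (simp_all add: ev)
  have T02: "2 * S 0 0 2 - S 0 2 2 - 2 * S 0 2 3 = 0"
    by (rule trans[OF _ h2[of 0 2]]) (simp_all add: ev)
  have T03: "2 * S 0 0 3 - 2 * S 0 2 3 - S 0 3 3 = 0"
    by (rule trans[OF _ h2[of 0 3]]) (simp_all add: ev)
  have T04: "2 * S 0 0 4 - 2 * S 0 2 4 - 2 * S 0 3 4 + S 0 4 4 = 0"
    by (rule trans[OF _ h2[of 0 4]]) (simp_all add: ev)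
  have T10: "S 1 0 0 - 2 * S 1 0 1 - 2 * S 1 0 4 = 0"
    by (rule trans[OF _ h2[of 1 0]]) (simp_all add: ev)
  have T11: "- S 1 1 1 - 2 * S 1 1 4 = 0"
    by (rule trans[OF _ h2[of 1 1]]) (simp_all add: ev)
  have T12: "- 2 * S 1 1 2 + S 1 2 2 - 2 * S 1 2 4 = 0"
    by (rule trans[OF _ h2[of 1 2]]) (simp_all add: ev)
  have T13: "- 2 * S 1 1 3 + S 1 3 3 - 2 * S 1 3 4 = 0"
    by (rule trans[OF _ h2[of 1 3]]) (simp_all add: ev)
  have T14: "- 2 * S 1 1 4 - S 1 4 4 = 0"
    by (rule trans[OF _ h2[of 1 4]]) (simp_all add: ev)
  have T20: "- 3 * S 2 0 0 - 2 * S 2 0 3 + 4 * S 2 0 4 = 0"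
    by (rule trans[OF _ h2[of 2 0]]) (simp_all add: ev)
  have T21: "- 4 * S 2 0 1 + S 2 1 1 - 2 * S 2 1 3 + 4 * S 2 1 4 = 0"
    by (rule trans[OF _ h2[of 2 1]]) (simp_all add: ev)
  have T22: "- 4 * S 2 0 2 + S 2 2 2 - 2 * S 2 2 3 + 4 * S 2 2 4 = 0"
    by (rule trans[OF _ h2[of 2 2]]) (simp_all add: ev)
  have T23: "- 4 * S 2 0 3 - S 2 3 3 + 4 * S 2 3 4 = 0"
    by (rule trans[OF _ h2[of 2 3]]) (simp_all add: ev)
  have T24: "- 4 * S 2 0 4 - 2 * S 2 3 4 + 5 * S 2 4 4 = 0"
    by (rule trans[OF _ h2[of 2 4]]) (simp_all add: ev)
  have T30: "S 3 0 0 - 2 * S 3 0 1 - 2 * S 3 0 2 = 0"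
    by (rule trans[OF _ h2[of 3 0]]) (simp_all add: ev)
  have T31: "- S 3 1 1 - 2 * S 3 1 2 = 0"
    by (rule trans[OF _ h2[of 3 1]]) (simp_all add: ev)
  have T32: "- 2 * S 3 1 2 - S 3 2 2 = 0"
    by (rule trans[OF _ h2[of 3 2]]) (simp_all add: ev)
  have T33: "- 2 * S 3 1 3 - 2 * S 3 2 3 + S 3 3 3 = 0"
    by (rule trans[OF _ h2[of 3 3]]) (simp_all add: ev)
  have T34: "- 2 * S 3 1 4 - 2 * S 3 2 4 + S 3 4 4 = 0"
    by (rule trans[OF _ h2[of 3 4]]) (simp_all add: ev)
  have T40: "- S 4 0 0 + 2 * S 4 0 1 - 2 * S 4 0 2 - 2 * S 4 0 3 + 2 * S 4 0 4 = 0"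
    by (rule trans[OF _ h2[of 4 0]]) (simp_all add: ev)
  have T41: "- 2 * S 4 0 1 + 3 * S 4 1 1 - 2 * S 4 1 2 - 2 * S 4 1 3 + 2 * S 4 1 4 = 0"
    by (rule trans[OF _ h2[of 4 1]]) (simp_all add: ev)
  have T42: "- 2 * S 4 0 2 + 2 * S 4 1 2 - S 4 2 2 - 2 * S 4 2 3 + 2 * S 4 2 4 = 0"
    by (rule trans[OF _ h2[of 4 2]]) (simp_all add: ev)
  have T43: "- 2 * S 4 0 3 + 2 * S 4 1 3 - 2 * S 4 2 3 - S 4 3 3 + 2 * S 4 3 4 = 0"
    by (rule trans[OF _ h2[of 4 3]]) (simp_all add: ev)
  have T44: "- 2 * S 4 0 4 + 2 * S 4 1 4 - 2 * S 4 2 4 - 2 * S 4 3 4 + 3 * S 4 4 4 = 0"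
    by (rule trans[OF _ h2[of 4 4]]) (simp_all add: ev)
  have T50: "S 5 0 0 - 2 * S 5 0 2 - 2 * S 5 0 4 = 0"
    by (rule trans[OF _ h2[of 5 0]]) (simp_all add: ev)
  have T51: "S 5 1 1 - 2 * S 5 1 2 - 2 * S 5 1 4 = 0"
    by (rule trans[OF _ h2[of 5 1]]) (simp_all add: ev)
  have T52: "- S 5 2 2 - 2 * S 5 2 4 = 0"
    by (rule trans[OF _ h2[of 5 2]]) (simp_all add: ev)
  have T53: "- 2 * S 5 2 3 + S 5 3 3 - 2 * S 5 3 4 = 0"
    by (rule trans[OF _ h2[of 5 3]]) (simp_all add: ev)
  have T54: "- 2 * S 5 2 4 - S 5 4 4 = 0"
    by (rule trans[OF _ h2[of 5 4]]) (simp_all add: ev)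
  have T60: "- S 6 0 0 + 2 * S 6 0 4 = 0"
    by (rule trans[OF _ h2[of 6 0]]) (simp_all add: ev)
  have T61: "- 2 * S 6 0 1 + S 6 1 1 + 2 * S 6 1 4 = 0"
    by (rule trans[OF _ h2[of 6 1]]) (simp_all add: ev)
  have T62: "- 2 * S 6 0 2 + S 6 2 2 + 2 * S 6 2 4 = 0"
    by (rule trans[OF _ h2[of 6 2]]) (simp_all add: ev)
  have T63: "- 2 * S 6 0 3 + S 6 3 3 + 2 * S 6 3 4 = 0"
    by (rule trans[OF _ h2[of 6 3]]) (simp_all add: ev)
  have T64: "- 2 * S 6 0 4 + 3 * S 6 4 4 = 0"
    by (rule trans[OF _ h2[of 6 4]]) (simp_all add: ev)
  have T70: "S 7 0 0 - 2 * S 7 0 1 - 2 * S 7 0 3 = 0"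
    by (rule trans[OF _ h2[of 7 0]]) (simp_all add: ev)
  have T71: "- S 7 1 1 - 2 * S 7 1 3 = 0"
    by (rule trans[OF _ h2[of 7 1]]) (simp_all add: ev)
  have T72: "- 2 * S 7 1 2 + S 7 2 2 - 2 * S 7 2 3 = 0"
    by (rule trans[OF _ h2[of 7 2]]) (simp_all add: ev)
  have T73: "- 2 * S 7 1 3 - S 7 3 3 = 0"
    by (rule trans[OF _ h2[of 7 3]]) (simp_all add: ev)
  have T74: "- 2 * S 7 1 4 - 2 * S 7 3 4 + S 7 4 4 = 0"
    by (rule trans[OF _ h2[of 7 4]]) (simp_all add: ev)
  have G03: "- 2 * S 0 0 3 + S 0 2 3 + S 0 3 3 - 2 * S 2 0 3 - 2 * S 2 3 3 + 4 * S 2 3 4 + S 4 1 3 - S 4 2 3 - S 4 3 3 + S 4 3 4 + S 6 3 4 = 0"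
    by (rule trans[OF _ h3[of 0 3]]) (simp_all add: ev)
  have G04: "- 2 * S 0 0 4 + S 0 2 4 + S 0 3 4 - 2 * S 2 0 4 - 2 * S 2 3 4 + 4 * S 2 4 4 + S 4 1 4 - S 4 2 4 - S 4 3 4 + S 4 4 4 + S 6 4 4 = 0"
    by (rule trans[OF _ h3[of 0 4]]) (simp_all add: ev)
  have G10: "- S 1 0 4 - S 3 0 2 + S 4 0 0 - 2 * S 4 0 1 + S 4 0 2 + S 4 0 3 - S 4 0 4 - S 7 0 3 = 0"
    by (rule trans[OF _ h3[of 1 0]]) (simp_all add: ev)
  have G11: "- S 1 1 4 - S 3 1 2 + S 4 0 1 - 2 * S 4 1 1 + S 4 1 2 + S 4 1 3 - S 4 1 4 - S 7 1 3 = 0"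
    by (rule trans[OF _ h3[of 1 1]]) (simp_all add: ev)
  have G12: "- S 1 2 4 - S 3 2 2 + S 4 0 2 - 2 * S 4 1 2 + S 4 2 2 + S 4 2 3 - S 4 2 4 - S 7 2 3 = 0"
    by (rule trans[OF _ h3[of 1 2]]) (simp_all add: ev)
  have G13: "- S 1 3 4 - S 3 2 3 + S 4 0 3 - 2 * S 4 1 3 + S 4 2 3 + S 4 3 3 - S 4 3 4 - S 7 3 3 = 0"
    by (rule trans[OF _ h3[of 1 3]]) (simp_all add: ev)
  have G14: "- S 1 4 4 - S 3 2 4 + S 4 0 4 - 2 * S 4 1 4 + S 4 2 4 + S 4 3 4 - S 4 4 4 - S 7 3 4 = 0"
    by (rule trans[OF _ h3[of 1 4]]) (simp_all add: ev)
  have G20: "S 0 0 0 - S 0 0 3 - S 3 0 1 - S 4 0 0 + S 4 0 1 - S 4 0 3 + S 4 0 4 - S 5 0 4 = 0"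
    by (rule trans[OF _ h3[of 2 0]]) (simp_all add: ev)
  have G21: "S 0 0 1 - S 0 1 3 - S 3 1 1 - S 4 0 1 + S 4 1 1 - S 4 1 3 + S 4 1 4 - S 5 1 4 = 0"
    by (rule trans[OF _ h3[of 2 1]]) (simp_all add: ev)
  have G22: "S 0 0 2 - S 0 2 3 - S 3 1 2 - S 4 0 2 + S 4 1 2 - S 4 2 3 + S 4 2 4 - S 5 2 4 = 0"
    by (rule trans[OF _ h3[of 2 2]]) (simp_all add: ev)
  have G23: "S 0 0 3 - S 0 3 3 - S 3 1 3 - S 4 0 3 + S 4 1 3 - S 4 3 3 + S 4 3 4 - S 5 3 4 = 0"
    by (rule trans[OF _ h3[of 2 3]]) (simp_all add: ev)
  have G24: "S 0 0 4 - S 0 3 4 - S 3 1 4 - S 4 0 4 + S 4 1 4 - S 4 3 4 + S 4 4 4 - S 5 4 4 = 0"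
    by (rule trans[OF _ h3[of 2 4]]) (simp_all add: ev)
  have G30: "S 0 0 0 - S 0 0 2 - 2 * S 2 0 0 + 2 * S 2 0 4 - S 4 0 0 + S 4 0 1 - S 4 0 2 + S 4 0 4 - S 7 0 1 = 0"
    by (rule trans[OF _ h3[of 3 0]]) (simp_all add: ev)
  have G31: "S 0 0 1 - S 0 1 2 - 2 * S 2 0 1 + 2 * S 2 1 4 - S 4 0 1 + S 4 1 1 - S 4 1 2 + S 4 1 4 - S 7 1 1 = 0"
    by (rule trans[OF _ h3[of 3 1]]) (simp_all add: ev)
  have G32: "S 0 0 2 - S 0 2 2 - 2 * S 2 0 2 + 2 * S 2 2 4 - S 4 0 2 + S 4 1 2 - S 4 2 2 + S 4 2 4 - S 7 1 2 = 0"
    by (rule trans[OF _ h3[of 3 2]]) (simp_all add: ev)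
  have G33: "S 0 0 3 - S 0 2 3 - 2 * S 2 0 3 + 2 * S 2 3 4 - S 4 0 3 + S 4 1 3 - S 4 2 3 + S 4 3 4 - S 7 1 3 = 0"
    by (rule trans[OF _ h3[of 3 3]]) (simp_all add: ev)
  have G34: "S 0 0 4 - S 0 2 4 - 2 * S 2 0 4 + 2 * S 2 4 4 - S 4 0 4 + S 4 1 4 - S 4 2 4 + S 4 4 4 - S 7 1 4 = 0"
    by (rule trans[OF _ h3[of 3 4]]) (simp_all add: ev)
  have G40: "- S 1 0 1 + 4 * S 2 0 0 + 2 * S 2 0 3 - 6 * S 2 0 4 + S 4 0 0 - S 4 0 1 + S 4 0 2 + S 4 0 3 - 2 * S 4 0 4 - S 5 0 2 + S 6 0 0 - 2 * S 6 0 4 = 0"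
    by (rule trans[OF _ h3[of 4 0]]) (simp_all add: ev)
  have G41: "- S 1 1 1 + 4 * S 2 0 1 + 2 * S 2 1 3 - 6 * S 2 1 4 + S 4 0 1 - S 4 1 1 + S 4 1 2 + S 4 1 3 - 2 * S 4 1 4 - S 5 1 2 + S 6 0 1 - 2 * S 6 1 4 = 0"
    by (rule trans[OF _ h3[of 4 1]]) (simp_all add: ev)
  have G42: "- S 1 1 2 + 4 * S 2 0 2 + 2 * S 2 2 3 - 6 * S 2 2 4 + S 4 0 2 - S 4 1 2 + S 4 2 2 + S 4 2 3 - 2 * S 4 2 4 - S 5 2 2 + S 6 0 2 - 2 * S 6 2 4 = 0"
    by (rule trans[OF _ h3[of 4 2]]) (simp_all add: ev)
  have G43: "- S 1 1 3 + 4 * S 2 0 3 + 2 * S 2 3 3 - 6 * S 2 3 4 + S 4 0 3 - S 4 1 3 + S 4 2 3 + S 4 3 3 - 2 * S 4 3 4 - S 5 2 3 + S 6 0 3 - 2 * S 6 3 4 = 0"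
    by (rule trans[OF _ h3[of 4 3]]) (simp_all add: ev)
  have G44: "- S 1 1 4 + 4 * S 2 0 4 + 2 * S 2 3 4 - 6 * S 2 4 4 + S 4 0 4 - S 4 1 4 + S 4 2 4 + S 4 3 4 - 2 * S 4 4 4 - S 5 2 4 + S 6 0 4 - 2 * S 6 4 4 = 0"
    by (rule trans[OF _ h3[of 4 4]]) (simp_all add: ev)
  have [simp]: "S 0 1 4 = 0" "S 0 1 2 = 0" "S 0 2 4 = 0" "S 0 1 3 = 0" "S 1 1 4 = 0" "S 1 1 2 = 0"
    "S 1 2 4 = 0" "S 1 1 3 = 0" "S 2 1 4 = 0" "S 2 1 2 = 0" "S 2 2 4 = 0" "S 2 1 3 = 0"
    "S 3 1 4 = 0" "S 3 1 2 = 0" "S 3 2 4 = 0" "S 3 1 3 = 0" "S 4 1 4 = 0" "S 4 1 2 = 0"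
    "S 4 2 4 = 0" "S 4 1 3 = 0" "S 5 1 4 = 0" "S 5 1 2 = 0" "S 5 2 4 = 0" "S 5 1 3 = 0"
    "S 6 1 4 = 0" "S 6 1 2 = 0" "S 6 2 4 = 0" "S 6 1 3 = 0" "S 7 1 4 = 0" "S 7 1 2 = 0"
    "S 7 2 4 = 0" "S 7 1 3 = 0"
    using Q1[of 0] Q3[of 0] Q5[of 0] Q7[of 0] Q1[of 1] Q3[of 1] Q5[of 1] Q7[of 1] Q1[of 2] Q3[of 2]
      Q5[of 2] Q7[of 2] Q1[of 3] Q3[of 3] Q5[of 3] Q7[of 3] Q1[of 4] Q3[of 4] Q5[of 4] Q7[of 4]
      Q1[of 5] Q3[of 5] Q5[of 5] Q7[of 5] Q1[of 6] Q3[of 6] Q5[of 6] Q7[of 6] Q1[of 7] Q3[of 7]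
      Q5[of 7] Q7[of 7]
    by simp_all
  have [simp]: "S 1 1 1 = 0" "S 1 4 4 = 0" "S 1 2 2 = 0" "S 3 1 1 = 0" "S 3 2 2 = 0" "S 3 4 4 = 0"
    "S 5 1 1 = 0" "S 5 2 2 = 0" "S 5 4 4 = 0" "S 7 1 1 = 0" "S 7 3 3 = 0"
    using T11 T14 T12 T31 T32 T34 T51 T52 T54 T71
      T73
    by simp_all
  have [simp]: "S 1 0 4 = 0" "S 3 0 4 = 0" "S 5 0 4 = 0"
    using Q6[of 1] Q6[of 3] Q6[of 5]
    by simp_all
  have [simp]: "S 6 0 0 = 2 * S 6 0 4"
    by (rule solve_two_terms[of "-1" _ "2", OF trans[OF _ T60]])
      (simp_all add: algebra_simps)
  have [simp]: "S 1 0 0 = 2 * S 1 0 1"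
    by (rule solve_two_terms[of "1" _ "-2", OF trans[OF _ T10]])
      (simp_all add: algebra_simps)
  have [simp]: "S 1 3 3 = 2 * S 1 3 4"
    by (rule solve_two_terms[of "1" _ "-2", OF trans[OF _ T13]])
      (simp_all add: algebra_simps)
  have [simp]: "S 3 3 3 = 2 * S 3 2 3"
    by (rule solve_two_terms[of "1" _ "-2", OF trans[OF _ T33]])
      (simp_all add: algebra_simps)
  have [simp]: "S 5 0 0 = 2 * S 5 0 2"
    by (rule solve_two_terms[of "1" _ "-2", OF trans[OF _ T50]])
      (simp_all add: algebra_simps)
  have [simp]: "S 6 1 1 = 2 * S 6 0 1"
    by (rule solve_two_terms[of "1" _ "-2", OF trans[OF _ T61]])
      (simp_all add: algebra_simps)
  have [simp]: "S 6 2 2 = 2 * S 6 0 2"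
    by (rule solve_two_terms[of "1" _ "-2", OF trans[OF _ T62]])
      (simp_all add: algebra_simps)
  have [simp]: "S 7 2 2 = 2 * S 7 2 3"
    by (rule solve_two_terms[of "1" _ "-2", OF trans[OF _ T72]])
      (simp_all add: algebra_simps)
  have [simp]: "S 7 4 4 = 2 * S 7 3 4"
    by (rule solve_two_terms[of "1" _ "-2", OF trans[OF _ T74]])
      (simp_all add: algebra_simps)
  \<comment> \<open>The only entries left in row 1 are \<open>S i 0 1\<close> and
    \<open>S i 1 1\<close>, so the T- and G-equations with second index 1 form a small system of
    their own.\<close>
  have [simp]: "S 0 1 1 = -2 * S 0 0 1"
    by (rule solve_two_terms[of "1" _ "2", OF trans[OF _ T01]])
      (simp_all add: algebra_simps)
  have [simp]: "S 2 1 1 = 4 * S 2 0 1"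
    by (rule solve_two_terms[of "1" _ "-4", OF trans[OF _ T21]])
      (simp_all add: algebra_simps)
  have [simp]: "S 4 0 1 = 2 * S 4 1 1"
    by (rule solve_two_terms[of "1" _ "-2", OF trans[OF _ G11]])
      (simp_all add: algebra_simps)
  have [simp]: "S 4 1 1 = 0"
    using T41
    by simp_all
  have [simp]: "S 0 0 1 = 0"
    using G21
    by simp_all
  have [simp]: "S 2 0 1 = 0"
    using G31
    by simp_all
  have [simp]: "S 6 0 1 = 0"
    using G41
    by simp_all
  \<comment> \<open>Column 4 separates likewise: only \<open>S i 0 4\<close>, \<open>S i 3 4\<close>
    and \<open>S i 4 4\<close> are left in it, and Q6 identifies the first with the last.\<close>
  have [simp]: "S 0 4 4 = 1 * S 0 0 4"
    by (rule solve_two_terms[of "-2" _ "2", OF trans[OF _ Q6[of 0]]])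
      (simp_all add: algebra_simps)
  have [simp]: "S 2 4 4 = 1 * S 2 0 4"
    by (rule solve_two_terms[of "-2" _ "2", OF trans[OF _ Q6[of 2]]])
      (simp_all add: algebra_simps)
  have [simp]: "S 2 0 4 = 2 * S 2 3 4"
    by (rule solve_two_terms[of "1" _ "-2", OF trans[OF _ T24]])
      (simp_all add: algebra_simps)
  have [simp]: "S 4 4 4 = 1 * S 4 0 4"
    by (rule solve_two_terms[of "-2" _ "2", OF trans[OF _ Q6[of 4]]])
      (simp_all add: algebra_simps)
  have [simp]: "S 0 0 4 = 0"
    using G34
    by simp_all
  have [simp]: "S 0 3 4 = 0"
    using T04
    by simp_all
  have [simp]: "S 4 3 4 = 0"
    using G24
    by simp_all
  have [simp]: "S 4 0 4 = 0" "S 7 3 4 = 0"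
    using T44 G14
    by simp_all
  have [simp]: "S 7 0 4 = 0"
    using Q6[of 7]
    by simp_all
  have [simp]: "S 6 4 4 = -2 * S 2 3 4"
    by (rule solve_two_terms[of "1" _ "2", OF trans[OF _ G04]])
      (simp_all add: algebra_simps)
  have [simp]: "S 6 0 4 = -2 * S 2 3 4"
    by (rule solve_two_terms[of "1" _ "2", OF trans[OF _ G44]])
      (simp_all add: algebra_simps)
  have [simp]: "S 2 3 4 = 0"
    using T64
    by simp_all
  \<comment> \<open>Now \<open>S 2\<close>, \<open>S 0\<close> and \<open>S 4\<close> are finished
    in this order; their vanishing shortens the G-equations for the other matrices.\<close>
  have [simp]: "S 2 3 3 = -4 * S 2 0 3"
    by (rule solve_two_terms[of "-1" _ "-4", OF trans[OF _ T23]])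
      (simp_all add: algebra_simps)
  have [simp]: "S 2 0 0 = (-2 / 3) * S 2 0 3"
    by (rule solve_two_terms[of "-3" _ "-2", OF trans[OF _ T20]])
      (simp_all add: algebra_simps)
  have [simp]: "S 2 0 3 = 0"
    using Q2[of 2]
    by simp_all
  have [simp]: "S 2 2 3 = 1 * S 2 0 2"
    by (rule solve_two_terms[of "-2" _ "2", OF trans[OF _ Q0[of 2]]])
      (simp_all add: algebra_simps)
  have [simp]: "S 2 0 2 = 0"
    using Q4[of 2]
    by simp_all
  have [simp]: "S 2 2 2 = 0"
    using T22
    by simp_all
  have [simp]: "S 0 0 0 = -2 * S 0 0 3"
    by (rule solve_two_terms[of "-2" _ "-4", OF trans[OF _ Q2[of 0]]])
      (simp_all add: algebra_simps)
  have [simp]: "S 0 0 2 = -4 * S 0 0 3"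
    by (rule solve_two_terms[of "-2" _ "-8", OF trans[OF _ T00]])
      (simp_all add: algebra_simps)
  have [simp]: "S 0 2 3 = -1 * S 0 0 3"
    by (rule solve_two_terms[of "-2" _ "-2", OF trans[OF _ Q0[of 0]]])
      (simp_all add: algebra_simps)
  have [simp]: "S 0 0 3 = 0"
    using Q4[of 0]
    by simp_all
  have [simp]: "S 0 3 3 = 0" "S 0 2 2 = 0"
    using T03 T02
    by simp_all
  have [simp]: "S 4 0 2 = -1 * S 4 2 3"
    by (rule solve_two_terms[of "-1" _ "-1", OF trans[OF _ G22]])
      (simp_all add: algebra_simps)
  have [simp]: "S 4 2 2 = 0"
    using T42
    by simp_all
  have [simp]: "S 7 2 3 = 0" "S 4 2 3 = 0" "S 6 0 2 = 0"
    using G12 G32 G42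
    by simp_all
  have [simp]: "S 4 0 3 = 0"
    using G33
    by simp_all
  have [simp]: "S 4 3 3 = 0" "S 4 0 0 = 0"
    using T43 T40
    by simp_all
  have [simp]: "S 5 3 4 = 0" "S 3 0 1 = 0" "S 6 3 4 = 0" "S 7 0 1 = 0"
    using G23 G20 G03 G30
    by simp_all
  have [simp]: "S 6 0 3 = 0"
    using Q2[of 6]
    by simp_all
  have [simp]: "S 6 3 3 = 0" "S 5 2 3 = 0" "S 6 2 3 = 0"
    using T63 G43 Q0[of 6]
    by simp_all
  have [simp]: "S 5 3 3 = 0"
    using T53
    by simp_all
  have [simp]: "S 1 3 4 = -1 * S 3 2 3"
    by (rule solve_two_terms[of "-1" _ "-1", OF trans[OF _ G13]])
      (simp_all add: algebra_simps)
  have [simp]: "S 3 0 2 = -1 * S 7 0 3"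
    by (rule solve_two_terms[of "-1" _ "-1", OF trans[OF _ G10]])
      (simp_all add: algebra_simps)
  have [simp]: "S 1 0 1 = -1 * S 5 0 2"
    by (rule solve_two_terms[of "-1" _ "-1", OF trans[OF _ G40]])
      (simp_all add: algebra_simps)
  have [simp]: "S 7 0 0 = 2 * S 7 0 3"
    by (rule solve_two_terms[of "1" _ "-2", OF trans[OF _ T70]])
      (simp_all add: algebra_simps)
  have [simp]: "S 7 0 3 = 0"
    using Q2[of 7]
    by simp_all
  have [simp]: "S 3 0 0 = 0" "S 7 0 2 = 0"
    using T30 Q0[of 7]
    by simp_all
  have [simp]: "S 5 0 3 = 1 * S 5 0 2"
    by (rule solve_two_terms[of "2" _ "-2", OF trans[OF _ Q0[of 5]]])
      (simp_all add: algebra_simps)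
  have [simp]: "S 5 0 2 = 0"
    using Q2[of 5]
    by simp_all
  have [simp]: "S 5 0 1 = 0"
    using Q4[of 5]
    by simp_all
  have [simp]: "S 3 0 3 = 1 * S 3 2 3"
    by (rule solve_two_terms[of "2" _ "-2", OF trans[OF _ Q0[of 3]]])
      (simp_all add: algebra_simps)
  have [simp]: "S 3 3 4 = 1 * S 3 2 3"
    by (rule solve_two_terms[of "4" _ "-4", OF trans[OF _ Q2[of 3]]])
      (simp_all add: algebra_simps)
  have [simp]: "S 3 2 3 = 0"
    using Q4[of 3]
    by simp_all
  have [simp]: "S 1 0 3 = 0"
    using Q2[of 1]
    by simp_all
  have [simp]: "S 1 0 2 = 1 * S 1 2 3"
    by (rule solve_two_terms[of "2" _ "-2", OF trans[OF _ Q0[of 1]]])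
      (simp_all add: algebra_simps)
  have [simp]: "S 1 2 3 = 0"
    using Q4[of 1]
    by simp_all
  show "\<forall>i<8. \<forall>p<5. \<forall>l<5. S i p l = 0"
    by (simp add: all_less_5 all_less_8 symmetric_entries[of S, OF sym])
qed

section \<open>The case r = 9\<close>

definition base_points_9 :: "nat \<Rightarrow> nat \<Rightarrow> 'a::comm_ring_1" where
  "base_points_9 i p =
    ([[0, 0, 1, 1, 0],
     [0, 1, 1, 0, 1],
     [1, 0, 1, 0, 1],
     [0, 1, 0, 1, 0],
     [0, 1, 0, 0, 1],
     [1, 0, 0, -1, 1],
     [-1, 1, 0, 0, 1],
     [1, 0, 1, 0, 0],
     [0, 0, 0, 1, 1]] ! i) ! p"

text \<open>With surplus 15 and five points that are sums of two unit vectors, the elimination can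
  be made triangular: each equation used has a single unknown left, so no entry has to be expressed
  through another one.\<close>

lemma rigid_base_points_9: "rigid 9 (base_points_9 :: nat \<Rightarrow> nat \<Rightarrow> 'a::field_char_0)"
proof (rule rigidI)
  let ?a = "base_points_9 :: nat \<Rightarrow> nat \<Rightarrow> 'a"
  have A: "?a 0 0 = 0" "?a 0 1 = 0" "?a 0 2 = 1" "?a 0 3 = 1" "?a 0 4 = 0"
    "?a 1 0 = 0" "?a 1 1 = 1" "?a 1 2 = 1" "?a 1 3 = 0" "?a 1 4 = 1"
    "?a 2 0 = 1" "?a 2 1 = 0" "?a 2 2 = 1" "?a 2 3 = 0" "?a 2 4 = 1"
    "?a 3 0 = 0" "?a 3 1 = 1" "?a 3 2 = 0" "?a 3 3 = 1" "?a 3 4 = 0"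
    "?a 4 0 = 0" "?a 4 1 = 1" "?a 4 2 = 0" "?a 4 3 = 0" "?a 4 4 = 1"
    "?a 5 0 = 1" "?a 5 1 = 0" "?a 5 2 = 0" "?a 5 3 = -1" "?a 5 4 = 1"
    "?a 6 0 = -1" "?a 6 1 = 1" "?a 6 2 = 0" "?a 6 3 = 0" "?a 6 4 = 1"
    "?a 7 0 = 1" "?a 7 1 = 0" "?a 7 2 = 1" "?a 7 3 = 0" "?a 7 4 = 0"
    "?a 8 0 = 0" "?a 8 1 = 0" "?a 8 2 = 0" "?a 8 3 = 1" "?a 8 4 = 1"
    by (simp_all add: base_points_9_def)
  fix S :: "nat \<Rightarrow> nat \<Rightarrow> nat \<Rightarrow> 'a"
  assume sym: "\<And>i p l. S i p l = S i l p"
  note [simp del] = One_nat_def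
  assume h1: "\<And>i j. i < 9 \<Longrightarrow> j < 9 \<Longrightarrow> (\<Sum>p<5. \<Sum>l<5. q_mat (?a j) p l * S i p l) = 0"
    and h2: "\<And>i p. i < 9 \<Longrightarrow> p < 5 \<Longrightarrow> S i p p - 2 * (\<Sum>l<5. ?a i l * S i p l) = 0"
    and h3: "\<And>k p. k < 5 \<Longrightarrow> p < 5 \<Longrightarrow> (\<Sum>i<9. \<Sum>l<5. q_mat (?a i) k l * S i l p) = 0"
  note ev = sum_5 sum_9 q_mat_def A symmetric_entries[of S, OF sym] algebra_simps
  have Q0: "- 2 * S i 2 3 = 0" if "i < 9" for i
    by (rule trans[OF _ h1[OF that, of 0]]) (simp_all add: ev)
  have Q1: "- 2 * S i 1 2 - 2 * S i 1 4 - 2 * S i 2 4 = 0" if "i < 9" for i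
    by (rule trans[OF _ h1[OF that, of 1]]) (simp_all add: ev)
  have Q2: "- 2 * S i 0 2 - 2 * S i 0 4 - 2 * S i 2 4 = 0" if "i < 9" for i
    by (rule trans[OF _ h1[OF that, of 2]]) (simp_all add: ev)
  have Q3: "- 2 * S i 1 3 = 0" if "i < 9" for i
    by (rule trans[OF _ h1[OF that, of 3]]) (simp_all add: ev)
  have Q4: "- 2 * S i 1 4 = 0" if "i < 9" for i
    by (rule trans[OF _ h1[OF that, of 4]]) (simp_all add: ev)
  have Q5: "2 * S i 0 3 - 2 * S i 0 4 - 2 * S i 3 3 + 2 * S i 3 4 = 0" if "i < 9" for i
    by (rule trans[OF _ h1[OF that, of 5]]) (simp_all add: ev)
  have Q6: "- 2 * S i 0 0 + 2 * S i 0 1 + 2 * S i 0 4 - 2 * S i 1 4 = 0" if "i < 9" for i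
    by (rule trans[OF _ h1[OF that, of 6]]) (simp_all add: ev)
  have Q7: "- 2 * S i 0 2 = 0" if "i < 9" for i
    by (rule trans[OF _ h1[OF that, of 7]]) (simp_all add: ev)
  have Q8: "- 2 * S i 3 4 = 0" if "i < 9" for i
    by (rule trans[OF _ h1[OF that, of 8]]) (simp_all add: ev)
  have T00: "S 0 0 0 - 2 * S 0 0 2 - 2 * S 0 0 3 = 0"
    by (rule trans[OF _ h2[of 0 0]]) (simp_all add: ev)
  have T01: "S 0 1 1 - 2 * S 0 1 2 - 2 * S 0 1 3 = 0"
    by (rule trans[OF _ h2[of 0 1]]) (simp_all add: ev)
  have T02: "- S 0 2 2 - 2 * S 0 2 3 = 0"
    by (rule trans[OF _ h2[of 0 2]]) (simp_all add: ev)
  have T03: "- 2 * S 0 2 3 - S 0 3 3 = 0"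
    by (rule trans[OF _ h2[of 0 3]]) (simp_all add: ev)
  have T04: "- 2 * S 0 2 4 - 2 * S 0 3 4 + S 0 4 4 = 0"
    by (rule trans[OF _ h2[of 0 4]]) (simp_all add: ev)
  have T10: "S 1 0 0 - 2 * S 1 0 1 - 2 * S 1 0 2 - 2 * S 1 0 4 = 0"
    by (rule trans[OF _ h2[of 1 0]]) (simp_all add: ev)
  have T11: "- S 1 1 1 - 2 * S 1 1 2 - 2 * S 1 1 4 = 0"
    by (rule trans[OF _ h2[of 1 1]]) (simp_all add: ev)
  have T12: "- 2 * S 1 1 2 - S 1 2 2 - 2 * S 1 2 4 = 0"
    by (rule trans[OF _ h2[of 1 2]]) (simp_all add: ev)
  have T13: "- 2 * S 1 1 3 - 2 * S 1 2 3 + S 1 3 3 - 2 * S 1 3 4 = 0"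
    by (rule trans[OF _ h2[of 1 3]]) (simp_all add: ev)
  have T14: "- 2 * S 1 1 4 - 2 * S 1 2 4 - S 1 4 4 = 0"
    by (rule trans[OF _ h2[of 1 4]]) (simp_all add: ev)
  have T20: "- S 2 0 0 - 2 * S 2 0 2 - 2 * S 2 0 4 = 0"
    by (rule trans[OF _ h2[of 2 0]]) (simp_all add: ev)
  have T21: "- 2 * S 2 0 1 + S 2 1 1 - 2 * S 2 1 2 - 2 * S 2 1 4 = 0"
    by (rule trans[OF _ h2[of 2 1]]) (simp_all add: ev)
  have T22: "- 2 * S 2 0 2 - S 2 2 2 - 2 * S 2 2 4 = 0"
    by (rule trans[OF _ h2[of 2 2]]) (simp_all add: ev)
  have T23: "- 2 * S 2 0 3 - 2 * S 2 2 3 + S 2 3 3 - 2 * S 2 3 4 = 0"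
    by (rule trans[OF _ h2[of 2 3]]) (simp_all add: ev)
  have T24: "- 2 * S 2 0 4 - 2 * S 2 2 4 - S 2 4 4 = 0"
    by (rule trans[OF _ h2[of 2 4]]) (simp_all add: ev)
  have T30: "S 3 0 0 - 2 * S 3 0 1 - 2 * S 3 0 3 = 0"
    by (rule trans[OF _ h2[of 3 0]]) (simp_all add: ev)
  have T31: "- S 3 1 1 - 2 * S 3 1 3 = 0"
    by (rule trans[OF _ h2[of 3 1]]) (simp_all add: ev)
  have T32: "- 2 * S 3 1 2 + S 3 2 2 - 2 * S 3 2 3 = 0"
    by (rule trans[OF _ h2[of 3 2]]) (simp_all add: ev)
  have T33: "- 2 * S 3 1 3 - S 3 3 3 = 0"
    by (rule trans[OF _ h2[of 3 3]]) (simp_all add: ev)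
  have T34: "- 2 * S 3 1 4 - 2 * S 3 3 4 + S 3 4 4 = 0"
    by (rule trans[OF _ h2[of 3 4]]) (simp_all add: ev)
  have T40: "S 4 0 0 - 2 * S 4 0 1 - 2 * S 4 0 4 = 0"
    by (rule trans[OF _ h2[of 4 0]]) (simp_all add: ev)
  have T41: "- S 4 1 1 - 2 * S 4 1 4 = 0"
    by (rule trans[OF _ h2[of 4 1]]) (simp_all add: ev)
  have T42: "- 2 * S 4 1 2 + S 4 2 2 - 2 * S 4 2 4 = 0"
    by (rule trans[OF _ h2[of 4 2]]) (simp_all add: ev)
  have T43: "- 2 * S 4 1 3 + S 4 3 3 - 2 * S 4 3 4 = 0"
    by (rule trans[OF _ h2[of 4 3]]) (simp_all add: ev)
  have T44: "- 2 * S 4 1 4 - S 4 4 4 = 0"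
    by (rule trans[OF _ h2[of 4 4]]) (simp_all add: ev)
  have T50: "- S 5 0 0 + 2 * S 5 0 3 - 2 * S 5 0 4 = 0"
    by (rule trans[OF _ h2[of 5 0]]) (simp_all add: ev)
  have T51: "- 2 * S 5 0 1 + S 5 1 1 + 2 * S 5 1 3 - 2 * S 5 1 4 = 0"
    by (rule trans[OF _ h2[of 5 1]]) (simp_all add: ev)
  have T52: "- 2 * S 5 0 2 + S 5 2 2 + 2 * S 5 2 3 - 2 * S 5 2 4 = 0"
    by (rule trans[OF _ h2[of 5 2]]) (simp_all add: ev)
  have T54: "- 2 * S 5 0 4 + 2 * S 5 3 4 - S 5 4 4 = 0"
    by (rule trans[OF _ h2[of 5 4]]) (simp_all add: ev)
  have T60: "3 * S 6 0 0 - 2 * S 6 0 1 - 2 * S 6 0 4 = 0"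
    by (rule trans[OF _ h2[of 6 0]]) (simp_all add: ev)
  have T61: "2 * S 6 0 1 - S 6 1 1 - 2 * S 6 1 4 = 0"
    by (rule trans[OF _ h2[of 6 1]]) (simp_all add: ev)
  have T62: "2 * S 6 0 2 - 2 * S 6 1 2 + S 6 2 2 - 2 * S 6 2 4 = 0"
    by (rule trans[OF _ h2[of 6 2]]) (simp_all add: ev)
  have T63: "2 * S 6 0 3 - 2 * S 6 1 3 + S 6 3 3 - 2 * S 6 3 4 = 0"
    by (rule trans[OF _ h2[of 6 3]]) (simp_all add: ev)
  have T64: "2 * S 6 0 4 - 2 * S 6 1 4 - S 6 4 4 = 0"
    by (rule trans[OF _ h2[of 6 4]]) (simp_all add: ev)
  have T70: "- S 7 0 0 - 2 * S 7 0 2 = 0"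
    by (rule trans[OF _ h2[of 7 0]]) (simp_all add: ev)
  have T71: "- 2 * S 7 0 1 + S 7 1 1 - 2 * S 7 1 2 = 0"
    by (rule trans[OF _ h2[of 7 1]]) (simp_all add: ev)
  have T72: "- 2 * S 7 0 2 - S 7 2 2 = 0"
    by (rule trans[OF _ h2[of 7 2]]) (simp_all add: ev)
  have T73: "- 2 * S 7 0 3 - 2 * S 7 2 3 + S 7 3 3 = 0"
    by (rule trans[OF _ h2[of 7 3]]) (simp_all add: ev)
  have T74: "- 2 * S 7 0 4 - 2 * S 7 2 4 + S 7 4 4 = 0"
    by (rule trans[OF _ h2[of 7 4]]) (simp_all add: ev)
  have T80: "S 8 0 0 - 2 * S 8 0 3 - 2 * S 8 0 4 = 0"
    by (rule trans[OF _ h2[of 8 0]]) (simp_all add: ev)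
  have T81: "S 8 1 1 - 2 * S 8 1 3 - 2 * S 8 1 4 = 0"
    by (rule trans[OF _ h2[of 8 1]]) (simp_all add: ev)
  have T82: "S 8 2 2 - 2 * S 8 2 3 - 2 * S 8 2 4 = 0"
    by (rule trans[OF _ h2[of 8 2]]) (simp_all add: ev)
  have T83: "- S 8 3 3 - 2 * S 8 3 4 = 0"
    by (rule trans[OF _ h2[of 8 3]]) (simp_all add: ev)
  have T84: "- 2 * S 8 3 4 - S 8 4 4 = 0"
    by (rule trans[OF _ h2[of 8 4]]) (simp_all add: ev)
  have G01: "- S 2 1 2 - S 2 1 4 + S 5 1 3 - S 5 1 4 - 2 * S 6 0 1 + S 6 1 1 + S 6 1 4 - S 7 1 2 = 0"
    by (rule trans[OF _ h3[of 0 1]]) (simp_all add: ev)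
  have G02: "- S 2 2 2 - S 2 2 4 + S 5 2 3 - S 5 2 4 - 2 * S 6 0 2 + S 6 1 2 + S 6 2 4 - S 7 2 2 = 0"
    by (rule trans[OF _ h3[of 0 2]]) (simp_all add: ev)
  have G03: "- S 2 2 3 - S 2 3 4 + S 5 3 3 - S 5 3 4 - 2 * S 6 0 3 + S 6 1 3 + S 6 3 4 - S 7 2 3 = 0"
    by (rule trans[OF _ h3[of 0 3]]) (simp_all add: ev)
  have G04: "- S 2 2 4 - S 2 4 4 + S 5 3 4 - S 5 4 4 - 2 * S 6 0 4 + S 6 1 4 + S 6 4 4 - S 7 2 4 = 0"
    by (rule trans[OF _ h3[of 0 4]]) (simp_all add: ev)
  have G10: "- S 1 0 2 - S 1 0 4 - S 3 0 3 - S 4 0 4 + S 6 0 0 - S 6 0 4 = 0"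
    by (rule trans[OF _ h3[of 1 0]]) (simp_all add: ev)
  have G11: "- S 1 1 2 - S 1 1 4 - S 3 1 3 - S 4 1 4 + S 6 0 1 - S 6 1 4 = 0"
    by (rule trans[OF _ h3[of 1 1]]) (simp_all add: ev)
  have G12: "- S 1 2 2 - S 1 2 4 - S 3 2 3 - S 4 2 4 + S 6 0 2 - S 6 2 4 = 0"
    by (rule trans[OF _ h3[of 1 2]]) (simp_all add: ev)
  have G13: "- S 1 2 3 - S 1 3 4 - S 3 3 3 - S 4 3 4 + S 6 0 3 - S 6 3 4 = 0"
    by (rule trans[OF _ h3[of 1 3]]) (simp_all add: ev)
  have G20: "- S 0 0 3 - S 1 0 1 - S 1 0 4 - S 2 0 0 - S 2 0 4 - S 7 0 0 = 0"
    by (rule trans[OF _ h3[of 2 0]]) (simp_all add: ev)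
  have G21: "- S 0 1 3 - S 1 1 1 - S 1 1 4 - S 2 0 1 - S 2 1 4 - S 7 0 1 = 0"
    by (rule trans[OF _ h3[of 2 1]]) (simp_all add: ev)
  have G22: "- S 0 2 3 - S 1 1 2 - S 1 2 4 - S 2 0 2 - S 2 2 4 - S 7 0 2 = 0"
    by (rule trans[OF _ h3[of 2 2]]) (simp_all add: ev)
  have G23: "- S 0 3 3 - S 1 1 3 - S 1 3 4 - S 2 0 3 - S 2 3 4 - S 7 0 3 = 0"
    by (rule trans[OF _ h3[of 2 3]]) (simp_all add: ev)
  have G24: "- S 0 3 4 - S 1 1 4 - S 1 4 4 - S 2 0 4 - S 2 4 4 - S 7 0 4 = 0"
    by (rule trans[OF _ h3[of 2 4]]) (simp_all add: ev)
  have G30: "- S 0 0 2 - S 3 0 1 + S 5 0 0 - 2 * S 5 0 3 + S 5 0 4 - S 8 0 4 = 0"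
    by (rule trans[OF _ h3[of 3 0]]) (simp_all add: ev)
  have G31: "- S 0 1 2 - S 3 1 1 + S 5 0 1 - 2 * S 5 1 3 + S 5 1 4 - S 8 1 4 = 0"
    by (rule trans[OF _ h3[of 3 1]]) (simp_all add: ev)
  have G32: "- S 0 2 2 - S 3 1 2 + S 5 0 2 - 2 * S 5 2 3 + S 5 2 4 - S 8 2 4 = 0"
    by (rule trans[OF _ h3[of 3 2]]) (simp_all add: ev)
  have G33: "- S 0 2 3 - S 3 1 3 + S 5 0 3 - 2 * S 5 3 3 + S 5 3 4 - S 8 3 4 = 0"
    by (rule trans[OF _ h3[of 3 3]]) (simp_all add: ev)
  have G34: "- S 0 2 4 - S 3 1 4 + S 5 0 4 - 2 * S 5 3 4 + S 5 4 4 - S 8 4 4 = 0"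
    by (rule trans[OF _ h3[of 3 4]]) (simp_all add: ev)
  have G40: "- S 1 0 1 - S 1 0 2 - S 2 0 0 - S 2 0 2 - S 4 0 1 - S 5 0 0 + S 5 0 3 + S 6 0 0 - S 6 0 1 - S 8 0 3 = 0"
    by (rule trans[OF _ h3[of 4 0]]) (simp_all add: ev)
  have G42: "- S 1 1 2 - S 1 2 2 - S 2 0 2 - S 2 2 2 - S 4 1 2 - S 5 0 2 + S 5 2 3 + S 6 0 2 - S 6 1 2 - S 8 2 3 = 0"
    by (rule trans[OF _ h3[of 4 2]]) (simp_all add: ev)
  have G43: "- S 1 1 3 - S 1 2 3 - S 2 0 3 - S 2 2 3 - S 4 1 3 - S 5 0 3 + S 5 3 3 + S 6 0 3 - S 6 1 3 - S 8 3 3 = 0"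
    by (rule trans[OF _ h3[of 4 3]]) (simp_all add: ev)
  have G44: "- S 1 1 4 - S 1 2 4 - S 2 0 4 - S 2 2 4 - S 4 1 4 - S 5 0 4 + S 5 3 4 + S 6 0 4 - S 6 1 4 - S 8 3 4 = 0"
    by (rule trans[OF _ h3[of 4 4]]) (simp_all add: ev)
  have [simp]: "S 0 2 3 = 0" "S 0 1 3 = 0" "S 0 1 4 = 0" "S 0 0 2 = 0" "S 0 3 4 = 0" "S 1 2 3 = 0"
    "S 1 1 3 = 0" "S 1 1 4 = 0" "S 1 0 2 = 0" "S 1 3 4 = 0" "S 2 2 3 = 0" "S 2 1 3 = 0"
    "S 2 1 4 = 0" "S 2 0 2 = 0" "S 2 3 4 = 0" "S 3 2 3 = 0" "S 3 1 3 = 0" "S 3 1 4 = 0"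
    "S 3 0 2 = 0" "S 3 3 4 = 0" "S 4 2 3 = 0" "S 4 1 3 = 0" "S 4 1 4 = 0" "S 4 0 2 = 0"
    "S 4 3 4 = 0" "S 5 2 3 = 0" "S 5 1 3 = 0" "S 5 1 4 = 0" "S 5 0 2 = 0" "S 5 3 4 = 0"
    "S 6 2 3 = 0" "S 6 1 3 = 0" "S 6 1 4 = 0" "S 6 0 2 = 0" "S 6 3 4 = 0" "S 7 2 3 = 0"
    "S 7 1 3 = 0" "S 7 1 4 = 0" "S 7 0 2 = 0" "S 7 3 4 = 0"
    using Q0[of 0] Q3[of 0] Q4[of 0] Q7[of 0] Q8[of 0] Q0[of 1] Q3[of 1] Q4[of 1] Q7[of 1] Q8[of 1]
      Q0[of 2] Q3[of 2] Q4[of 2] Q7[of 2] Q8[of 2] Q0[of 3] Q3[of 3] Q4[of 3] Q7[of 3] Q8[of 3]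
      Q0[of 4] Q3[of 4] Q4[of 4] Q7[of 4] Q8[of 4] Q0[of 5] Q3[of 5] Q4[of 5] Q7[of 5] Q8[of 5]
      Q0[of 6] Q3[of 6] Q4[of 6] Q7[of 6] Q8[of 6] Q0[of 7] Q3[of 7] Q4[of 7] Q7[of 7] Q8[of 7]
    by simp_all
  have [simp]: "S 0 2 2 = 0" "S 0 3 3 = 0" "S 1 3 3 = 0" "S 3 1 1 = 0" "S 3 3 3 = 0" "S 3 4 4 = 0"
    "S 4 1 1 = 0" "S 4 4 4 = 0" "S 4 3 3 = 0" "S 7 0 0 = 0" "S 7 2 2 = 0" "S 8 2 3 = 0"
    "S 8 1 3 = 0" "S 8 1 4 = 0" "S 8 0 2 = 0" "S 8 3 4 = 0"
    using T02 T03 T13 T31 T33 T34 T41 T44 T43 T70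
      T72 Q0[of 8] Q3[of 8] Q4[of 8] Q7[of 8] Q8[of 8]
    by simp_all
  have [simp]: "S 6 0 3 = 0" "S 8 1 1 = 0" "S 8 3 3 = 0" "S 8 4 4 = 0"
    using G13 T81 T83 T84
    by simp_all
  have [simp]: "S 6 3 3 = 0" "S 5 3 3 = 0"
    using T63 G03
    by simp_all
  have [simp]: "S 5 0 3 = 0" "S 6 0 4 = 0"
    using G33 Q5[of 6]
    by simp_all
  have [simp]: "S 2 0 3 = 0" "S 5 0 4 = 0" "S 6 4 4 = 0" "S 6 2 4 = 0"
    using G43 Q5[of 5] T64 Q2[of 6]
    by simp_all
  have [simp]: "S 2 3 3 = 0" "S 7 0 3 = 0" "S 5 0 0 = 0" "S 5 4 4 = 0" "S 5 2 4 = 0"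
    using T23 G23 T50 T54 Q2[of 5]
    by simp_all
  have [simp]: "S 7 3 3 = 0" "S 2 0 4 = 0" "S 0 2 4 = 0" "S 5 2 2 = 0" "S 5 1 2 = 0"
    using T73 Q5[of 2] G34 T52 Q1[of 5]
    by simp_all
  have [simp]: "S 2 0 0 = 0" "S 2 2 4 = 0" "S 0 4 4 = 0" "S 0 1 2 = 0" "S 0 0 4 = 0"
    using T20 Q2[of 2] T04 Q1[of 0] Q2[of 0]
    by simp_all
  have [simp]: "S 2 2 2 = 0" "S 2 4 4 = 0" "S 2 1 2 = 0" "S 2 0 1 = 0" "S 0 1 1 = 0" "S 5 0 1 = 0"
    "S 0 0 3 = 0" "S 1 2 4 = 0"
    using T22 T24 Q1[of 2] Q6[of 2] T01 G31 Q5[of 0] G44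
    by simp_all
  have [simp]: "S 2 1 1 = 0" "S 5 1 1 = 0" "S 0 0 0 = 0" "S 7 2 4 = 0" "S 1 4 4 = 0" "S 1 1 2 = 0"
    "S 1 0 4 = 0" "S 6 1 2 = 0"
    using T21 T51 T00 G04 T14 G22 Q2[of 1] G02
    by simp_all
  have [simp]: "S 0 0 1 = 0" "S 1 1 1 = 0" "S 1 2 2 = 0" "S 6 0 1 = 0" "S 7 0 4 = 0" "S 1 0 1 = 0"
    "S 6 2 2 = 0" "S 1 0 3 = 0"
    using Q6[of 0] T11 T12 G11 G24 G20 T62 Q5[of 1]
    by simp_all
  have [simp]: "S 6 1 1 = 0" "S 7 0 1 = 0" "S 7 4 4 = 0" "S 1 0 0 = 0" "S 4 2 4 = 0" "S 4 1 2 = 0"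
    "S 6 0 0 = 0"
    using T61 G21 T74 T10 G12 G42 T60
    by simp_all
  have [simp]: "S 7 1 2 = 0" "S 4 2 2 = 0" "S 4 0 4 = 0"
    using G01 T42 Q2[of 4]
    by simp_all
  have [simp]: "S 7 1 1 = 0" "S 3 0 3 = 0" "S 4 0 3 = 0"
    using T71 G10 Q5[of 4]
    by simp_all
  have [simp]: "S 3 0 4 = 0"
    using Q5[of 3]
    by simp_all
  have [simp]: "S 3 2 4 = 0"
    using Q2[of 3]
    by simp_all
  have [simp]: "S 3 1 2 = 0"
    using Q1[of 3]
    by simp_all
  have [simp]: "S 3 2 2 = 0" "S 8 2 4 = 0"
    using T32 G32
    by simp_all
  have [simp]: "S 8 2 2 = 0" "S 8 1 2 = 0" "S 8 0 4 = 0"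
    using T82 Q1[of 8] Q2[of 8]
    by simp_all
  have [simp]: "S 3 0 1 = 0" "S 8 0 3 = 0"
    using G30 Q5[of 8]
    by simp_all
  have [simp]: "S 3 0 0 = 0" "S 8 0 0 = 0" "S 4 0 1 = 0"
    using T30 T80 G40
    by simp_all
  have [simp]: "S 4 0 0 = 0" "S 8 0 1 = 0"
    using T40 Q6[of 8]
    by simp_all
  show "\<forall>i<9. \<forall>p<5. \<forall>l<5. S i p l = 0"
    by (simp add: all_less_5 all_less_9 symmetric_entries[of S, OF sym])
qed

section \<open>The case r at least 10\<close>

definition base_points_10 :: "nat \<Rightarrow> nat \<Rightarrow> 'a::comm_ring_1" where
  "base_points_10 i p =
    ([[1, 0, 1, 0, 1],
     [0, 1, 1, 0, 1],
     [1, 1, 0, 0, 0],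
     [0, 0, 1, 1, 0],
     [0, -1, 0, 1, 1],
     [0, 1, 0, 0, 1],
     [1, 0, 1, 0, 0],
     [0, 0, 1, 0, 1],
     [0, 1, -1, 1, 0],
     [1, 0, -2, 1, 0]] ! i) ! p"

text \<open>Ten Q-equations and the five T-equations of its own point are 15 equations for the 15
  entries of a matrix, so every matrix is treated separately. Indices from 10 on reuse point
  0.\<close>

lemma rigid_base_points_10:
  assumes "10 \<le> r"
  shows "rigid r (\<lambda>i. base_points_10 (if i < 10 then i else 0) :: nat \<Rightarrow> 'a::field_char_0)"
proof (rule rigidI)
  let ?a = "base_points_10 :: nat \<Rightarrow> nat \<Rightarrow> 'a"
  have A: "?a 0 0 = 1" "?a 0 1 = 0" "?a 0 2 = 1" "?a 0 3 = 0" "?a 0 4 = 1"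
    "?a 1 0 = 0" "?a 1 1 = 1" "?a 1 2 = 1" "?a 1 3 = 0" "?a 1 4 = 1"
    "?a 2 0 = 1" "?a 2 1 = 1" "?a 2 2 = 0" "?a 2 3 = 0" "?a 2 4 = 0"
    "?a 3 0 = 0" "?a 3 1 = 0" "?a 3 2 = 1" "?a 3 3 = 1" "?a 3 4 = 0"
    "?a 4 0 = 0" "?a 4 1 = -1" "?a 4 2 = 0" "?a 4 3 = 1" "?a 4 4 = 1"
    "?a 5 0 = 0" "?a 5 1 = 1" "?a 5 2 = 0" "?a 5 3 = 0" "?a 5 4 = 1"
    "?a 6 0 = 1" "?a 6 1 = 0" "?a 6 2 = 1" "?a 6 3 = 0" "?a 6 4 = 0"
    "?a 7 0 = 0" "?a 7 1 = 0" "?a 7 2 = 1" "?a 7 3 = 0" "?a 7 4 = 1"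
    "?a 8 0 = 0" "?a 8 1 = 1" "?a 8 2 = -1" "?a 8 3 = 1" "?a 8 4 = 0"
    "?a 9 0 = 1" "?a 9 1 = 0" "?a 9 2 = -2" "?a 9 3 = 1" "?a 9 4 = 0"
    by (simp_all add: base_points_10_def)
  fix S :: "nat \<Rightarrow> nat \<Rightarrow> nat \<Rightarrow> 'a"
  assume sym: "\<And>i p l. S i p l = S i l p"
  note [simp del] = One_nat_def
  assume h1: "\<And>i j. i < r \<Longrightarrow> j < r \<Longrightarrow> (\<Sum>p<5. \<Sum>l<5. q_mat (?a (if j < 10 then j else 0)) p l * S i p l) = 0"
    and h2: "\<And>i p. i < r \<Longrightarrow> p < 5 \<Longrightarrow> S i p p - 2 * (\<Sum>l<5. ?a (if i < 10 then i else 0) l * S i p l) = 0"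
  note ev = sum_5 q_mat_def A symmetric_entries[of S, OF sym] algebra_simps
  have h1': "(\<Sum>p<5. \<Sum>l<5. q_mat (?a j) p l * S i p l) = 0" if "i < r" "j < 10" for i j
    using h1[OF that(1), of j] that(2) assms by simp
  have Q0: "- 2 * S i 0 2 - 2 * S i 0 4 - 2 * S i 2 4 = 0" if "i < r" for i
    by (rule trans[OF _ h1'[OF that, of 0]]) (simp_all add: ev)
  have Q1: "- 2 * S i 1 2 - 2 * S i 1 4 - 2 * S i 2 4 = 0" if "i < r" for i
    by (rule trans[OF _ h1'[OF that, of 1]]) (simp_all add: ev)
  have Q2: "- 2 * S i 0 1 = 0" if "i < r" for i
    by (rule trans[OF _ h1'[OF that, of 2]]) (simp_all add: ev)
  have Q3: "- 2 * S i 2 3 = 0" if "i < r" for i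
    by (rule trans[OF _ h1'[OF that, of 3]]) (simp_all add: ev)
  have Q4: "- 2 * S i 1 1 + 2 * S i 1 3 + 2 * S i 1 4 - 2 * S i 3 4 = 0" if "i < r" for i
    by (rule trans[OF _ h1'[OF that, of 4]]) (simp_all add: ev)
  have Q5: "- 2 * S i 1 4 = 0" if "i < r" for i
    by (rule trans[OF _ h1'[OF that, of 5]]) (simp_all add: ev)
  have Q6: "- 2 * S i 0 2 = 0" if "i < r" for i
    by (rule trans[OF _ h1'[OF that, of 6]]) (simp_all add: ev)
  have Q7: "- 2 * S i 2 4 = 0" if "i < r" for i
    by (rule trans[OF _ h1'[OF that, of 7]]) (simp_all add: ev)
  have Q8: "2 * S i 1 2 - 2 * S i 1 3 - 2 * S i 2 2 + 2 * S i 2 3 = 0" if "i < r" for i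
    by (rule trans[OF _ h1'[OF that, of 8]]) (simp_all add: ev)
  have Q9: "4 * S i 0 2 - 2 * S i 0 3 - 6 * S i 2 2 + 4 * S i 2 3 = 0" if "i < r" for i
    by (rule trans[OF _ h1'[OF that, of 9]]) (simp_all add: ev)
  show "\<forall>i<r. \<forall>p<5. \<forall>l<5. S i p l = 0"
  proof (rule allI, rule impI)
    fix i assume i: "i < r"
    \<comment> \<open>The Q-equations are the same for every i, and the T-equations depend on i only
      through its point, so ten cases remain however large r is.\<close>
    define s where "s = (if i < 10 then i else 0)"
    have T: "S i p p - 2 * (\<Sum>l<5. ?a s l * S i p l) = 0" if "p < 5" for p
      using h2[OF i that] by (simp only: s_def)
    have "s < 10" by (simp add: s_def)
    then have "s = 0 \<or> s = 1 \<or> s = 2 \<or> s = 3 \<or> s = 4 \<or> s = 5 \<or> s = 6 \<or> s = 7 \<or> s = 8 \<or> s = 9" by arith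
    then show "\<forall>p<5. \<forall>l<5. S i p l = 0"
    proof (elim disjE)
      assume s: "s = 0"
      \<comment> \<open>In every case the Q-equations kill seven off-diagonal entries: these five,
        then 04 and 12 by Q0 and Q1. The diagonal and the entries 03, 13 and 34 remain, eight
        unknowns for Q4, Q8, Q9 and the five T-equations.\<close>
      from Q2[OF i] Q3[OF i] Q5[OF i] Q6[OF i] Q7[OF i] have [simp]:
        "S i 0 1 = 0" "S i 2 3 = 0" "S i 1 4 = 0" "S i 0 2 = 0" "S i 2 4 = 0"
        by simp_all
      from T[of 2] Q0[OF i] Q1[OF i] have [simp]:
        "S i 2 2 = 0" "S i 0 4 = 0" "S i 1 2 = 0"
        by (simp_all add: s ev)
      from T[of 0] T[of 4] T[of 1] Q8[OF i] Q9[OF i] have [simp]: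
        "S i 0 0 = 0" "S i 4 4 = 0" "S i 1 1 = 0" "S i 1 3 = 0" "S i 0 3 = 0"
        by (simp_all add: s ev)
      from Q4[OF i] have [simp]:
        "S i 3 4 = 0"
        by simp_all
      from T[of 3] have [simp]:
        "S i 3 3 = 0"
        by (simp_all add: s ev)
      show ?thesis by (simp add: symmetric_entries[of S, OF sym] all_less_5)
    next
      assume s: "s = 1"
      from Q2[OF i] Q3[OF i] Q5[OF i] Q6[OF i] Q7[OF i] have [simp]:
        "S i 0 1 = 0" "S i 2 3 = 0" "S i 1 4 = 0" "S i 0 2 = 0" "S i 2 4 = 0"
        by simp_all
      from T[of 4] Q0[OF i] Q1[OF i] have [simp]:
        "S i 4 4 = 0" "S i 0 4 = 0" "S i 1 2 = 0"
        by (simp_all add: s ev)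
      from T[of 0] T[of 1] T[of 2] have [simp]:
        "S i 0 0 = 0" "S i 1 1 = 0" "S i 2 2 = 0"
        by (simp_all add: s ev)
      from Q8[OF i] Q9[OF i] have [simp]:
        "S i 1 3 = 0" "S i 0 3 = 0"
        by simp_all
      from Q4[OF i] have [simp]:
        "S i 3 4 = 0"
        by simp_all
      from T[of 3] have [simp]:
        "S i 3 3 = 0"
        by (simp_all add: s ev)
      show ?thesis by (simp add: symmetric_entries[of S, OF sym] all_less_5)
    next
      assume s: "s = 2"
      from Q2[OF i] Q3[OF i] Q5[OF i] Q6[OF i] Q7[OF i] have [simp]:
        "S i 0 1 = 0" "S i 2 3 = 0" "S i 1 4 = 0" "S i 0 2 = 0" "S i 2 4 = 0"
        by simp_all
      from T[of 0] T[of 1] Q0[OF i] Q1[OF i] have [simp]: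
        "S i 0 0 = 0" "S i 1 1 = 0" "S i 0 4 = 0" "S i 1 2 = 0"
        by (simp_all add: s ev)
      from T[of 4] T[of 2] have [simp]:
        "S i 4 4 = 0" "S i 2 2 = 0"
        by (simp_all add: s ev)
      from Q8[OF i] Q9[OF i] have [simp]:
        "S i 1 3 = 0" "S i 0 3 = 0"
        by simp_all
      from Q4[OF i] T[of 3] have [simp]:
        "S i 3 4 = 0" "S i 3 3 = 0"
        by (simp_all add: s ev)
      show ?thesis by (simp add: symmetric_entries[of S, OF sym] all_less_5)
    next
      assume s: "s = 3"
      from Q2[OF i] Q3[OF i] Q5[OF i] Q6[OF i] Q7[OF i] have [simp]:
        "S i 0 1 = 0" "S i 2 3 = 0" "S i 1 4 = 0" "S i 0 2 = 0" "S i 2 4 = 0"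
        by simp_all
      from T[of 2] T[of 3] Q0[OF i] Q1[OF i] have [simp]:
        "S i 2 2 = 0" "S i 3 3 = 0" "S i 0 4 = 0" "S i 1 2 = 0"
        by (simp_all add: s ev)
      from Q8[OF i] Q9[OF i] have [simp]:
        "S i 1 3 = 0" "S i 0 3 = 0"
        by simp_all
      from T[of 1] T[of 0] have [simp]:
        "S i 1 1 = 0" "S i 0 0 = 0"
        by (simp_all add: s ev)
      from Q4[OF i] have [simp]:
        "S i 3 4 = 0"
        by simp_all
      from T[of 4] have [simp]:
        "S i 4 4 = 0"
        by (simp_all add: s ev)
      show ?thesis by (simp add: symmetric_entries[of S, OF sym] all_less_5)
    next
      assume s: "s = 4"
      from Q2[OF i] Q3[OF i] Q5[OF i] Q6[OF i] Q7[OF i] have [simp]: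
        "S i 0 1 = 0" "S i 2 3 = 0" "S i 1 4 = 0" "S i 0 2 = 0" "S i 2 4 = 0"
        by simp_all
      from Q0[OF i] Q1[OF i] have [simp]:
        "S i 0 4 = 0" "S i 1 2 = 0"
        by simp_all
      from T[of 2] have [simp]:
        "S i 2 2 = 0"
        by (simp_all add: s ev)
      from Q8[OF i] Q9[OF i] have [simp]:
        "S i 1 3 = 0" "S i 0 3 = 0"
        by simp_all
      from T[of 1] T[of 0] have [simp]:
        "S i 1 1 = 0" "S i 0 0 = 0"
        by (simp_all add: s ev)
      from Q4[OF i] have [simp]:
        "S i 3 4 = 0"
        by simp_all
      from T[of 3] T[of 4] have [simp]:
        "S i 3 3 = 0" "S i 4 4 = 0"
        by (simp_all add: s ev)
      show ?thesis by (simp add: symmetric_entries[of S, OF sym] all_less_5)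
    next
      assume s: "s = 5"
      from Q2[OF i] Q3[OF i] Q5[OF i] Q6[OF i] Q7[OF i] have [simp]:
        "S i 0 1 = 0" "S i 2 3 = 0" "S i 1 4 = 0" "S i 0 2 = 0" "S i 2 4 = 0"
        by simp_all
      from T[of 1] T[of 4] Q0[OF i] Q1[OF i] have [simp]:
        "S i 1 1 = 0" "S i 4 4 = 0" "S i 0 4 = 0" "S i 1 2 = 0"
        by (simp_all add: s ev)
      from T[of 0] T[of 2] have [simp]:
        "S i 0 0 = 0" "S i 2 2 = 0"
        by (simp_all add: s ev)
      from Q8[OF i] Q9[OF i] have [simp]:
        "S i 1 3 = 0" "S i 0 3 = 0"
        by simp_all
      from Q4[OF i] have [simp]:
        "S i 3 4 = 0"
        by simp_all
      from T[of 3] have [simp]: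
        "S i 3 3 = 0"
        by (simp_all add: s ev)
      show ?thesis by (simp add: symmetric_entries[of S, OF sym] all_less_5)
    next
      assume s: "s = 6"
      from Q2[OF i] Q3[OF i] Q5[OF i] Q6[OF i] Q7[OF i] have [simp]:
        "S i 0 1 = 0" "S i 2 3 = 0" "S i 1 4 = 0" "S i 0 2 = 0" "S i 2 4 = 0"
        by simp_all
      from T[of 0] T[of 2] Q0[OF i] Q1[OF i] have [simp]:
        "S i 0 0 = 0" "S i 2 2 = 0" "S i 0 4 = 0" "S i 1 2 = 0"
        by (simp_all add: s ev)
      from T[of 4] T[of 1] Q8[OF i] Q9[OF i] have [simp]:
        "S i 4 4 = 0" "S i 1 1 = 0" "S i 1 3 = 0" "S i 0 3 = 0"
        by (simp_all add: s ev)
      from Q4[OF i] T[of 3] have [simp]: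
        "S i 3 4 = 0" "S i 3 3 = 0"
        by (simp_all add: s ev)
      show ?thesis by (simp add: symmetric_entries[of S, OF sym] all_less_5)
    next
      assume s: "s = 7"
      from Q2[OF i] Q3[OF i] Q5[OF i] Q6[OF i] Q7[OF i] have [simp]:
        "S i 0 1 = 0" "S i 2 3 = 0" "S i 1 4 = 0" "S i 0 2 = 0" "S i 2 4 = 0"
        by simp_all
      from T[of 2] T[of 4] Q0[OF i] Q1[OF i] have [simp]:
        "S i 2 2 = 0" "S i 4 4 = 0" "S i 0 4 = 0" "S i 1 2 = 0"
        by (simp_all add: s ev)
      from T[of 0] T[of 1] Q8[OF i] Q9[OF i] have [simp]:
        "S i 0 0 = 0" "S i 1 1 = 0" "S i 1 3 = 0" "S i 0 3 = 0"
        by (simp_all add: s ev)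
      from Q4[OF i] have [simp]:
        "S i 3 4 = 0"
        by simp_all
      from T[of 3] have [simp]:
        "S i 3 3 = 0"
        by (simp_all add: s ev)
      show ?thesis by (simp add: symmetric_entries[of S, OF sym] all_less_5)
    next
      assume s: "s = 8"
      from Q2[OF i] Q3[OF i] Q5[OF i] Q6[OF i] Q7[OF i] have [simp]:
        "S i 0 1 = 0" "S i 2 3 = 0" "S i 1 4 = 0" "S i 0 2 = 0" "S i 2 4 = 0"
        by simp_all
      from Q0[OF i] Q1[OF i] have [simp]:
        "S i 0 4 = 0" "S i 1 2 = 0"
        by simp_all
      from T[of 2] have [simp]:
        "S i 2 2 = 0"
        by (simp_all add: s ev)
      from Q8[OF i] Q9[OF i] have [simp]:
        "S i 1 3 = 0" "S i 0 3 = 0"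
        by simp_all
      from T[of 1] T[of 3] T[of 0] have [simp]:
        "S i 1 1 = 0" "S i 3 3 = 0" "S i 0 0 = 0"
        by (simp_all add: s ev)
      from Q4[OF i] have [simp]:
        "S i 3 4 = 0"
        by simp_all
      from T[of 4] have [simp]:
        "S i 4 4 = 0"
        by (simp_all add: s ev)
      show ?thesis by (simp add: symmetric_entries[of S, OF sym] all_less_5)
    next
      assume s: "s = 9"
      from Q2[OF i] Q3[OF i] Q5[OF i] Q6[OF i] Q7[OF i] have [simp]:
        "S i 0 1 = 0" "S i 2 3 = 0" "S i 1 4 = 0" "S i 0 2 = 0" "S i 2 4 = 0"
        by simp_all
      from Q0[OF i] Q1[OF i] T[of 2] have [simp]:
        "S i 0 4 = 0" "S i 1 2 = 0" "S i 2 2 = 0"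
        by (simp_all add: s ev)
      from Q8[OF i] Q9[OF i] have [simp]:
        "S i 1 3 = 0" "S i 0 3 = 0"
        by simp_all
      from T[of 1] T[of 0] T[of 3] have [simp]:
        "S i 1 1 = 0" "S i 0 0 = 0" "S i 3 3 = 0"
        by (simp_all add: s ev)
      from Q4[OF i] have [simp]:
        "S i 3 4 = 0"
        by simp_all
      from T[of 4] have [simp]:
        "S i 4 4 = 0"
        by (simp_all add: s ev)
      show ?thesis by (simp add: symmetric_entries[of S, OF sym] all_less_5)
    qed
  qed
qed

theorem lemma4p3:
  fixes r :: nat
  assumes "6 \<le> r" and "r \<le> 14"
  shows "dominant
    (Phi_domain r :: ('k::{alg_closed_field, field_char_0} mat \<times> (nat \<Rightarrow> 'k vec)) set)
    (Phi r) (gr_zariski r)"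
proof (cases "10 \<le> r")
  case True
  then show ?thesis by (rule dominant_if_rigid[OF rigid_base_points_10])
next
  case False
  then have "r = 6 \<or> r = 7 \<or> r = 8 \<or> r = 9" using assms(1) by arith
  then show ?thesis
    using dominant_if_rigid[OF rigid_base_points_6] dominant_if_rigid[OF rigid_base_points_7]
      dominant_if_rigid[OF rigid_base_points_8] dominant_if_rigid[OF rigid_base_points_9]
    by blast
qed

end
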